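(* Let $d\ge 1$ be an integer, let $\alpha_1,\dots,\alpha_d\in\mathbb{C}$, and let $M=P_d\,\mathrm{diag}(\alpha_1,\dots,\alpha_d)\in\mathbb{C}^{d,d}$, where $P_d$ is the $d\times d$ cyclic permutation matrix. Then $\psi(M)=\psi_{cb}(M)\le 2$. Furthermore, if $\alpha_1\cdots\alpha_d\neq 0$, then $\psi(M)=\psi_{cb}(M)<2$.
   Context: $\mathbb{C}^{m,m}$ denotes the space of complex $m\times m$ matrices, and $\|\cdot\|$ is the operator norm induced by the Euclidean norm (the largest singular value). The cyclic permutation matrix $P_d=(p_{ij})_{1\le i,j\le d}$ is defined by $p_{d1}=1$, $p_{ij}=1$ if $j-i=1$, and $p_{ij}=0$ otherwise. For a square complex matrix $M\in\mathbb{C}^{d,d}$, $W(M)=\{\langle Mx,x\rangle : x\in\mathbb{C}^d,\ \|x\|=1\}$ is its numerical range. Define $$\psi(M)=\sup\{\|p(M)\| : p \text{ a complex polynomial with } |p(z)|\le 1 \text{ for all } z\in W(M)\},$$ $$\psi_{cb}(M)=\sup\{\|P(M)\| : m\ge 1,\ P \text{ a polynomial from } \mathbb{C} \text{ into } \mathbb{C}^{m,m} \text{ with } \|P(z)\|\le 1 \text{ for all } z\in W(M)\}.$$ Here, for a matrix-valued polynomial $P(z)=\sum_j C_j z^j$ with $C_j\in\mathbb{C}^{m,m}$, $P(M)=\sum_j C_j\otimes M^j\in\mathbb{C}^{md,md}$ (Kronecker product). *)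

theory Defs
  imports "Jordan_Normal_Form.Matrix" "HOL-Library.Extended_Real"
    "HOL-Computational_Algebra.Polynomial"
begin

definition cyclic_perm_mat :: "nat \<Rightarrow> complex mat" where
  "cyclic_perm_mat d =
     mat d d (\<lambda>(i, j). if i = d - 1 \<and> j = 0 \<or> j = i + 1 then 1 else 0)"

definition vnorm :: "complex vec \<Rightarrow> real" where
  "vnorm x = sqrt (\<Sum>i<dim_vec x. (cmod (x $ i))\<^sup>2)"

definition op_norm :: "complex mat \<Rightarrow> real" where
  "op_norm A = (SUP x\<in>{x \<in> carrier_vec (dim_col A). vnorm x = 1}. vnorm (A *\<^sub>v x))"

definition numerical_range :: "complex mat \<Rightarrow> complex set" where
  "numerical_range M = {(M *\<^sub>v x) \<bullet>c x | x. x \<in> carrier_vec (dim_row M) \<and> vnorm x = 1}"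

(* The type of matrices is not a monoid under addition (the dimensions vary), so the sum of a
   family of nr x nc matrices is formed entrywise. *)
definition mat_sum :: "nat \<Rightarrow> nat \<Rightarrow> (nat \<Rightarrow> complex mat) \<Rightarrow> nat set \<Rightarrow> complex mat" where
  "mat_sum nr nc F J = mat nr nc (\<lambda>(i, k). \<Sum>j\<in>J. F j $$ (i, k))"

definition kronecker :: "complex mat \<Rightarrow> complex mat \<Rightarrow> complex mat" where
  "kronecker A B = mat (dim_row A * dim_row B) (dim_col A * dim_col B)
     (\<lambda>(i, j). A $$ (i div dim_row B, j div dim_col B) * B $$ (i mod dim_row B, j mod dim_col B))"

definition poly_at_mat :: "complex poly \<Rightarrow> complex mat \<Rightarrow> complex mat" where
  "poly_at_mat p M =
     mat_sum (dim_row M) (dim_row M) (\<lambda>j. coeff p j \<cdot>\<^sub>m (M ^\<^sub>m j)) {..degree p}"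

(* A polynomial with m x m matrix coefficients is given by a degree bound N and coefficients
   C 0, ..., C N; its values at a scalar and at a square matrix are the following. *)
definition mpoly_at :: "nat \<Rightarrow> nat \<Rightarrow> (nat \<Rightarrow> complex mat) \<Rightarrow> complex \<Rightarrow> complex mat" where
  "mpoly_at m N C z = mat_sum m m (\<lambda>j. z ^ j \<cdot>\<^sub>m C j) {..N}"

definition mpoly_at_mat :: "nat \<Rightarrow> nat \<Rightarrow> (nat \<Rightarrow> complex mat) \<Rightarrow> complex mat \<Rightarrow> complex mat" where
  "mpoly_at_mat m N C M =
     mat_sum (m * dim_row M) (m * dim_row M) (\<lambda>j. kronecker (C j) (M ^\<^sub>m j)) {..N}"

(* The suprema are taken in the extended reals, so that finiteness is not presupposed. *)
definition psi :: "complex mat \<Rightarrow> ereal" where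
  "psi M = (SUP p\<in>{p. \<forall>z\<in>numerical_range M. cmod (poly p z) \<le> 1}. ereal (op_norm (poly_at_mat p M)))"

definition psi_cb :: "complex mat \<Rightarrow> ereal" where
  "psi_cb M =
     (SUP (m, N, C)\<in>{(m, N, C). m \<ge> 1 \<and> (\<forall>j\<le>N. C j \<in> carrier_mat m m) \<and>
                        (\<forall>z\<in>numerical_range M. op_norm (mpoly_at m N C z) \<le> 1)}.
        ereal (op_norm (mpoly_at_mat m N C M)))"

end

theory Submission
  imports "HOL-Complex_Analysis.Complex_Analysis" Defs
begin

text \<open>
  After a diagonal unitary similarity and a rotation, \<open>M\<close> is the weighted cyclic shift with weights
  \<open>a i = \<bar>\<alpha> i\<bar>\<close>, so \<open>M ^ d\<close> is the scalar \<open>\<Prod>i. a i = \<rho> ^ d\<close> and the numerical range is a convex set \<open>W\<close> with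
  the symmetries of the regular \<open>d\<close>-gon. A conformal map \<open>\<phi>\<close> of the interior of \<open>W\<close> onto the disc with
  \<open>\<phi> 0 = 0\<close> commutes with these symmetries, hence \<open>\<phi> M = \<kappa> M\<close> with \<open>\<kappa> = \<phi> \<rho> / \<rho>\<close> (or \<open>\<phi>' 0\<close> if \<open>\<rho> = 0\<close>).

  A diagonal similarity turns \<open>\<kappa> M\<close> into a contraction; by a longest-path argument its condition number can
  be taken to be \<open>\<Lambda> = Max {\<parallel>(\<kappa> M) ^ k\<parallel> |k. k < d}\<close>. By von Neumann's inequality \<open>\<Lambda>\<close> bounds the completely
  bounded constant, and it is attained by the scalar functions \<open>\<phi> ^ k\<close>, so both constants equal \<open>\<Lambda>\<close>.

  For the bound by 2, positivity of the double layer potential kernel on the level curves of \<open>\<phi>\<close>, tested on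
  the entry \<open>(i, i + k)\<close>, gives \<open>x + (1 - (\<phi> \<rho> / (\<rho> * \<phi>' 0)) ^ k) / x \<le> 2\<close> where \<open>x\<close> is that entry of
  \<open>(\<kappa> M) ^ k\<close>. Finally \<open>\<phi> \<rho> \<le> \<rho> * \<phi>' 0\<close>, strictly unless \<open>W\<close> is a disc, because the radial function of \<open>W\<close>
  decreases on the angles from \<open>0\<close> to \<open>pi / d\<close> (a reflection argument).
\<close>

text \<open>Nothing is known about \<phi> on the boundary of \<open>W\<close>: neither an extension
  nor a normal direction. So the double layer argument runs on level curves of radius
  \<open>r\<close> for weights dilated by \<open>s < 1\<close>; Study's inequality supplies the
  half-plane that a smooth convex boundary would give at each point, and \<open>r\<close>, then
  \<open>s\<close>, tend to 1. For the same reason powers of \<phi> are dilated before polynomials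
  approximate them. The bound 2 counts two diagonal entries: the real part of the resolvent is
  tested on two basis vectors with relative phase \<mu>. On a level curve \<mu> can be chosen so
  that the integrand depends on \<open>v = w ^ d\<close> alone. In this variable all
  \<open>d\<close> eigenvalues become one pole, whose residue gives \<open>2 - x - 1 / x\<close>;
  the pole at 0 adds the remaining term. If the scalar \<open>M ^ d\<close> is not 0, polynomials
  act on \<open>M\<close> through their values at \<open>d\<close> points, so unbounded degrees do
  no harm in limits. Two cases lie outside this scheme. For constant weights the eigenvalues are on
  the boundary of \<open>W\<close>. If only some weights vanish, \<open>W\<close> is a disc and
  powers of \<open>z\<close> replace those of \<phi>.\<close>

section \<open>Cyclic products and roots of unity\<close>

text \<open>The nonzero entry, in column \<open>(i + n) mod d\<close>, of row \<open>i\<close> of the \<open>n\<close>-th power of the cyclic shift with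
  weights \<open>b\<close>.\<close>

definition cyc_prod :: "nat \<Rightarrow> (nat \<Rightarrow> 'a::comm_monoid_mult) \<Rightarrow> nat \<Rightarrow> nat \<Rightarrow> 'a" where
  "cyc_prod d b i n = (\<Prod>l<n. b ((i + l) mod d))"

lemma cyc_prod_0 [simp]: "cyc_prod d b i 0 = 1"
  by (simp add: cyc_prod_def)

lemma cyc_prod_add: "cyc_prod d b i (n + m) = cyc_prod d b i n * cyc_prod d b ((i + n) mod d) m"
proof -
  have "cyc_prod d b i (n + m) = (\<Prod>l<n. b ((i + l) mod d)) * (\<Prod>l\<in>{n..<n+m}. b ((i + l) mod d))"
    unfolding cyc_prod_def
    by (subst prod.union_disjoint [symmetric]) (auto intro!: prod.cong)
  also have "(\<Prod>l\<in>{n..<n+m}. b ((i + l) mod d)) = (\<Prod>l<m. b ((i + n + l) mod d))"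
    by (rule prod.reindex_bij_witness [of _ "\<lambda>l. l + n" "\<lambda>l. l - n"]) (auto simp: ac_simps)
  also have "\<dots> = cyc_prod d b ((i + n) mod d) m"
    by (simp add: cyc_prod_def mod_add_left_eq)
  finally show ?thesis by (simp add: cyc_prod_def)
qed

lemma cyc_prod_Suc: "cyc_prod d b i (Suc n) = b (i mod d) * cyc_prod d b ((i + 1) mod d) n"
  using cyc_prod_add [of d b i 1 n] by (simp add: cyc_prod_def)

lemma cyc_prod_Suc_right: "cyc_prod d b i (Suc n) = cyc_prod d b i n * b ((i + n) mod d)"
  by (simp add: cyc_prod_def)

lemma cyc_prod_mod [simp]: "cyc_prod d b (i mod d) n = cyc_prod d b i n"
  by (simp add: cyc_prod_def mod_add_left_eq)

lemma bij_betw_add_mod: "bij_betw (\<lambda>l. (i + l) mod d) {..<d} {..<d::nat}"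
proof (cases "d = 0")
  case False
  have "inj_on (\<lambda>l. (i + l) mod d) {..<d}"
  proof (rule inj_onI)
    fix x y assume "x \<in> {..<d}" "y \<in> {..<d}" and e: "(i + x) mod d = (i + y) mod d"
    have "int x mod int d = int y mod int d"
      using arg_cong [OF e, of int] unfolding zmod_int of_nat_add
      by (metis add_diff_cancel_left' mod_diff_left_eq)
    then have "x mod d = y mod d" by (simp flip: zmod_int)
    then show "x = y" using \<open>x \<in> {..<d}\<close> \<open>y \<in> {..<d}\<close> by auto
  qed
  moreover have "(\<lambda>l. (i + l) mod d) ` {..<d} \<subseteq> {..<d}" using False by auto
  ultimately show ?thesis
    by (simp add: bij_betw_def endo_inj_surj)
qed (simp add: bij_betw_def)

lemma cyc_prod_full: "cyc_prod d b i d = (\<Prod>l<d. b l)"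
  unfolding cyc_prod_def using prod.reindex_bij_betw [OF bij_betw_add_mod, of b i d] by simp

lemma cyc_prod_period: "cyc_prod d b i (k + d * m) = cyc_prod d b i k * (\<Prod>l<d. b l) ^ m"
proof (induction m)
  case (Suc m)
  have "cyc_prod d b i (k + d * Suc m) = cyc_prod d b i (k + d * m) * cyc_prod d b ((i + (k + d * m)) mod d) d"
    using cyc_prod_add [of d b i "k + d * m" d] by (simp add: ac_simps)
  then show ?case by (simp add: cyc_prod_full Suc.IH ac_simps)
qed simp

text \<open>The quotients of \<open>g\<close> telescope along the cycle. This is conjugation by the
  diagonal matrix of \<open>g\<close>, entry by entry; \<open>g\<close> may consist of phases or be
  a positive potential.\<close>

lemma cyc_prod_gauge:
  fixes b b' :: "nat \<Rightarrow> 'a::field"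
  assumes "d > 0" "\<And>i. i < d \<Longrightarrow> b i = \<kappa> * b' i * g ((i + 1) mod d) / g i" "\<And>i. i < d \<Longrightarrow> g i \<noteq> 0"
  shows "cyc_prod d b i n = \<kappa> ^ n * cyc_prod d b' i n * g ((i + n) mod d) / g (i mod d)"
proof (induction n)
  case 0
  then show ?case using assms(1,3) by simp
next
  case (Suc n)
  have "(i + n) mod d < d" using assms(1) by simp
  then show ?case using assms
    by (simp add: cyc_prod_Suc_right Suc.IH mod_Suc_eq field_simps)
qed

lemma sum_cyclic_shift: "(\<Sum>i<d. f ((i + n) mod d)) = (\<Sum>i<d. f (i::nat))"
  using sum.reindex_bij_betw [OF bij_betw_add_mod, of f n d] by (simp add: add.commute)

definition unit_root :: "nat \<Rightarrow> complex" where "unit_root d = cis (2 * pi / d)"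

lemma norm_unit_root [simp]: "cmod (unit_root d) = 1"
  by (simp add: unit_root_def)

lemma unit_root_nonzero [simp]: "unit_root d \<noteq> 0"
  by (simp add: unit_root_def)

lemma unit_root_power [simp]: "d > 0 \<Longrightarrow> unit_root d ^ d = 1"
  by (simp only: unit_root_def Complex.DeMoivre) simp

lemma unit_root_power_power: "d > 0 \<Longrightarrow> (unit_root d ^ j) ^ d = 1"
  by (metis mult.commute power_mult power_one unit_root_power)

lemma unit_root_power_mod:
  assumes "d > 0" shows "(unit_root d ^ j) ^ (n mod d) = (unit_root d ^ j) ^ n"
proof -
  have "(unit_root d ^ j) ^ n = ((unit_root d ^ j) ^ d) ^ (n div d) * (unit_root d ^ j) ^ (n mod d)"
    by (metis power_add power_mult mult_div_mod_eq)
  then show ?thesis using unit_root_power_power [OF assms] by simp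
qed

lemma unit_root_power_eq_1_iff:
  assumes "d > 0" shows "unit_root d ^ n = 1 \<longleftrightarrow> d dvd n"
proof
  assume "unit_root d ^ n = 1"
  then have "cis (2 * pi * real n / real d) = 1"
    by (simp only: unit_root_def Complex.DeMoivre) (simp add: ac_simps)
  then have "cos (2 * pi * real n / real d) = 1" by (metis cis.sel(1) one_complex.sel(1))
  then obtain l::int where "2 * pi * real n / real d = l * (2 * pi)"
    by (auto simp: cos_one_2pi_int)
  then have "real n = real d * l" using assms by (simp add: field_simps)
  then have "int n = int d * l" by (metis of_int_eq_iff of_int_mult of_int_of_nat_eq)
  then show "d dvd n" by (metis dvd_triv_left int_dvd_int_iff)
qed (use assms in \<open>auto simp: power_mult\<close>)

lemma unit_root_sum:
  assumes "d > 0"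
  shows "(\<Sum>j<d. (unit_root d ^ j) ^ n) = (if d dvd n then of_nat d else 0)"
proof -
  have eq: "(\<Sum>j<d. (unit_root d ^ j) ^ n) = (\<Sum>j<d. (unit_root d ^ n) ^ j)"
    by (simp add: power_mult [symmetric] mult.commute)
  have "(unit_root d ^ n) ^ d = 1"
    using assms unit_root_power_power by blast
  then show ?thesis
    unfolding eq using assms unit_root_power_eq_1_iff [OF assms, of n]
    by (auto simp: sum_gp_strict)
qed

lemma inverse_unit_root: "inverse (unit_root d ^ n) = cnj (unit_root d ^ n)"
  by (simp add: unit_root_def cis_cnj flip: cis_inverse power_inverse)

lemma unit_root_orthogonal:
  assumes "d > 0" "l < d" "k < d"
  shows "(\<Sum>j<d. (unit_root d ^ j) ^ l * cnj ((unit_root d ^ j) ^ k)) = (if l = k then of_nat d else 0)"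
proof -
  \<comment> \<open>Conjugation inverts a root of unity; the exponent \<open>d - k\<close> stands
    for \<open>- k\<close> without leaving the naturals.\<close>
  have e: "(unit_root d ^ j) ^ l * cnj ((unit_root d ^ j) ^ k) = (unit_root d ^ j) ^ (l + (d - k))" for j
  proof -
    have "(unit_root d ^ j) ^ (d - k) * (unit_root d ^ j) ^ k = (unit_root d ^ j) ^ d"
      using assms by (metis less_imp_le le_add_diff_inverse2 power_add)
    also have "\<dots> = 1"
      using assms unit_root_power_power by simp
    finally have "(unit_root d ^ j) ^ (d - k) = inverse ((unit_root d ^ j) ^ k)"
      by (simp add: field_simps)
    also have "\<dots> = cnj ((unit_root d ^ j) ^ k)"
      unfolding power_mult [symmetric] by (rule inverse_unit_root)
    finally show ?thesis by (simp add: power_add)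
  qed
  have "d dvd l + (d - k) \<longleftrightarrow> l = k"
  proof
    assume "d dvd l + (d - k)"
    then obtain q where q: "l + (d - k) = d * q" by auto
    have "q \<noteq> 0" using q assms by (intro notI) simp
    moreover have "q < 2"
    proof (rule ccontr)
      assume "\<not> q < 2"
      then have "d * 2 \<le> d * q" by simp
      then show False using q assms by linarith
    qed
    ultimately have "q = 1" by simp
    then show "l = k" using q assms by simp
  qed (use assms in auto)
  then show ?thesis
    unfolding e using unit_root_sum [OF assms(1), of "l + (d - k)"] by simp
qed

text \<open>The left-hand side is the entry in row \<open>i\<close> and column
  \<open>(i + k) mod d\<close> of the polynomial in the shift. The finite Fourier transform filters
  the residue class \<open>k\<close> out of the values at the eigenvalues
  \<open>\<rho> * unit_root d ^ j\<close>, so these \<open>d\<close> values determine the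
  entry.\<close>

lemma sum_residue_class:
  fixes p :: "nat \<Rightarrow> complex" and b :: "nat \<Rightarrow> complex"
  assumes d: "d > 0" and k: "k < d" and \<rho>: "\<rho> ^ d = (\<Prod>l<d. b l)" "\<rho> \<noteq> 0"
  shows "(\<Sum>n\<in>{n. n \<le> N \<and> n mod d = k}. p n * cyc_prod d b i n) =
    cyc_prod d b i k / \<rho> ^ k * (1 / of_nat d) *
      (\<Sum>j<d. cnj ((unit_root d ^ j) ^ k) * (\<Sum>n\<le>N. p n * (\<rho> * unit_root d ^ j) ^ n))"
proof -
  have "(\<Sum>j<d. cnj ((unit_root d ^ j) ^ k) * (\<Sum>n\<le>N. p n * (\<rho> * unit_root d ^ j) ^ n))
      = (\<Sum>n\<le>N. p n * \<rho> ^ n * (\<Sum>j<d. (unit_root d ^ j) ^ (n mod d) * cnj ((unit_root d ^ j) ^ k)))"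
  proof -
    have "(unit_root d ^ j) ^ (n mod d) = (unit_root d ^ j) ^ n" for j n
      using d by (rule unit_root_power_mod)
    then show ?thesis
      unfolding sum_distrib_left by (subst sum.swap) (simp add: power_mult_distrib ac_simps)
  qed
  also have "\<dots> = (\<Sum>n\<le>N. p n * \<rho> ^ n * (if n mod d = k then of_nat d else 0))"
    using unit_root_orthogonal [OF d _ k] d by simp
  also have "\<dots> = (\<Sum>n\<in>{n. n \<le> N \<and> n mod d = k}. p n * \<rho> ^ n * of_nat d)"
    by (rule sum.mono_neutral_cong_right) auto
  finally have e: "(\<Sum>j<d. cnj ((unit_root d ^ j) ^ k) * (\<Sum>n\<le>N. p n * (\<rho> * unit_root d ^ j) ^ n)) = \<dots>" .
  have "p n * cyc_prod d b i n = cyc_prod d b i k / \<rho> ^ k * (1 / of_nat d) * (p n * \<rho> ^ n * of_nat d)"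
    if "n mod d = k" for n
  proof -
    have n: "n = k + d * (n div d)" using that by (metis mod_mult_div_eq)
    have "cyc_prod d b i n = cyc_prod d b i k * (\<rho> ^ d) ^ (n div d)"
      by (subst n) (simp only: cyc_prod_period \<rho>(1))
    moreover have "\<rho> ^ n = \<rho> ^ k * (\<rho> ^ d) ^ (n div d)"
      by (subst n) (simp only: power_add power_mult)
    ultimately show ?thesis using \<rho>(2) d by simp
  qed
  then show ?thesis
    unfolding e unfolding sum_distrib_left by (intro sum.cong) auto
qed

section \<open>The numerical range of a weighted cyclic shift\<close>

text \<open>The sesquilinear form \<open>(T x, y)\<close> of the shift \<open>T\<close>. Vectors are
  functions on all naturals of which only the entries below \<open>d\<close> count, so no dimension
  conditions arise; the two-vector version is what the convexity proof expands.\<close>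

definition csesq :: "nat \<Rightarrow> (nat \<Rightarrow> real) \<Rightarrow> (nat \<Rightarrow> complex) \<Rightarrow> (nat \<Rightarrow> complex) \<Rightarrow> complex" where
  "csesq d a x y = (\<Sum>i<d. of_real (a i) * x ((i + 1) mod d) * cnj (y i))"

definition cform :: "nat \<Rightarrow> (nat \<Rightarrow> real) \<Rightarrow> (nat \<Rightarrow> complex) \<Rightarrow> complex" where
  "cform d a x = csesq d a x x"

definition cinner :: "nat \<Rightarrow> (nat \<Rightarrow> complex) \<Rightarrow> (nat \<Rightarrow> complex) \<Rightarrow> complex" where
  "cinner d x y = (\<Sum>i<d. x i * cnj (y i))"

definition nsq :: "nat \<Rightarrow> (nat \<Rightarrow> complex) \<Rightarrow> real" where
  "nsq d x = (\<Sum>i<d. (cmod (x i))\<^sup>2)"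

definition num_range :: "nat \<Rightarrow> (nat \<Rightarrow> real) \<Rightarrow> complex set" where
  "num_range d a = {cform d a x |x. nsq d x = 1}"

lemma nsq_nonneg [simp]: "0 \<le> nsq d x" by (simp add: nsq_def sum_nonneg)

lemma of_real_nsq: "of_real (nsq d x) = cinner d x x"
  by (simp add: nsq_def cinner_def complex_norm_square del: of_real_power)

lemma nsq_eq_0_iff: "nsq d x = 0 \<longleftrightarrow> (\<forall>i<d. x i = 0)"
  by (auto simp: nsq_def sum_nonneg_eq_0_iff)

lemma nsq_scale: "nsq d (\<lambda>i. c * x i) = (cmod c)\<^sup>2 * nsq d x"
  by (simp add: nsq_def norm_mult power_mult_distrib sum_distrib_left)

lemma cform_scale: "cform d a (\<lambda>i. c * x i) = of_real ((cmod c)\<^sup>2) * cform d a x"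
  unfolding complex_norm_square
  by (simp add: cform_def csesq_def sum_distrib_left ac_simps)

lemma csesq_comb:
  "csesq d a (\<lambda>i. u * x i + v * y i) (\<lambda>i. u * x i + v * y i) =
   u * cnj u * csesq d a x x + v * cnj v * csesq d a y y + u * cnj v * csesq d a x y + v * cnj u * csesq d a y x"
  unfolding csesq_def sum_distrib_left sum.distrib [symmetric]
  by (intro sum.cong refl) (simp add: algebra_simps)

lemma cinner_comb:
  "cinner d (\<lambda>i. u * x i + v * y i) (\<lambda>i. u * x i + v * y i) =
   u * cnj u * cinner d x x + v * cnj v * cinner d y y + u * cnj v * cinner d x y + v * cnj u * cinner d y x"
  unfolding cinner_def sum_distrib_left sum.distrib [symmetric]
  by (intro sum.cong refl) (simp add: algebra_simps)

lemma cform_in_num_range: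
  assumes "nsq d x \<noteq> 0" shows "cform d a x / of_real (nsq d x) \<in> num_range d a"
proof -
  have pos: "nsq d x > 0" using assms nsq_nonneg [of d x] by linarith
  define c where "c = complex_of_real (1 / sqrt (nsq d x))"
  have c: "(cmod c)\<^sup>2 = 1 / nsq d x"
    unfolding c_def norm_of_real using pos by (simp add: power_divide)
  have "nsq d (\<lambda>i. c * x i) = 1" unfolding nsq_scale c using assms by simp
  moreover have "cform d a (\<lambda>i. c * x i) = cform d a x / of_real (nsq d x)"
    unfolding cform_scale c by simp
  ultimately show ?thesis unfolding num_range_def by force
qed

lemma cform_mem_num_range: "nsq d x = 1 \<Longrightarrow> cform d a x \<in> num_range d a"
  by (auto simp: num_range_def)

text \<open>Toeplitz--Hausdorff: after an affine normalisation the two points become 0 and 1, and the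
  phase \<open>e\<close> makes the form real on the segment from \<open>x\<close> to \<open>e y\<close>.\<close>

lemma convex_num_range: "convex (num_range d a)"
proof (rule convexI)
  fix p q :: complex and u \<mu> :: real
  assume pq: "p \<in> num_range d a" "q \<in> num_range d a" and u: "0 \<le> u" "0 \<le> \<mu>" "u + \<mu> = 1"
  obtain x where x: "nsq d x = 1" "p = cform d a x" using pq by (auto simp: num_range_def)
  obtain y where y: "nsq d y = 1" "q = cform d a y" using pq by (auto simp: num_range_def)
  show "u *\<^sub>R p + \<mu> *\<^sub>R q \<in> num_range d a"
  proof (cases "p = q")
    case True
    then show ?thesis using pq u by (simp flip: scaleR_add_left)
  next
    case False
    define \<delta> where "\<delta> = q - p"
    have \<delta>: "\<delta> \<noteq> 0" using False by (simp add: \<delta>_def)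
    define B where "B v w = (csesq d a v w - p * cinner d v w) / \<delta>" for v w
    have Bx: "B x x = 0" using x by (simp add: B_def of_real_nsq [symmetric] cform_def)
    have By: "B y y = 1" using y \<delta> by (simp add: B_def of_real_nsq [symmetric] cform_def \<delta>_def)
    define w where "w = B y x - cnj (B x y)"
    define e where "e = (if w = 0 then 1 else cnj w / of_real (cmod w))"
    have e1: "cmod e = 1" by (simp add: e_def norm_divide)
    have "Im (e * w) = 0"
    proof (cases "w = 0")
      case False
      have "e * w = of_real ((cmod w)\<^sup>2) / of_real (cmod w)"
        using False unfolding complex_norm_square by (simp add: e_def)
      then show ?thesis by (simp flip: of_real_divide)
    qed simp
    then have im: "Im (e * B y x + cnj e * B x y) = 0"
      by (simp add: w_def algebra_simps)
    define s where "s = Re (e * B y x + cnj e * B x y)"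
    have s: "e * B y x + cnj e * B x y = of_real s"
      using im by (simp add: s_def complex_eq_iff)
    define v where "v \<tau> i = complex_of_real (1 - \<tau>) * x i + (of_real \<tau> * e) * y i" for \<tau> :: real and i
    have ee: "e * cnj e = 1" using e1 by (metis complex_norm_square of_real_1 one_power2)
    have Bv: "B (v \<tau>) (v \<tau>) = of_real (\<tau>\<^sup>2 + \<tau> * (1 - \<tau>) * s)" for \<tau>
    proof -
      have "B (v \<tau>) (v \<tau>) = of_real (1 - \<tau>) * of_real (1 - \<tau>) * B x x + of_real \<tau> * of_real \<tau> * (e * cnj e) * B y y
          + of_real (1 - \<tau>) * of_real \<tau> * (e * B y x + cnj e * B x y)"
        unfolding v_def B_def csesq_comb cinner_comb using \<delta> by (simp add: field_simps)
      then show ?thesis unfolding Bx By s ee by (simp add: power2_eq_square)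
    qed
    \<comment> \<open>A zero on the segment would make \<open>x\<close> a unimodular multiple of
      \<open>y\<close>, and the two points of the range would coincide.\<close>
    have nz: "nsq d (v \<tau>) \<noteq> 0" if "0 \<le> \<tau>" "\<tau> \<le> 1" for \<tau>
    proof
      assume "nsq d (v \<tau>) = 0"
      then have v0: "\<And>i. i < d \<Longrightarrow> complex_of_real (1 - \<tau>) * x i = - (of_real \<tau> * e) * y i"
        unfolding nsq_eq_0_iff v_def by (simp add: add_eq_0_iff)
      then have "nsq d (\<lambda>i. complex_of_real (1 - \<tau>) * x i) = nsq d (\<lambda>i. - (of_real \<tau> * e) * y i)"
        unfolding nsq_def by simp
      then have "(1 - \<tau>)\<^sup>2 = \<tau>\<^sup>2"
        unfolding nsq_scale x y using e1 by (simp add: norm_mult del: of_real_diff)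
      then have \<tau>: "\<tau> = 1/2" by (simp add: power2_eq_square algebra_simps)
      have xy: "x i = - e * y i" if "i < d" for i
        using v0 [OF that] unfolding \<tau> by (simp add: field_simps)
      have "cform d a x = cform d a (\<lambda>i. - e * y i)"
        unfolding cform_def csesq_def using xy
        by (intro sum.cong refl) (metis lessThan_iff mod_less_divisor not_less_zero not_gr_zero)
      then show False using False x(2) y(2) e1 unfolding cform_scale by simp
    qed
    \<comment> \<open>The affine coordinate, on the line through \<open>p\<close> and
      \<open>q\<close>, of the form at the normalised vector; it runs continuously from 0 to
      1.\<close>
    define g where "g \<tau> = (\<tau>\<^sup>2 + \<tau> * (1 - \<tau>) * s) / nsq d (v \<tau>)" for \<tau>
    have "continuous_on {0..1} g"
      unfolding g_def
    proof (intro continuous_intros)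
      show "continuous_on {0..1} (\<lambda>\<tau>. nsq d (v \<tau>))"
        unfolding nsq_def v_def by (intro continuous_intros)
    qed (use nz in auto)
    moreover have "nsq d (v 0) = 1" using x(1) by (simp add: v_def nsq_def)
    moreover have "nsq d (v 1) = 1" using y(1) e1 by (simp add: v_def nsq_def norm_mult)
    ultimately have "\<exists>\<tau>\<ge>0. \<tau> \<le> 1 \<and> g \<tau> = \<mu>"
      using u by (intro IVT') (auto simp: g_def)
    then obtain \<tau> where \<tau>: "0 \<le> \<tau>" "\<tau> \<le> 1" "g \<tau> = \<mu>" by auto
    have "csesq d a (v \<tau>) (v \<tau>) = p * cinner d (v \<tau>) (v \<tau>) + \<delta> * B (v \<tau>) (v \<tau>)"
      using \<delta> by (simp add: B_def)
    then have "cform d a (v \<tau>) / of_real (nsq d (v \<tau>)) = p + \<delta> * (of_real (\<tau>\<^sup>2 + \<tau> * (1 - \<tau>) * s) / of_real (nsq d (v \<tau>)))"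
      unfolding Bv cform_def of_real_nsq [symmetric] using nz [OF \<tau>(1,2)] by (simp add: field_simps)
    also have "\<dots> = p + \<delta> * of_real (g \<tau>)" by (simp add: g_def)
    also have "\<dots> = u *\<^sub>R p + \<mu> *\<^sub>R q"
    proof -
      have u': "u = 1 - \<mu>" using u by simp
      show ?thesis unfolding \<tau>(3) \<delta>_def u' by (simp add: scaleR_conv_of_real algebra_simps)
    qed
    finally show ?thesis using cform_in_num_range [OF nz [OF \<tau>(1,2)], of a] by simp
  qed
qed

section \<open>Symmetries and support function of the numerical range\<close>

text \<open>A diagonal unitary conjugates the shift into \<open>e\<close> times itself once its
  entries have ratio \<open>e\<close> along every edge of non-zero weight. Edges of weight zero
  impose nothing, and this is where full rotational symmetry comes from when a weight
  vanishes.\<close>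

lemma num_range_gauge:
  assumes d: "d > 0" and g: "\<And>i. i < d \<Longrightarrow> cmod (g i) = 1"
    and e: "\<And>i. i < d \<Longrightarrow> a i \<noteq> 0 \<Longrightarrow> g ((i + 1) mod d) = e * g i" and z: "z \<in> num_range d a"
  shows "e * z \<in> num_range d a"
proof -
  obtain x where x: "nsq d x = 1" "z = cform d a x" using z by (auto simp: num_range_def)
  have "nsq d (\<lambda>i. g i * x i) = 1"
    using x(1) g by (simp add: nsq_def norm_mult)
  moreover have "cform d a (\<lambda>i. g i * x i) = e * z"
    unfolding x(2) cform_def csesq_def sum_distrib_left
  proof (rule sum.cong [OF refl])
    fix i assume i: "i \<in> {..<d}"
    have gg: "g i * cnj (g i) = 1" using g [of i] i by (metis complex_norm_square lessThan_iff of_real_1 one_power2)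
    have "a i = 0 \<or> g ((i + 1) mod d) = e * g i" using e i by auto
    then show "of_real (a i) * (g ((i + 1) mod d) * x ((i + 1) mod d)) * cnj (g i * x i) = e * (of_real (a i) * x ((i + 1) mod d) * cnj (x i))"
    proof
      assume ge: "g ((i + 1) mod d) = e * g i"
      have "of_real (a i) * (e * g i * x ((i + 1) mod d)) * cnj (g i * x i) = (g i * cnj (g i)) * (e * (of_real (a i) * x ((i + 1) mod d) * cnj (x i)))"
        by (simp add: ac_simps)
      then show ?thesis unfolding ge gg by simp
    qed simp
  qed
  ultimately show ?thesis using cform_mem_num_range by metis
qed

lemma num_range_unit_root:
  assumes d: "d > 0" and z: "z \<in> num_range d a" shows "unit_root d * z \<in> num_range d a"
proof (rule num_range_gauge [OF d _ _ z])
  show "cmod (unit_root d ^ i) = 1" for i by (simp add: norm_power)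
  show "unit_root d ^ ((i + 1) mod d) = unit_root d * unit_root d ^ i" for i
    using unit_root_power_mod [OF d, of 1 "i + 1"] by simp
qed

lemma num_range_unit_root_power:
  assumes d: "d > 0" and z: "z \<in> num_range d a" shows "unit_root d ^ j * z \<in> num_range d a"
proof (induction j)
  case (Suc j)
  show ?case using num_range_unit_root [OF d Suc.IH] by (simp add: ac_simps)
qed (use z in simp)

text \<open>The numbering \<open>(i + (d - 1 - j)) mod d\<close> puts \<open>j\<close> last, so
  passing to the successor raises the position by one except across the edge at \<open>j\<close>.
  Powers of a phase with these exponents are therefore a gauge on the cycle cut open at
  \<open>j\<close>.\<close>

lemma shifted_position:
  fixes d :: nat
  assumes j: "j < d" and i: "i < d" "i \<noteq> j"
  shows "((i + 1) mod d + (d - 1 - j)) mod d = Suc ((i + (d - 1 - j)) mod d)"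
proof -
  have "((i + 1) mod d + (d - 1 - j)) mod d = Suc (i + (d - 1 - j)) mod d"
    by (metis Suc_eq_plus1 add_Suc mod_add_left_eq)
  moreover have "Suc ((i + (d - 1 - j)) mod d) \<noteq> d"
  proof (cases "i < j")
    case True
    then have "(i + (d - 1 - j)) mod d = i + (d - 1 - j)" using j by (intro mod_less) simp
    then show ?thesis using True j by simp
  next
    case False
    then have e: "i + (d - 1 - j) = (i - j - 1) + d" using i j by simp
    have "(i + (d - 1 - j)) mod d = i - j - 1" unfolding e using i by simp
    then show ?thesis using i False by simp
  qed
  ultimately show ?thesis by (simp add: mod_Suc)
qed

lemma num_range_rotate:
  assumes d: "d > 0" and j: "j < d" "a j = 0" and e: "cmod e = 1" and z: "z \<in> num_range d a"
  shows "e * z \<in> num_range d a"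
proof (rule num_range_gauge [OF d _ _ z])
  show "cmod (e ^ ((i + (d - 1 - j)) mod d)) = 1" for i using e by (simp add: norm_power)
  fix i assume "i < d" "a i \<noteq> 0"
  then have ij: "i < d" "i \<noteq> j" using j by auto
  show "e ^ (((i + 1) mod d + (d - 1 - j)) mod d) = e * e ^ ((i + (d - 1 - j)) mod d)"
    unfolding shifted_position [OF j(1) ij] by simp
qed

lemma num_range_cnj:
  assumes z: "z \<in> num_range d a" shows "cnj z \<in> num_range d a"
proof -
  obtain x where x: "nsq d x = 1" "z = cform d a x" using z by (auto simp: num_range_def)
  have "nsq d (\<lambda>i. cnj (x i)) = 1" using x(1) by (simp add: nsq_def)
  moreover have "cform d a (\<lambda>i. cnj (x i)) = cnj z"
    unfolding x(2) cform_def csesq_def by simp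
  ultimately show ?thesis using cform_mem_num_range by metis
qed

lemma Arg_cis_bound: "\<bar>Arg (cis t)\<bar> \<le> pi" "cis (Arg (cis t)) = cis t"
  using Arg_bounded [of "cis t"] cis_Arg [of "cis t"] by (auto simp: sgn_eq)

lemma cis_sum: "cis (\<Sum>i\<in>A. f i) = (\<Prod>i\<in>A. cis (f i))"
  by (induction A rule: infinite_finite_induct) (auto simp: cis_mult [symmetric])

text \<open>The phases \<open>\<delta>\<close> of the summands of the form at \<open>x\<close>, relative to \<open>\<theta>2\<close>, add up to
  \<open>- d * \<theta>2\<close> modulo \<open>2 * pi\<close>; shrinking them proportionally to absolute sum \<open>d * \<theta>1\<close> increases
  every cosine.\<close>

lemma num_range_support_mono:
  assumes d: "d > 0" and a: "\<And>i. 0 \<le> a i" and th: "0 \<le> \<theta>1" "\<theta>1 \<le> \<theta>2" "d * \<theta>2 \<le> pi"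
    and z: "z \<in> num_range d a"
  shows "\<exists>z'\<in>num_range d a. Re (cis (- \<theta>2) * z) \<le> Re (cis (- \<theta>1) * z')"
proof -
  obtain x where x: "nsq d x = 1" "z = cform d a x" using z by (auto simp: num_range_def)
  define r where "r i = cmod (x i)" for i
  define \<xi> where "\<xi> i = Arg (x i)" for i
  have xr: "x i = of_real (r i) * cis (\<xi> i)" for i
    using rcis_cmod_Arg [of "x i"] by (simp add: rcis_def r_def \<xi>_def)
  define nx where "nx i = (i + 1) mod d" for i
  define \<delta> where "\<delta> i = Arg (cis (\<xi> (nx i) - \<xi> i - \<theta>2))" for i
  have \<delta>: "\<bar>\<delta> i\<bar> \<le> pi" "cis (\<delta> i) = cis (\<xi> (nx i) - \<xi> i - \<theta>2)" for i
    unfolding \<delta>_def by (rule Arg_cis_bound)+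
  have "cis (\<Sum>i<d. \<delta> i) = cis (- (d * \<theta>2))"
  proof -
    have "cis (\<Sum>i<d. \<delta> i) = (\<Prod>i<d. cis (\<delta> i))"
      by (simp add: cis_sum)
    also have "\<dots> = (\<Prod>i<d. cis (\<xi> (nx i)) * (cis (- \<xi> i) * cis (- \<theta>2)))"
      by (simp add: \<delta>(2) cis_mult algebra_simps)
    also have "\<dots> = (\<Prod>i<d. cis (\<xi> (nx i))) * (\<Prod>i<d. cis (- \<xi> i)) * (\<Prod>i<d. cis (- \<theta>2))"
      by (simp only: prod.distrib ac_simps)
    also have "(\<Prod>i<d. cis (\<xi> (nx i))) = (\<Prod>i<d. cis (\<xi> i))"
      using prod.reindex_bij_betw [OF bij_betw_add_mod, of "\<lambda>i. cis (\<xi> i)" 1 d] by (simp add: nx_def)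
    also have "(\<Prod>i<d. cis (\<xi> i)) * (\<Prod>i<d. cis (- \<xi> i)) = 1"
      unfolding prod.distrib [symmetric] by (simp add: cis_mult)
    finally show ?thesis by (simp add: Complex.DeMoivre)
  qed
  then have cosS: "cos (\<Sum>i<d. \<delta> i) = cos (d * \<theta>2)"
    by (metis cis.sel(1) cos_minus)
  define D where "D = (\<Sum>i<d. \<bar>\<delta> i\<bar>)"
  \<comment> \<open>The cosine of the sum of the phases is \<open>cos (d * \<theta>2)\<close> with
    \<open>d * \<theta>2\<close> in \<open>[0, pi]\<close>; a sum of smaller modulus would have a
    larger cosine.\<close>
  have "D \<ge> d * \<theta>2"
  proof (rule ccontr)
    assume "\<not> D \<ge> d * \<theta>2"
    then have "\<bar>\<Sum>i<d. \<delta> i\<bar> < d * \<theta>2"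
      unfolding D_def using sum_abs [of \<delta> "{..<d}"] by linarith
    then have "cos (d * \<theta>2) < cos \<bar>\<Sum>i<d. \<delta> i\<bar>"
      using th by (intro cos_monotone_0_pi) auto
    then show False using cosS by simp
  qed
  moreover have "d * \<theta>1 \<le> d * \<theta>2" using th by (simp add: mult_left_mono)
  ultimately have D: "d * \<theta>1 \<le> D" by linarith
  have D0: "D \<ge> 0" by (simp add: D_def sum_nonneg)
  define t where "t = d * \<theta>1 / D"
  have t: "0 \<le> t" "t \<le> 1" using D D0 th by (auto simp: t_def divide_le_eq_1)
  have tD: "t * D = d * \<theta>1"
    using D D0 th d by (cases "D = 0") (auto simp: t_def zero_le_mult_iff mult_le_0_iff)
  \<comment> \<open>The new phase increments deviate from \<open>\<theta>1\<close> by the shrunk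
    phases, all with the same sign. The value of \<open>t\<close> makes their total vanish, so they
    close up around the cycle.\<close>
  define \<xi>' where "\<xi>' i = (\<Sum>l<i. \<theta>1 - t * \<bar>\<delta> l\<bar>)" for i
  have \<xi>d: "\<xi>' d = 0"
    using tD by (simp add: \<xi>'_def sum_subtractf D_def sum_distrib_left)
  define y where "y i = of_real (r i) * cis (\<xi>' i)" for i
  have step: "cis (- \<theta>1) * (y (nx i) * cnj (y i)) = of_real (r (nx i) * r i) * cis (- (t * \<bar>\<delta> i\<bar>))" if "i < d" for i
  proof -
    have "\<xi>' (nx i) = \<xi>' (Suc i)"
    proof (cases "Suc i = d")
      case True
      then show ?thesis using \<xi>d by (simp add: nx_def \<xi>'_def)
    qed (use that in \<open>simp add: nx_def\<close>)
    then have "\<xi>' (nx i) = \<xi>' i + (\<theta>1 - t * \<bar>\<delta> i\<bar>)" by (simp add: \<xi>'_def)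
    then have "cis (- \<theta>1) * (cis (\<xi>' (nx i)) * cis (- \<xi>' i)) = cis (- (t * \<bar>\<delta> i\<bar>))"
      by (simp add: cis_mult)
    moreover have "cis (- \<theta>1) * (y (nx i) * cnj (y i)) =
        of_real (r (nx i) * r i) * (cis (- \<theta>1) * (cis (\<xi>' (nx i)) * cis (- \<xi>' i)))"
      by (simp add: y_def cis_cnj)
    ultimately show ?thesis by simp
  qed
  have "Re (cis (- \<theta>2) * z) = (\<Sum>i<d. a i * (r (nx i) * r i * cos (\<delta> i)))"
  proof -
    have "cis (- \<theta>2) * z = (\<Sum>i<d. of_real (a i) * (of_real (r (nx i) * r i) * (cis (- \<theta>2) * (cis (\<xi> (nx i)) * cis (- \<xi> i)))))"
      unfolding x(2) cform_def csesq_def sum_distrib_left nx_def [symmetric]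
      by (intro sum.cong refl) (simp add: xr cis_cnj)
    also have "\<dots> = (\<Sum>i<d. of_real (a i) * (of_real (r (nx i) * r i) * cis (\<delta> i)))"
      by (simp add: \<delta>(2) cis_mult)
    finally show ?thesis by (simp add: Re_sum)
  qed
  also have "\<dots> \<le> (\<Sum>i<d. a i * (r (nx i) * r i * cos (- (t * \<bar>\<delta> i\<bar>))))"
  proof (intro sum_mono mult_left_mono a)
    fix i
    have "cos \<bar>\<delta> i\<bar> \<le> cos (t * \<bar>\<delta> i\<bar>)"
      using t \<delta>(1) [of i] by (intro cos_monotone_0_pi_le) (auto simp: mult_left_le_one_le)
    then show "cos (\<delta> i) \<le> cos (- (t * \<bar>\<delta> i\<bar>))" by simp
  qed (simp add: r_def)
  also have "\<dots> = Re (cis (- \<theta>1) * cform d a y)"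
  proof -
    have "cis (- \<theta>1) * cform d a y = (\<Sum>i<d. of_real (a i) * (cis (- \<theta>1) * (y (nx i) * cnj (y i))))"
      unfolding cform_def csesq_def sum_distrib_left nx_def [symmetric] by (simp add: ac_simps)
    also have "\<dots> = (\<Sum>i<d. of_real (a i) * (of_real (r (nx i) * r i) * cis (- (t * \<bar>\<delta> i\<bar>))))"
      using step by simp
    finally show ?thesis by (simp add: Re_sum)
  qed
  finally have "Re (cis (- \<theta>2) * z) \<le> Re (cis (- \<theta>1) * cform d a y)" .
  moreover have "nsq d y = 1" using x(1) by (simp add: nsq_def y_def norm_mult r_def)
  ultimately show ?thesis using cform_mem_num_range by blast
qed

section \<open>Separating directions and the fundamental sector\<close>

lemma not_in_closure_convex_direction:
  fixes S :: "complex set"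
  assumes "convex S" "z \<notin> closure S" "S \<noteq> {}"
  obtains \<psi> t where "\<And>w. w \<in> closure S \<Longrightarrow> Re (cis (- \<psi>) * w) \<le> t" "Re (cis (- \<psi>) * z) > t"
proof -
  obtain n b where nb: "inner n z < b" "\<And>x. x \<in> closure S \<Longrightarrow> b < inner n x"
    using separating_hyperplane_closed_point [of "closure S" z] assms by (auto simp: convex_closure)
  have n0: "n \<noteq> 0" using nb assms(3) closure_subset [of S] by fastforce
  define \<psi> where "\<psi> = Arg (- n)"
  have "- n = of_real (cmod n) * cis \<psi>"
    using rcis_cmod_Arg [of "- n"] by (simp add: rcis_def \<psi>_def)
  then have nn: "n = - (of_real (cmod n) * cis \<psi>)" by (metis minus_minus)
  have inn: "inner n w = - cmod n * Re (cis (- \<psi>) * w)" for w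
    by (subst nn) (simp add: inner_complex_def algebra_simps)
  have pos: "cmod n > 0" using n0 by simp
  show ?thesis
  proof
    show "Re (cis (- \<psi>) * w) \<le> - b / cmod n" if "w \<in> closure S" for w
      using nb(2) [OF that] pos unfolding inn by (simp add: field_simps)
    show "- b / cmod n < Re (cis (- \<psi>) * z)"
      using nb(1) pos unfolding inn by (simp add: field_simps)
  qed
qed

text \<open>Subtracting the nearest multiple of \<open>2 * pi / d\<close> moves a direction into the
  sector of half-angle \<open>pi / d\<close> about the real axis, a fundamental domain for the
  rotations. Recording the sign of \<open>s\<close> separately also takes care of complex
  conjugation.\<close>

lemma cis_fold:
  assumes d: "d > (0::nat)"
  obtains l p s where "l < d" "0 \<le> p" "p \<le> pi / d" "s = p \<or> s = - p" "cis \<psi> = unit_root d ^ l * cis s"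
proof -
  define D where "D = pi / d"
  have D0: "D > 0" using d by (simp add: D_def)
  define q where "q = round (\<psi> / (2 * D))"
  define l where "l = nat (q mod int d)"
  define k where "k = q div int d"
  have q: "q = int d * k + int l" using d by (simp add: k_def l_def)
  define s where "s = \<psi> - 2 * D * q"
  have sD: "\<bar>s\<bar> \<le> D"
  proof -
    have "\<bar>of_int q - \<psi> / (2 * D)\<bar> \<le> 1/2" unfolding q_def by (rule of_int_round_abs_le)
    then have "2 * D * \<bar>of_int q - \<psi> / (2 * D)\<bar> \<le> 2 * D * (1/2)" using D0 by (intro mult_left_mono) auto
    moreover have "2 * D * \<bar>of_int q - \<psi> / (2 * D)\<bar> = \<bar>s\<bar>"
      using D0 by (simp add: s_def abs_if field_simps)
    ultimately show ?thesis by simp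
  qed
  have "\<psi> = (2 * D * l + s) + k * (2 * pi)"
  proof -
    have "2 * D * q = 2 * D * l + (d * D) * (2 * k)" unfolding q by (simp add: algebra_simps)
    moreover have "d * D = pi" using d by (simp add: D_def)
    ultimately show ?thesis by (simp add: s_def)
  qed
  then have "cis \<psi> = cis (2 * D * l + s)"
    using cos_int_2pin [of k] sin_int_2pin [of k]
    by (simp add: complex_eq_iff cos_add sin_add mult.commute)
  moreover have "unit_root d ^ l = cis (2 * D * l)"
    by (simp only: unit_root_def Complex.DeMoivre) (simp add: D_def ac_simps)
  ultimately have "cis \<psi> = unit_root d ^ l * cis s" by (simp add: cis_mult)
  moreover have "l < d" using d by (simp add: l_def nat_less_iff)
  ultimately show ?thesis
    using that [of l "\<bar>s\<bar>" s] sD by (cases "s \<ge> 0") (auto simp: D_def)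
qed

lemma cos_le_cos_dist:
  assumes "\<bar>y\<bar> \<le> x" "x \<le> 2 * pi - \<bar>y\<bar>" shows "cos x \<le> cos y"
proof -
  have y: "\<bar>y\<bar> \<le> pi" using assms by linarith
  show ?thesis
  proof (cases "x \<le> pi")
    case True
    then have "cos x \<le> cos \<bar>y\<bar>" using assms by (intro cos_monotone_0_pi_le) auto
    then show ?thesis by simp
  next
    case False
    then have "cos (2 * pi - x) \<le> cos \<bar>y\<bar>" using assms by (intro cos_monotone_0_pi_le) auto
    then show ?thesis by simp
  qed
qed

text \<open>Of all images of the direction \<open>p\<close> under rotations and conjugation,
  \<open>p\<close> itself is nearest to a direction \<theta> of the same half-sector: modulo
  \<open>2 * pi\<close> every other image is at an angular distance of at least
  \<open>\<bar>p - \<theta>\<bar>\<close>.\<close>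

lemma cos_fold:
  assumes l: "l < d" and d: "d \<ge> (2::nat)" and D: "D = pi / d"
    and p: "0 \<le> p" "p \<le> D" and th: "0 \<le> \<theta>" "\<theta> \<le> D" and s: "s = p \<or> s = - p"
  shows "cos (2 * D * l + s - \<theta>) \<le> cos (p - \<theta>)"
proof -
  have D0: "D > 0" using d by (simp add: D)
  have dD: "d * D = pi" using d by (simp add: D)
  have D2: "2 * D \<le> pi" using mult_right_mono [of 2 "real d" D] d D0 dD by simp
  have "real (Suc l) * D \<le> d * D" using l D0 by (intro mult_right_mono) auto
  then have up: "2 * D * l + 2 * D \<le> 2 * pi" using dD by (simp add: algebra_simps)
  show ?thesis
  proof (cases "l = 0")
    case True
    show ?thesis
    proof (cases "s = p")
      case False
      have "cos (p + \<theta>) \<le> cos (p - \<theta>)" using p th D2 by (intro cos_le_cos_dist) auto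
      moreover have "2 * D * l + s - \<theta> = - (p + \<theta>)" using False s True by auto
      ultimately show ?thesis by (simp only: cos_minus)
    qed (use True in simp)
  next
    case False
    then have "1 \<le> real l" by simp
    then have "2 * D * 1 \<le> 2 * D * l" using D0 by (intro mult_left_mono) auto
    then show ?thesis using p th s up by (intro cos_le_cos_dist) auto
  qed
qed

section \<open>Shape of the range for non-constant weights\<close>

text \<open>Constant weights give a normal shift whose range is the convex hull of its eigenvalues:
  these are boundary points, and for \<open>d = 2\<close> there is no interior at all. Excluding
  this case puts both 0 and the geometric mean in the interior.\<close>

locale cyclic_weights =
  fixes d :: nat and a :: "nat \<Rightarrow> real"
  assumes d2: "d \<ge> 2" and a_nonneg: "\<And>i. 0 \<le> a i" and not_const: "\<exists>i<d. a i \<noteq> a 0"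
begin

abbreviation "W \<equiv> num_range d a"

lemma d_pos: "d > 0" using d2 by simp

lemma W_nonempty: "W \<noteq> {}"
proof -
  have "nsq d (\<lambda>i. if i = 0 then 1 else 0) = 1"
    unfolding nsq_def using d_pos by (simp add: if_distrib [of cmod] if_distrib [of "\<lambda>x. x ^ 2"] cong: if_cong)
  then show ?thesis by (auto simp: num_range_def)
qed

text \<open>Monotonicity of the support function is passed on to the radial function. The normal of
  a half-plane that cuts off the point at \<open>\<theta>2\<close> can be folded to an angle
  \<open>p\<close> in \<open>[0, pi / d]\<close>. Its bound then holds for all normal angles from
  \<open>p\<close> to \<open>pi / d\<close>, and one of these is at least as close to
  \<open>\<theta>1\<close> as \<open>p\<close> is to \<open>\<theta>2\<close>, so the point at
  \<open>\<theta>1\<close> is cut off too.\<close>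

lemma radial_closure:
  assumes z: "of_real R * cis \<theta>1 \<in> closure W" and R: "R \<ge> 0" and th: "0 \<le> \<theta>2" "\<theta>2 \<le> \<theta>1" "\<theta>1 \<le> pi / d"
  shows "of_real R * cis \<theta>2 \<in> closure W"
proof (rule ccontr)
  assume "of_real R * cis \<theta>2 \<notin> closure W"
  then obtain \<psi> t where H: "\<And>w. w \<in> closure W \<Longrightarrow> Re (cis (- \<psi>) * w) \<le> t"
    and "Re (cis (- \<psi>) * (of_real R * cis \<theta>2)) > t"
    using not_in_closure_convex_direction [OF convex_num_range _ W_nonempty] by metis
  then have t: "t < R * cos (\<theta>2 - \<psi>)" by (simp add: cos_diff algebra_simps)
  have HW: "Re (cis (- \<psi>) * w) \<le> t" if "w \<in> W" for w
    using H that closure_subset by blast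
  define D where "D = pi / d"
  have D0: "D > 0" using d2 by (simp add: D_def)
  have dD: "d * D = pi" using d2 by (simp add: D_def)
  obtain l p s where l: "l < d" and p: "0 \<le> p" "p \<le> pi / d" and s: "s = p \<or> s = - p"
    and \<psi>: "cis \<psi> = unit_root d ^ l * cis s"
    using cis_fold [OF d_pos, of \<psi>] by metis
  have p: "0 \<le> p" "p \<le> D" using p by (auto simp: D_def)
  have rl: "unit_root d ^ l = cis (2 * D * l)"
    by (simp only: unit_root_def Complex.DeMoivre) (simp add: D_def ac_simps)
  have Hs: "Re (cis (- s) * w) \<le> t" if "w \<in> W" for w
  proof -
    have "cis (- \<psi>) = cnj (cis \<psi>)" by (simp add: cis_cnj)
    also have "\<dots> = cis (- (2 * D * l)) * cis (- s)" unfolding \<psi> rl by (simp add: cis_cnj)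
    finally have "cis (- \<psi>) * unit_root d ^ l = cis (- s)" unfolding rl by (simp add: cis_mult)
    then have eq: "cis (- \<psi>) * (unit_root d ^ l * w) = cis (- s) * w" by (simp only: mult.assoc [symmetric])
    show ?thesis using HW [OF num_range_unit_root_power [OF d_pos that, of l]] unfolding eq .
  qed
  have Hp: "Re (cis (- p) * w) \<le> t" if "w \<in> W" for w
  proof (cases "s = p")
    case False
    then have "Re (cis (- p) * w) = Re (cis (- s) * cnj w)" using s by auto
    then show ?thesis using Hs [OF num_range_cnj [OF that]] by simp
  qed (use Hs that in simp)
  have "cos (\<theta>2 - \<psi>) = Re (cis \<psi> * cis (- \<theta>2))" by (simp add: cis_mult cos_diff algebra_simps)
  also have "\<dots> = cos (2 * D * l + s - \<theta>2)" unfolding \<psi> rl by (simp only: cis_mult) simp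
  also have "\<dots> \<le> cos (p - \<theta>2)"
    using l d2 D_def p th s by (intro cos_fold [of l d D p]) auto
  finally have "R * cos (\<theta>2 - \<psi>) \<le> R * cos (p - \<theta>2)" using R by (rule mult_left_mono)
  then have t': "t < R * cos (p - \<theta>2)" using t by linarith
  have mono: "Re (cis (- \<phi>) * w) \<le> t" if w: "w \<in> W" and p\<phi>: "p \<le> \<phi>" and "\<phi> \<le> D" for w \<phi>
  proof -
    have "d * \<phi> \<le> pi" using that(3) d_pos by (simp add: D_def field_simps)
    then obtain z' where "z' \<in> W" "Re (cis (- \<phi>) * w) \<le> Re (cis (- p) * z')"
      using num_range_support_mono [OF d_pos a_nonneg p(1) p\<phi> _ w] by blast
    then show ?thesis using Hp by fastforce
  qed
  have cl: "R * cos (\<theta>1 - \<phi>) \<le> t" if "p \<le> \<phi>" "\<phi> \<le> D" for \<phi>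
  proof -
    have "closure W \<subseteq> {w. Re (cis (- \<phi>) * w) \<le> t}"
      using mono [OF _ that] by (intro closure_minimal closed_Collect_le continuous_intros) auto
    then have "Re (cis (- \<phi>) * (of_real R * cis \<theta>1)) \<le> t" using z by blast
    then show ?thesis by (simp add: cos_diff algebra_simps)
  qed
  consider "p \<le> \<theta>2" | "\<theta>2 < p" "p \<le> \<theta>1" | "\<theta>1 < p" by linarith
  then show False
  proof cases
    case 1
    have "R * cos (\<theta>1 - (p + \<theta>1 - \<theta>2)) \<le> t" using 1 th by (intro cl) (auto simp: D_def)
    then show False using t' by (simp add: cos_diff algebra_simps)
  next
    case 2
    have "R \<le> t" using cl [of \<theta>1] 2 th by (simp add: D_def)
    moreover have "R * cos (p - \<theta>2) \<le> R * 1" using R by (intro mult_left_mono) auto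
    ultimately show False using t' by simp
  next
    case 3
    have "D \<le> pi" using D0 dD d2 by (simp add: D_def divide_le_eq)
    then have "cos (p - \<theta>2) \<le> cos (p - \<theta>1)" using 3 p th by (intro cos_monotone_0_pi_le) auto
    then have "R * cos (p - \<theta>2) \<le> R * cos (p - \<theta>1)" using R by (rule mult_left_mono)
    moreover have "R * cos (\<theta>1 - p) \<le> t" using p by (intro cl) auto
    ultimately show False using t' by (simp add: cos_diff algebra_simps)
  qed
qed

lemma min_weight:
  obtains j where "j < d" "d * a j < (\<Sum>i<d. a i)" "\<And>i. i < d \<Longrightarrow> a j \<le> a i"
proof -
  obtain j where j: "j \<in> {..<d}" "\<And>i. i \<in> {..<d} \<Longrightarrow> a j \<le> a i"
    using ex_min_if_finite [of "a ` {..<d}"] d_pos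
    by (metis (no_types, lifting) arg_min_if_finite(1) arg_min_least empty_iff finite_lessThan lessThan_iff)
  obtain i0 where i0: "i0 < d" "a i0 \<noteq> a 0" using not_const by auto
  have "\<exists>i\<in>{..<d}. a j < a i"
    using i0 j(2) [of i0] j(2) [of 0] d_pos by (metis antisym_conv2 lessThan_iff)
  then have "(\<Sum>i<d. a j) < (\<Sum>i<d. a i)" using j by (intro sum_strict_mono_ex1) auto
  then show ?thesis using that j by auto
qed

text \<open>For each direction there is a trial vector with entries of equal modulus whose phases
  advance in that direction along all edges but one. The exceptional edge, chosen of least weight,
  costs at most twice its weight, so the support function is at least
  \<open>(S - 2 * a j) / d > 0\<close>.\<close>

lemma zero_interior: "0 \<in> interior W"
proof -
  obtain j where j: "j < d" "d * a j < (\<Sum>i<d. a i)" by (rule min_weight)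
  define S where "S = (\<Sum>i<d. a i)"
  have "2 * a j \<le> d * a j" using d2 a_nonneg [of j] by (intro mult_right_mono) auto
  then have S: "2 * a j < S" using j(2) by (simp add: S_def)
  define \<delta> where "\<delta> = (S - 2 * a j) / d"
  have \<delta>: "\<delta> > 0" using S d_pos by (simp add: \<delta>_def)
  have "ball 0 \<delta> \<subseteq> closure W"
  proof (rule subsetI, rule ccontr)
    fix z assume z: "z \<in> ball 0 \<delta>" "z \<notin> closure W"
    obtain \<psi> t where H: "\<And>w. w \<in> closure W \<Longrightarrow> Re (cis (- \<psi>) * w) \<le> t" "Re (cis (- \<psi>) * z) > t"
      using not_in_closure_convex_direction [OF convex_num_range z(2) W_nonempty] by metis
    have "Re (cis (- \<psi>) * z) \<le> cmod z"
      using complex_Re_le_cmod [of "cis (- \<psi>) * z"] by (simp add: norm_mult)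
    then have t: "t < \<delta>" using H(2) z(1) by simp
    define pos where "pos i = (i + (d - 1 - j)) mod d" for i
    define x where "x i = cis (\<psi> * pos i) / of_real (sqrt d)" for i
    have x1: "nsq d x = 1"
      using d_pos by (simp add: nsq_def x_def norm_divide power_divide)
    have sq: "complex_of_real (sqrt d) * complex_of_real (sqrt d) = of_nat d"
      by (simp flip: of_real_mult)
    have xx: "cis (- \<psi>) * (x ((i + 1) mod d) * cnj (x i)) = cis (\<psi> * (real (pos ((i + 1) mod d)) - 1 - real (pos i))) / of_nat d" for i
      using sq by (simp add: x_def cis_cnj cis_mult algebra_simps)
    have "(S - 2 * a j) / d = (\<Sum>i<d. a i * ((if i = j then - 1 else 1) / d))"
    proof -
      have "(\<Sum>i<d. a i * ((if i = j then - 1 else 1) / d)) = (\<Sum>i<d. a i / d - (if i = j then 2 * a j / d else 0))"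
        by (intro sum.cong) auto
      also have "\<dots> = S / d - 2 * a j / d"
        using j(1) by (simp add: sum_subtractf S_def sum_divide_distrib)
      finally show ?thesis by (simp add: diff_divide_distrib)
    qed
    also have "\<dots> \<le> (\<Sum>i<d. a i * Re (cis (- \<psi>) * (x ((i + 1) mod d) * cnj (x i))))"
    proof (intro sum_mono mult_left_mono a_nonneg)
      fix i assume "i \<in> {..<d}"
      then have i: "i < d" by simp
      have "(if i = j then - 1 else 1) \<le> cos (\<psi> * (real (pos ((i + 1) mod d)) - 1 - real (pos i)))"
      proof (cases "i = j")
        case False
        then have "pos ((i + 1) mod d) = Suc (pos i)"
          unfolding pos_def using shifted_position [OF j(1) i] by simp
        then show ?thesis using False by simp
      qed simp
      then show "(if i = j then - 1 else 1) / d \<le> Re (cis (- \<psi>) * (x ((i + 1) mod d) * cnj (x i)))"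
        unfolding xx using d_pos by (simp add: divide_right_mono Re_divide_of_nat)
    qed
    also have "\<dots> = Re (cis (- \<psi>) * cform d a x)"
      unfolding cform_def csesq_def sum_distrib_left Re_sum by (intro sum.cong refl) (simp add: algebra_simps)
    also have "\<dots> \<le> t" using H(1) cform_mem_num_range [OF x1, of a] closure_subset by blast
    finally show False using t by (simp add: \<delta>_def)
  qed
  then have "0 \<in> interior (closure W)"
    using \<delta> by (meson centre_in_ball interiorI open_ball)
  then show ?thesis by (simp add: convex_interior_closure convex_num_range)
qed

lemma shrink_interior:
  assumes "z \<in> closure W" "0 \<le> s" "s < 1" shows "of_real s * z \<in> interior W"
  using mem_interior_closure_convex_shrink [OF convex_num_range zero_interior assms(1), of "1 - s"] assms(2,3)
  by (simp add: scaleR_conv_of_real algebra_simps)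

lemma interior_expand:
  assumes "z \<in> interior W" obtains \<epsilon> where "\<epsilon> > 0" "of_real (1 + \<epsilon>) * z \<in> W"
proof -
  obtain e where e: "e > 0" "ball z e \<subseteq> W" using assms by (meson mem_interior)
  define \<epsilon> where "\<epsilon> = e / (2 * (1 + cmod z))"
  have n: "1 + cmod z > 0" by (smt (verit) norm_ge_zero)
  have \<epsilon>: "\<epsilon> > 0" using e n by (simp add: \<epsilon>_def)
  have half: "e / (2 * m) * m = e / 2" if "m > 0" for m :: real using that by simp
  have "\<epsilon> * cmod z < e"
  proof -
    have "\<epsilon> * cmod z \<le> \<epsilon> * (1 + cmod z)" using \<epsilon> by simp
    also have "\<dots> = e / 2" unfolding \<epsilon>_def using half [OF n] .
    finally show ?thesis using e by simp
  qed
  then have "of_real (1 + \<epsilon>) * z \<in> ball z e"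
    using \<epsilon> by (simp add: dist_norm algebra_simps norm_mult)
  then show ?thesis using that \<epsilon> e by blast
qed

text \<open>An interior point is pushed outwards within \<open>W\<close>, the statement for the
  closure is applied there, and shrinking towards the interior point 0 lands in the interior
  again.\<close>

lemma radial_interior:
  assumes z: "of_real R * cis \<theta>1 \<in> interior W" and R: "R \<ge> 0" and th: "0 \<le> \<theta>2" "\<theta>2 \<le> \<theta>1" "\<theta>1 \<le> pi / d"
  shows "of_real R * cis \<theta>2 \<in> interior W"
proof -
  obtain \<epsilon> where e: "\<epsilon> > 0" "of_real (1 + \<epsilon>) * (of_real R * cis \<theta>1) \<in> W"
    using interior_expand [OF z] by blast
  then have "of_real ((1 + \<epsilon>) * R) * cis \<theta>1 \<in> W"
    by (simp only: of_real_mult mult.assoc)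
  then have cl: "of_real ((1 + \<epsilon>) * R) * cis \<theta>1 \<in> closure W"
    using closure_subset by blast
  have "0 \<le> (1 + \<epsilon>) * R" using e R by simp
  then have "of_real ((1 + \<epsilon>) * R) * cis \<theta>2 \<in> closure W"
    by (rule radial_closure [OF cl _ th])
  then have "of_real (1 / (1 + \<epsilon>)) * (of_real ((1 + \<epsilon>) * R) * cis \<theta>2) \<in> interior W"
    using e by (intro shrink_interior) auto
  moreover have "of_real (1 / (1 + \<epsilon>)) * (of_real ((1 + \<epsilon>) * R) * cis \<theta>2) = of_real R * cis \<theta>2"
  proof -
    have "1 / (1 + \<epsilon>) * ((1 + \<epsilon>) * R) = R" using e by simp
    then show ?thesis by (metis mult.assoc of_real_mult)
  qed
  ultimately show ?thesis by simp
qed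

text \<open>The arithmetic mean of the weights is the value of the form at the constant unit vector.
  The geometric mean is strictly smaller, hence lies between the interior point 0 and a point of the
  closure.\<close>

lemma geometric_mean_interior:
  assumes \<rho>: "\<rho> \<ge> 0" "\<rho> ^ d = (\<Prod>i<d. a i)"
  shows "of_real \<rho> \<in> interior W"
proof -
  define \<mu> where "\<mu> = (\<Sum>i<d. a i) / d"
  obtain j where j: "j < d" "d * a j < (\<Sum>i<d. a i)" by (rule min_weight)
  have "d * a j \<ge> 0" using a_nonneg by simp
  then have \<mu>0: "\<mu> > 0" using j d_pos by (simp add: \<mu>_def)
  have aj: "a j \<noteq> \<mu>" using j d_pos by (auto simp: \<mu>_def field_simps)
  \<comment> \<open>Strictness comes from \<open>ln x < x - 1\<close> at the least weight, which
    differs from the mean.\<close>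
  have "(\<Prod>i<d. a i) < \<mu> ^ d"
  proof (cases "\<forall>i<d. a i > 0")
    case True
    have "(\<Sum>i<d. ln (a i / \<mu>)) < (\<Sum>i<d. a i / \<mu> - 1)"
    proof (rule sum_strict_mono_ex1)
      show "\<forall>i\<in>{..<d}. ln (a i / \<mu>) \<le> a i / \<mu> - 1" using True \<mu>0 by (auto intro!: ln_le_minus_one)
      have "ln (a j / \<mu>) \<noteq> a j / \<mu> - 1"
        using ln_eq_minus_one [of "a j / \<mu>"] True j \<mu>0 aj by auto
      then show "\<exists>i\<in>{..<d}. ln (a i / \<mu>) < a i / \<mu> - 1"
        using ln_le_minus_one [of "a j / \<mu>"] True j \<mu>0 by (intro bexI [of _ j]) auto
    qed simp
    also have "\<dots> = (\<Sum>i<d. a i) / \<mu> - d"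
      by (simp add: sum_subtractf sum_divide_distrib)
    also have "\<dots> = 0"
      using \<mu>0 d_pos unfolding \<mu>_def by (cases "(\<Sum>i<d. a i) = 0") auto
    finally have "ln (\<Prod>i<d. a i / \<mu>) < 0"
      using True \<mu>0 by (subst ln_prod) auto
    then have "(\<Prod>i<d. a i / \<mu>) < 1" using True \<mu>0 by (subst (asm) ln_less_zero_iff) (auto intro!: prod_pos)
    then show ?thesis using \<mu>0 by (simp add: prod_dividef divide_less_eq)
  next
    case False
    then have "(\<Prod>i<d. a i) = 0" using a_nonneg by (metis finite_lessThan lessThan_iff linorder_not_less order_antisym prod_zero)
    then show ?thesis using \<mu>0 by (metis zero_less_power)
  qed
  then have \<rho>\<mu>: "\<rho> < \<mu>" using \<rho> \<mu>0 by (metis less_eq_real_def power_less_imp_less_base)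
  define x where "x i = complex_of_real (1 / sqrt d)" for i :: nat
  have x1: "nsq d x = 1"
    using d_pos by (simp add: nsq_def x_def norm_divide power_divide)
  have sq: "complex_of_real (sqrt d) * complex_of_real (sqrt d) = of_nat d"
    by (simp flip: of_real_mult)
  have "cform d a x = of_real \<mu>"
    using sq by (simp add: cform_def csesq_def x_def \<mu>_def sum_divide_distrib)
  then have "of_real \<mu> \<in> closure W" using cform_mem_num_range [OF x1, of a] closure_subset by auto
  then have "of_real (\<rho> / \<mu>) * of_real \<mu> \<in> interior W"
    using \<rho> \<rho>\<mu> \<mu>0 by (intro shrink_interior) auto
  then show ?thesis using \<mu>0 by simp
qed

end

section \<open>Compactness, and when the range is a disc\<close>

text \<open>In the space of functions on all naturals the condition \<open>nsq d x = 1\<close>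
  leaves the entries from \<open>d\<close> on free. Setting them to 0 and confining the others to
  the unit disc gives a compact product with the same values of the form.\<close>

lemma compact_num_range: "compact (num_range d a)"
proof -
  define B where "B i = (if i < d then cball 0 1 else {0::complex})" for i :: nat
  have "compactin (product_topology (\<lambda>_. euclidean) UNIV) (PiE UNIV B)"
    by (subst compactin_PiE) (auto simp: B_def)
  then have cB: "compact (PiE UNIV B)"
    by (metis compactin_euclidean_iff euclidean_product_topology)
  have cn: "continuous_on UNIV (nsq d)"
    unfolding nsq_def by (intro continuous_intros continuous_on_product_coordinates)
  have cf: "continuous_on UNIV (cform d a)"
    unfolding cform_def csesq_def by (intro continuous_intros continuous_on_product_coordinates)
  have cl: "closed {x. nsq d x = 1}"
    using cn by (intro closed_Collect_eq) (auto intro: continuous_intros)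
  have "num_range d a = cform d a ` (PiE UNIV B \<inter> {x. nsq d x = 1})"
  proof
    show "cform d a ` (PiE UNIV B \<inter> {x. nsq d x = 1}) \<subseteq> num_range d a"
      by (auto simp: num_range_def)
    show "num_range d a \<subseteq> cform d a ` (PiE UNIV B \<inter> {x. nsq d x = 1})"
    proof
      fix z assume "z \<in> num_range d a"
      then obtain x where x: "nsq d x = 1" "z = cform d a x" by (auto simp: num_range_def)
      define y where "y i = (if i < d then x i else 0)" for i
      have y: "nsq d y = nsq d x" by (simp add: nsq_def y_def)
      have "cmod (y i) \<le> 1" if "i < d" for i
      proof -
        have "(cmod (y i))\<^sup>2 \<le> nsq d y" unfolding nsq_def using that
          by (intro member_le_sum) auto
        then show ?thesis using x(1) y by (simp add: abs_square_le_1)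
      qed
      then have "y \<in> PiE UNIV B" by (auto simp: B_def y_def)
      moreover have "cform d a y = cform d a x"
        unfolding cform_def csesq_def y_def by (intro sum.cong) auto
      ultimately show "z \<in> cform d a ` (PiE UNIV B \<inter> {x. nsq d x = 1})"
        using x y by (metis (mono_tags, lifting) IntI image_eqI mem_Collect_eq)
    qed
  qed
  moreover have "compact (PiE UNIV B \<inter> {x. nsq d x = 1})"
    using cB cl by (rule compact_Int_closed)
  ultimately show ?thesis
    using cf by (metis compact_continuous_image continuous_on_subset subset_UNIV)
qed

lemma complex_eq_norm: "Re v = cmod v \<Longrightarrow> v = of_real (cmod v)"
  using cmod_power2 [of v] by (simp add: complex_eq_iff)

context cyclic_weights
begin

text \<open>A vector attaining the numerical radius has no zero entry, since filling a zero would
  increase the form to first order but the norm only to second order.\<close>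

lemma maximiser_nonzero:
  assumes pos: "\<And>i. i < d \<Longrightarrow> 0 < a i" and R: "\<And>z. z \<in> W \<Longrightarrow> cmod z \<le> R"
    and y0: "\<And>i. 0 \<le> y i" and y: "(\<Sum>i<d. (y i)\<^sup>2) = 1" "(\<Sum>i<d. a i * y ((i + 1) mod d) * y i) = R"
    and i: "i < d"
  shows "y i \<noteq> 0"
proof
  assume yi: "y i = 0"
  \<comment> \<open>Walking along the cycle from a zero entry, one must meet a zero followed by a
    non-zero entry, since the vector is not 0.\<close>
  have "\<exists>j<d. y j = 0 \<and> y ((j + 1) mod d) \<noteq> 0"
  proof (rule ccontr)
    assume no: "\<not> (\<exists>j<d. y j = 0 \<and> y ((j + 1) mod d) \<noteq> 0)"
    have "y ((i + n) mod d) = 0" for n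
    proof (induction n)
      case 0
      show ?case using yi i by simp
    next
      case (Suc n)
      have "(i + n) mod d < d" using d_pos by simp
      then have "y (((i + n) mod d + 1) mod d) = 0" using no Suc.IH by blast
      then show ?case by (simp add: mod_Suc_eq)
    qed
    then have "(\<Sum>n<d. (y ((i + n) mod d))\<^sup>2) = 0" by simp
    then show False using sum_cyclic_shift [of "\<lambda>i. (y i)\<^sup>2" i d] y(1) by (simp add: add.commute)
  qed
  then obtain j where j: "j < d" "y j = 0" "y ((j + 1) mod d) \<noteq> 0" by blast
  define j' where "j' = (j + 1) mod d"
  have jj: "j' \<noteq> j" "j' < d" using d2 j(1) by (auto simp: j'_def mod_Suc)
  have yj: "y j' > 0" using j(3) y0 [of j'] by (simp add: j'_def less_le)
  define g where "g = a j * y j'"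
  have g: "g > 0" using pos [OF j(1)] yj by (simp add: g_def)
  have key: "R + g * \<epsilon> \<le> R * (1 + \<epsilon>\<^sup>2)" if \<epsilon>: "\<epsilon> > 0" for \<epsilon> :: real
  proof -
    define y' where "y' = y(j := \<epsilon>)"
    have y'y: "y i \<le> y' i" "0 \<le> y' i" for i using y0 \<epsilon> j(2) by (auto simp: y'_def)
    define x where "x i = complex_of_real (y' i)" for i
    have n: "nsq d x = 1 + \<epsilon>\<^sup>2"
    proof -
      have "nsq d x = (\<Sum>i<d. (y i)\<^sup>2 + (if i = j then \<epsilon>\<^sup>2 else 0))"
        unfolding nsq_def x_def by (intro sum.cong) (auto simp: y'_def j(2))
      then show ?thesis using y(1) j(1) by (simp add: sum.distrib)
    qed
    have "R + g * \<epsilon> = (\<Sum>i<d. a i * y ((i + 1) mod d) * y i + (if i = j then g * \<epsilon> else 0))"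
      using y(2) j(1) by (simp add: sum.distrib)
    also have "\<dots> \<le> (\<Sum>i<d. a i * y' ((i + 1) mod d) * y' i)"
    proof (rule sum_mono)
      fix i assume "i \<in> {..<d}"
      show "a i * y ((i + 1) mod d) * y i + (if i = j then g * \<epsilon> else 0) \<le> a i * y' ((i + 1) mod d) * y' i"
      proof (cases "i = j")
        case True
        then show ?thesis using jj j(2) by (simp add: y'_def g_def j'_def)
      next
        case False
        have "y ((i + 1) mod d) * y i \<le> y' ((i + 1) mod d) * y' i"
          using y'y y0 by (intro mult_mono) auto
        then have "a i * (y ((i + 1) mod d) * y i) \<le> a i * (y' ((i + 1) mod d) * y' i)"
          using a_nonneg by (rule mult_left_mono)
        then show ?thesis using False by (simp add: mult.assoc)
      qed
    qed
    finally have ge: "R + g * \<epsilon> \<le> (\<Sum>i<d. a i * y' ((i + 1) mod d) * y' i)" .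
    have cf: "cform d a x = of_real (\<Sum>i<d. a i * y' ((i + 1) mod d) * y' i)"
      by (simp add: cform_def csesq_def x_def)
    have np: "nsq d x > 0" using n by (simp add: add_pos_nonneg)
    have "cmod (cform d a x / of_real (nsq d x)) \<le> R"
      using cform_in_num_range [of d x a] np by (intro R) auto
    then have "\<bar>\<Sum>i<d. a i * y' ((i + 1) mod d) * y' i\<bar> \<le> R * nsq d x"
      unfolding cf using np by (simp add: norm_divide divide_le_eq del: of_real_sum of_real_mult)
    then show ?thesis using ge n by simp
  qed
  have "R \<ge> 0" using R W_nonempty by (meson ex_in_conv norm_ge_zero order_trans)
  then show False
  proof (cases "R = 0")
    case True
    then show False using key [of 1] g by simp
  next
    case False
    then have R0: "R > 0" using \<open>R \<ge> 0\<close> by simp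
    \<comment> \<open>For \<open>\<epsilon> = g / (2 * R)\<close> the second-order loss
      \<open>R * \<epsilon>\<^sup>2\<close> is only half of the first-order gain
      \<open>g * \<epsilon>\<close>.\<close>
    have "g * (g / (2 * R)) \<le> R * (g / (2 * R))\<^sup>2"
      using key [of "g / (2 * R)"] g R0 by (simp add: algebra_simps)
    also have "\<dots> = (g * (g / (2 * R))) / 2" using R0 by (simp add: power2_eq_square)
    finally have "g * (g / (2 * R)) \<le> g * (g / (2 * R)) / 2" .
    moreover have "g * (g / (2 * R)) > 0" using g R0 by simp
    moreover have "h \<le> h / 2 \<Longrightarrow> \<not> 0 < h" for h :: real by simp
    ultimately show False by blast
  qed
qed

text \<open>On a disc the numerical radius is also attained in the direction \<open>pi / d\<close>.
  Equality in the triangle inequality then makes every rotated summand \<open>v i\<close>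
  non-negative, and positive because a maximiser has no zero entry. But around the cycle the phases
  of the entries cancel, and the rotation contributes \<open>cis (- \<theta>) ^ d = -1\<close> to
  the product.\<close>

lemma num_range_not_disc:
  assumes pos: "\<And>i. i < d \<Longrightarrow> 0 < a i" shows "interior W \<noteq> ball 0 R"
proof
  assume eq: "interior W = ball 0 R"
  have R0: "R > 0" using zero_interior unfolding eq by simp
  have "closure (interior W) = closure W"
    using zero_interior by (intro convex_closure_interior convex_num_range) auto
  moreover have "closure W = W" using compact_num_range compact_imp_closed by (simp add: compact_imp_closed)
  ultimately have W: "W = cball 0 R" using eq R0 by simp
  define \<theta> where "\<theta> = pi / d"
  have "of_real R * cis \<theta> \<in> W" unfolding W using R0 by (simp add: norm_mult)
  then obtain x where x: "nsq d x = 1" "of_real R * cis \<theta> = cform d a x" by (auto simp: num_range_def)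
  define y where "y i = cmod (x i)" for i
  define nx where "nx i = (i + 1) mod d" for i
  have y1: "(\<Sum>i<d. (y i)\<^sup>2) = 1" using x(1) by (simp add: nsq_def y_def)
  define v where "v i = cis (- \<theta>) * (x (nx i) * cnj (x i))" for i
  have nv: "cmod (v i) = y (nx i) * y i" for i by (simp add: v_def norm_mult y_def)
  have "of_real R = cis (- \<theta>) * (of_real R * cis \<theta>)" by (simp add: cis_mult)
  also have "\<dots> = (\<Sum>i<d. of_real (a i) * v i)"
    unfolding x(2) cform_def csesq_def sum_distrib_left nx_def [symmetric]
    by (intro sum.cong) (simp_all add: v_def)
  finally have RS: "R = (\<Sum>i<d. a i * Re (v i))" by (metis (no_types, lifting) Re_complex_of_real Re_sum sum.cong times_complex.sel(1) Im_complex_of_real mult_zero_left diff_zero)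
  have le: "a i * Re (v i) \<le> a i * (y (nx i) * y i)" for i
    using complex_Re_le_cmod [of "v i"] nv a_nonneg by (simp add: mult_left_mono)
  define V where "V = (\<Sum>i<d. a i * (y (nx i) * y i))"
  have "V \<le> R"
  proof -
    have "nsq d (\<lambda>i. of_real (y i)) = 1" using y1 by (simp add: nsq_def)
    moreover have "cform d a (\<lambda>i. of_real (y i)) = of_real V"
      by (simp add: cform_def csesq_def V_def nx_def mult.assoc)
    ultimately have "complex_of_real V \<in> cball 0 R" using cform_mem_num_range W by metis
    then show ?thesis by simp
  qed
  moreover have "R \<le> V" unfolding RS V_def by (intro sum_mono le)
  ultimately have VR: "V = R" by simp
  have "(\<Sum>i<d. a i * (y (nx i) * y i) - a i * Re (v i)) = 0"
    using VR RS by (simp add: sum_subtractf V_def)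
  then have z: "\<forall>i\<in>{..<d}. a i * (y (nx i) * y i) - a i * Re (v i) = 0"
    using le by (subst (asm) sum_nonneg_eq_0_iff) auto
  have "Re (v i) = cmod (v i)" if "i < d" for i
    using bspec [OF z, of i] that pos [OF that] nv [of i] by auto
  then have v: "v i = of_real (y (nx i) * y i)" if "i < d" for i
    using complex_eq_norm that nv by metis
  have ynz: "y i \<noteq> 0" if "i < d" for i
  proof (rule maximiser_nonzero [OF pos _ _ y1 _ that])
    show "cmod z \<le> R" if "z \<in> W" for z using that unfolding W by simp
    show "(\<Sum>i<d. a i * y ((i + 1) mod d) * y i) = R" using VR by (simp add: V_def nx_def mult.assoc)
  qed (auto simp: y_def)
  define P where "P = (\<Prod>i<d. (y i)\<^sup>2)"
  have P: "P \<noteq> 0" using ynz by (simp add: P_def)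
  have re: "(\<Prod>i<d. f (nx i)) = (\<Prod>i<d. f i)" for f :: "nat \<Rightarrow> complex"
    using prod.reindex_bij_betw [OF bij_betw_add_mod, of f 1 d] by (simp add: nx_def)
  have "(\<Prod>i<d. v i) = cis (- \<theta>) ^ d * ((\<Prod>i<d. x (nx i)) * (\<Prod>i<d. cnj (x i)))"
    unfolding v_def by (simp add: prod.distrib)
  also have "(\<Prod>i<d. x (nx i)) * (\<Prod>i<d. cnj (x i)) = of_real P"
    unfolding re unfolding prod.distrib [symmetric] P_def y_def of_real_prod complex_norm_square ..
  also have "cis (- \<theta>) ^ d = -1"
    using d_pos by (simp add: Complex.DeMoivre \<theta>_def complex_eq_iff)
  finally have 1: "(\<Prod>i<d. v i) = - of_real P" by simp
  have "(\<Prod>i<d. v i) = (\<Prod>i<d. of_real (y (nx i)) * of_real (y i))" using v by simp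
  also have "\<dots> = (\<Prod>i<d. of_real (y (nx i))) * (\<Prod>i<d. of_real (y i))" by (simp add: prod.distrib)
  also have "\<dots> = of_real P" unfolding re [of "\<lambda>i. of_real (y i)"]
    by (simp add: P_def power2_eq_square prod.distrib)
  finally show False using 1 P by simp
qed

text \<open>A vanishing weight opens the cycle and makes the range invariant under all rotations;
  with convexity and compactness it is a disc, of positive radius because 0 is interior.\<close>

lemma interior_disc_of_zero_weight:
  assumes j: "j < d" "a j = 0"
  obtains R where "R > 0" "interior W = ball 0 R" "\<And>z. z \<in> W \<Longrightarrow> cmod z \<le> R"
proof -
  obtain z0 where z0: "z0 \<in> W" "\<And>z. z \<in> W \<Longrightarrow> cmod z \<le> cmod z0"
    using continuous_attains_sup [OF compact_num_range W_nonempty, of norm] by (auto intro: continuous_intros)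
  define R where "R = cmod z0"
  have sub: "cball 0 R \<subseteq> W"
  proof
    fix z :: complex assume z: "z \<in> cball 0 R"
    \<comment> \<open>The phase that turns the farthest point \<open>z0\<close> into the direction
      of \<open>z\<close>.\<close>
    define e where "e = (if z = 0 then 1 else sgn z) * (if z0 = 0 then 1 else cnj (sgn z0))"
    have e: "cmod e = 1" by (simp add: e_def norm_mult norm_sgn)
    have "e * z0 \<in> W" using num_range_rotate [OF d_pos j e z0(1)] .
    moreover have "e * z0 = (if z = 0 then 1 else sgn z) * of_real R"
    proof (cases "z0 = 0")
      case False
      have "cnj (sgn z0) * z0 = (cnj z0 * z0) / of_real (cmod z0)" by (simp add: sgn_eq)
      also have "\<dots> = of_real ((cmod z0)\<^sup>2) / of_real (cmod z0)" unfolding complex_norm_square by (simp add: mult.commute)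
      also have "\<dots> = of_real R" by (simp add: R_def power2_eq_square)
      finally show ?thesis using False by (simp add: e_def mult.assoc)
    qed (simp add: R_def)
    ultimately have w: "(if z = 0 then 1 else sgn z) * of_real R \<in> W" by simp
    have 0: "0 \<in> W" using zero_interior interior_subset by blast
    show "z \<in> W"
    proof (cases "z = 0")
      case False
      have R0: "R > 0" using False z by (smt (verit) mem_cball_0 zero_less_norm_iff)
      have "(1 - cmod z / R) *\<^sub>R 0 + (cmod z / R) *\<^sub>R (sgn z * of_real R) \<in> W"
        using 0 w False z R0 by (intro convexD [OF convex_num_range]) auto
      moreover have "(cmod z / R) *\<^sub>R (sgn z * of_real R) = z"
        using R0 False by (simp add: scaleR_conv_of_real sgn_eq)
      ultimately show ?thesis by simp
    qed (use 0 in simp)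
  qed
  moreover have sup: "W \<subseteq> cball 0 R" using z0 by (auto simp: R_def)
  ultimately have W: "W = cball 0 R" by blast
  have "interior W = ball 0 R" unfolding W by simp
  moreover have "R > 0" using zero_interior calculation by auto
  ultimately show ?thesis using that [of R] z0 by (auto simp: R_def)
qed

end

section \<open>The resolvent and half-planes containing the range\<close>

text \<open>\<open>resolvent_entry d a z i l\<close> is, up to the factor \<open>z ^ d - \<Prod>i<d. a i\<close>, the entry \<open>(l, i)\<close> of
  the resolvent at \<open>z\<close> of the weighted cyclic shift.\<close>

definition resolvent_entry :: "nat \<Rightarrow> (nat \<Rightarrow> real) \<Rightarrow> complex \<Rightarrow> nat \<Rightarrow> nat \<Rightarrow> complex" where
  "resolvent_entry d a z i l = (let m = (i + d - l) mod d in z ^ (d - 1 - m) * of_real (cyc_prod d a l m))"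

text \<open>The coordinates of \<open>z - T\<close> applied to a column of the adjugate,
  \<open>T\<close> being the shift. Off the diagonal the two terms cancel by the recursion of
  \<open>cyc_prod\<close>; on the diagonal the path closes to a full cycle.\<close>

lemma resolvent_entry_eq:
  assumes d: "d \<ge> 2" and i: "i < d" and l: "l < d"
  shows "z * resolvent_entry d a z i l - of_real (a l) * resolvent_entry d a z i ((l + 1) mod d) =
    (if l = i then z ^ d - of_real (\<Prod>j<d. a j) else 0)"
proof (cases "l = i")
  case True
  have m': "(i + d - (i + 1) mod d) mod d = d - 1"
    using i d by (cases "Suc i = d") auto
  have "a i * cyc_prod d a (Suc i mod d) (d - 1) = cyc_prod d a i (Suc (d - 1))"
    unfolding cyc_prod_Suc using i by simp
  also have "\<dots> = (\<Prod>j<d. a j)" using d cyc_prod_full [of d a i] by simp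
  finally have "of_real (a i) * complex_of_real (cyc_prod d a (Suc i mod d) (d - 1)) = of_real (\<Prod>j<d. a j)"
    by (metis of_real_mult)
  moreover have "z * z ^ (d - 1) = z ^ d" using d by (metis Suc_pred' power_Suc zero_less_numeral less_le_trans)
  moreover have "resolvent_entry d a z i ((i + 1) mod d) = of_real (cyc_prod d a (Suc i mod d) (d - 1))"
    unfolding resolvent_entry_def m' Let_def by simp
  moreover have "resolvent_entry d a z i i = z ^ (d - 1)"
    using i by (simp add: resolvent_entry_def)
  ultimately show ?thesis unfolding True by simp
next
  case False
  define m where "m = (i + d - l) mod d"
  have "m \<noteq> 0"
  proof (cases "l < i")
    case True
    then have e: "i + d - l = (i - l) + d" by simp
    have "m = (i - l) mod d" unfolding m_def e by (rule mod_add_self2)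
    then show ?thesis using True i by simp
  next
    case False
    then show ?thesis using \<open>l \<noteq> i\<close> l by (simp add: m_def)
  qed
  then obtain m0 where m0: "m = Suc m0" using not0_implies_Suc by blast
  have md: "m < d" using d by (simp add: m_def)
  have m': "(i + d - (l + 1) mod d) mod d = m0"
  proof -
    have "(i + d - (l + 1) mod d) mod d = (i + d - (l + 1)) mod d"
    proof (cases "Suc l = d")
      case True
      then show ?thesis using i by simp
    qed (use l in simp)
    also have "\<dots> = m0"
    proof -
      have "Suc (i + d - (l + 1)) = i + d - l" using l by simp
      then have "Suc (i + d - (l + 1)) mod d = Suc m0" using m0 m_def by simp
      then show ?thesis by (simp add: mod_Suc split: if_splits)
    qed
    finally show ?thesis .
  qed
  have "cyc_prod d a l m = a l * cyc_prod d a ((l + 1) mod d) m0"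
    unfolding m0 cyc_prod_Suc using l by simp
  moreover have "z ^ (d - 1 - m0) = z * z ^ (d - 1 - m)"
  proof -
    have "d - 1 - m0 = Suc (d - 1 - m)" using m0 md by simp
    then show ?thesis by simp
  qed
  ultimately show ?thesis using False unfolding resolvent_entry_def m' m_def [symmetric] Let_def by simp
qed

lemma resolvent_entry_self: "i < d \<Longrightarrow> resolvent_entry d a z i i = z ^ (d - 1)"
  by (simp add: resolvent_entry_def)

lemma resolvent_entry_shift:
  assumes "i < d" "k < d"
  shows "resolvent_entry d a z ((i + k) mod d) i = z ^ (d - 1 - k) * of_real (cyc_prod d a i k)"
proof -
  have "((i + k) mod d + d - i) mod d = k"
  proof (cases "i + k < d")
    case False
    then have "(i + k) mod d = i + k - d" using assms by (simp add: mod_if)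
    then show ?thesis using assms False by simp
  qed simp
  then show ?thesis by (simp add: resolvent_entry_def)
qed

text \<open>If the half-plane through \<open>z\<close> with normal \<nu> contains the range,
  \<open>(z - T) / \<nu>\<close> has non-negative real part, and so has its inverse. The claim is
  the quadratic form of this inverse at the sum of basis vector \<open>i\<close> and \<mu> times
  basis vector \<open>(i + k) mod d\<close>: the two diagonal entries are equal, whence
  \<open>2 * z ^ (d - 1)\<close>.\<close>

lemma resolvent_positivity:
  assumes d: "d \<ge> 2" and i: "i < d" and k: "0 < k" "k < d"
    and z: "z ^ d \<noteq> of_real (\<Prod>j<d. a j)" and \<mu>: "cmod \<mu> = 1" and \<nu>: "\<nu> \<noteq> 0"
    and pos: "\<And>\<zeta>. \<zeta> \<in> num_range d a \<Longrightarrow> 0 \<le> Re ((z - \<zeta>) / \<nu>)"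
  shows "0 \<le> Re (\<nu> * (2 * z ^ (d - 1) + \<mu> * (z ^ (d - 1 - k) * of_real (cyc_prod d a i k)) +
     cnj \<mu> * (z ^ (k - 1) * of_real (cyc_prod d a ((i + k) mod d) (d - k)))) / (z ^ d - of_real (\<Prod>j<d. a j)))"
proof -
  define c where "c = z ^ d - complex_of_real (\<Prod>j<d. a j)"
  have c: "c \<noteq> 0" using z by (simp add: c_def)
  define j where "j = (i + k) mod d"
  have j: "j < d" using d by (simp add: j_def)
  have ij: "i \<noteq> j"
  proof
    assume "i = j"
    then have "(i + k) mod d = i mod d" using i by (simp add: j_def)
    then have "d dvd k" by (metis add_diff_cancel_left' mod_eq_dvd_iff_nat le_add1)
    then show False using k by (auto dest: dvd_imp_le)
  qed
  \<comment> \<open>The inverse of \<open>(z - T) / \<nu>\<close> applied to the test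
    vector.\<close>
  define x where "x l = \<nu> * (resolvent_entry d a z i l + \<mu> * resolvent_entry d a z j l) / c" for l
  have eq: "(z * x l - of_real (a l) * x ((l + 1) mod d)) / \<nu> = (if l = i then 1 else if l = j then \<mu> else 0)" if l: "l < d" for l
  proof -
    have "(z * x l - of_real (a l) * x ((l + 1) mod d)) / \<nu> =
      ((z * resolvent_entry d a z i l - of_real (a l) * resolvent_entry d a z i ((l + 1) mod d))
        + \<mu> * (z * resolvent_entry d a z j l - of_real (a l) * resolvent_entry d a z j ((l + 1) mod d))) / c"
      using \<nu> c by (simp add: x_def field_simps)
    also have "\<dots> = (if l = i then 1 else if l = j then \<mu> else 0)"
      unfolding resolvent_entry_eq [OF d i l] resolvent_entry_eq [OF d j l] c_def [symmetric]
      using c ij by auto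
    finally show ?thesis .
  qed
  have "0 \<le> Re ((z * of_real (nsq d x) - cform d a x) / \<nu>)"
  proof (cases "nsq d x = 0")
    case True
    then have "cform d a x = 0"
      unfolding nsq_eq_0_iff by (simp add: cform_def csesq_def)
    then show ?thesis using True by simp
  next
    case False
    then have n: "nsq d x > 0" using nsq_nonneg [of d x] by linarith
    have "0 \<le> nsq d x * Re ((z - cform d a x / of_real (nsq d x)) / \<nu>)"
      using pos [OF cform_in_num_range [OF False]] n by simp
    also have "\<dots> = Re (of_real (nsq d x) * ((z - cform d a x / of_real (nsq d x)) / \<nu>))"
      by (subst times_complex.sel(1)) (simp only: Re_complex_of_real Im_complex_of_real mult_zero_left diff_zero)
    also have "of_real (nsq d x) * ((z - cform d a x / of_real (nsq d x)) / \<nu>) = (z * of_real (nsq d x) - cform d a x) / \<nu>"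
    proof -
      have "N * ((z - C / N) / \<nu>) = (z * N - C) / \<nu>" if "N \<noteq> 0" for N C :: complex
        using that by (simp add: right_diff_distrib mult.commute)
      then show ?thesis using False by simp
    qed
    finally show ?thesis .
  qed
  also have "(z * of_real (nsq d x) - cform d a x) / \<nu> = (\<Sum>l<d. (z * x l - of_real (a l) * x ((l + 1) mod d)) / \<nu> * cnj (x l))"
    unfolding of_real_nsq cinner_def cform_def csesq_def sum_distrib_left sum_subtractf [symmetric] sum_divide_distrib
    by (intro sum.cong refl) (simp add: algebra_simps)
  also have "\<dots> = (\<Sum>l<d. (if l = i then cnj (x l) else 0) + (if l = j then \<mu> * cnj (x l) else 0))"
    using eq ij by (intro sum.cong) auto
  also have "\<dots> = cnj (x i) + \<mu> * cnj (x j)"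
    using i j by (simp add: sum.distrib)
  also have "Re \<dots> = Re (x i + cnj \<mu> * x j)" by simp
  also have "x i + cnj \<mu> * x j = \<nu> * (2 * z ^ (d - 1) + \<mu> * (z ^ (d - 1 - k) * of_real (cyc_prod d a i k)) +
     cnj \<mu> * (z ^ (k - 1) * of_real (cyc_prod d a j (d - k)))) / c"
  proof -
    have "resolvent_entry d a z j i = z ^ (d - 1 - k) * of_real (cyc_prod d a i k)"
      unfolding j_def by (rule resolvent_entry_shift [OF i k(2)])
    moreover have "resolvent_entry d a z i j = z ^ (k - 1) * of_real (cyc_prod d a j (d - k))"
    proof -
      have "(j + (d - k)) mod d = (i + k + (d - k)) mod d" unfolding j_def by (rule mod_add_left_eq)
      also have "\<dots> = i" using i k by simp
      finally have "(j + (d - k)) mod d = i" .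
      moreover have "d - 1 - (d - k) = k - 1" using k by simp
      ultimately show ?thesis using resolvent_entry_shift [OF j, of "d - k" a z] k by simp
    qed
    moreover have "cnj \<mu> * \<mu> = 1" using \<mu> by (metis complex_norm_square mult.commute of_real_1 one_power2)
    ultimately show ?thesis
      unfolding x_def resolvent_entry_self [OF i] resolvent_entry_self [OF j]
      using c by (simp add: field_simps)
  qed
  finally show ?thesis unfolding j_def c_def .
qed

section \<open>Conformal maps of symmetric convex domains\<close>

lemma Re_of_real_mult: "Re (of_real r * w) = r * Re w"
  by simp

lemma disc_power_root:
  assumes d: "d > 0" and v: "cmod v < 1" obtains w where "cmod w < 1" "w ^ d = v"
proof -
  define w where "w = of_real (root d (cmod v)) * cis (Arg v / d)"
  have "w ^ d = of_real (root d (cmod v) ^ d) * cis (Arg v)"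
    unfolding w_def power_mult_distrib Complex.DeMoivre of_real_power using d by simp
  also have "root d (cmod v) ^ d = cmod v" using d by simp
  also have "of_real (cmod v) * cis (Arg v) = v" using rcis_cmod_Arg [of v] by (simp add: rcis_def)
  finally have wd: "w ^ d = v" .
  have "cmod w < 1"
  proof (rule ccontr)
    assume "\<not> cmod w < 1"
    then have "1 \<le> cmod w ^ d" by (simp add: one_le_power)
    then show False using wd v by (simp flip: norm_power)
  qed
  then show ?thesis using that wd by blast
qed

text \<open>Averaging the power series over the rotations erases every coefficient whose index is
  not a multiple of \<open>d\<close>; the rest is a power series in \<open>w ^ d\<close>, convergent
  on the disc because every point there is such a power.\<close>

lemma rotation_invariant_factor:
  assumes d: "d > 0" and h: "h holomorphic_on ball 0 1"
    and rot: "\<And>w. cmod w < 1 \<Longrightarrow> h (unit_root d * w) = h w"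
  obtains E where "E holomorphic_on ball 0 1" "\<And>w. cmod w < 1 \<Longrightarrow> h w = E (w ^ d)"
proof -
  define c where "c n = (deriv ^^ n) h 0 / fact n" for n
  have hs: "(\<lambda>n. c n * w ^ n) sums h w" if "cmod w < 1" for w
    using holomorphic_power_series [OF h, of w] that by (simp add: c_def)
  define e where "e n = (if d dvd n then c n else 0)" for n
  have hd: "(\<lambda>n. e n * w ^ n) sums h w" if w: "cmod w < 1" for w
  proof -
    have "(\<lambda>n. \<Sum>j<d. c n * (unit_root d ^ j * w) ^ n) sums (\<Sum>j<d. h (unit_root d ^ j * w))"
      by (intro sums_sum hs) (simp add: norm_mult norm_power w)
    moreover have "h (unit_root d ^ j * w) = h w" for j
    proof (induction j)
      case (Suc j)
      have "h (unit_root d * (unit_root d ^ j * w)) = h (unit_root d ^ j * w)"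
        by (rule rot) (simp add: norm_mult norm_power w)
      then show ?case using Suc.IH by (simp add: mult.assoc)
    qed simp
    moreover have "(\<Sum>j<d. c n * (unit_root d ^ j * w) ^ n) = of_nat d * (e n * w ^ n)" for n
    proof -
      have "(\<Sum>j<d. c n * (unit_root d ^ j * w) ^ n) = c n * w ^ n * (\<Sum>j<d. (unit_root d ^ j) ^ n)"
        by (simp add: sum_distrib_left power_mult_distrib ac_simps)
      then show ?thesis unfolding unit_root_sum [OF d] by (simp add: e_def)
    qed
    ultimately have "(\<lambda>n. of_nat d * (e n * w ^ n)) sums (of_nat d * h w)" by simp
    then show ?thesis using d by (simp add: sums_mult_iff)
  qed
  define E where "E v = (\<Sum>m. c (d * m) * v ^ m)" for v
  have Es: "(\<lambda>m. c (d * m) * (w ^ d) ^ m) sums h w" if w: "cmod w < 1" for w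
  proof -
    have "strict_mono (\<lambda>m. d * m)" using d by (auto simp: strict_mono_def)
    then have "(\<lambda>m. e (d * m) * w ^ (d * m)) sums h w"
      using hd [OF w] by (subst sums_mono_reindex) (auto simp: e_def dvd_def)
    then show ?thesis by (simp add: e_def power_mult)
  qed
  have "E holomorphic_on ball 0 1"
  proof (rule power_series_holomorphic)
    fix v :: complex assume "v \<in> ball 0 1"
    then obtain w where w: "cmod w < 1" "w ^ d = v" using disc_power_root [OF d, of v] by auto
    from Es [OF w(1)] have "(\<lambda>m. c (d * m) * v ^ m) sums h w" unfolding w(2) .
    then show "(\<lambda>m. c (d * m) * (v - 0) ^ m) sums E v"
      unfolding E_def by (simp add: sums_unique [symmetric])
  qed
  moreover have "h w = E (w ^ d)" if "cmod w < 1" for w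
    unfolding E_def using sums_unique [OF Es [OF that]] .
  ultimately show ?thesis using that by blast
qed

text \<open>A disc automorphism moves the preimage of 0 to 0, and a rotation by the phase
  \<open>e\<close> turns the derivative of the inverse map at 0 onto the positive axis.\<close>

lemma normalised_Riemann_map:
  assumes "open S" "convex S" "S \<noteq> UNIV" "0 \<in> S"
  obtains F \<phi> c where "F holomorphic_on ball 0 1" "\<phi> holomorphic_on S"
    "\<And>w. cmod w < 1 \<Longrightarrow> F w \<in> S" "\<And>z. z \<in> S \<Longrightarrow> cmod (\<phi> z) < 1"
    "\<And>w. cmod w < 1 \<Longrightarrow> \<phi> (F w) = w" "\<And>z. z \<in> S \<Longrightarrow> F (\<phi> z) = z"
    "F 0 = 0" "deriv F 0 = of_real c" "c > 0"
proof -
  obtain f g where f: "f holomorphic_on S" and g: "g holomorphic_on ball 0 1"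
    and fS: "\<And>z. z \<in> S \<Longrightarrow> f z \<in> ball 0 1 \<and> g (f z) = z"
    and gB: "\<And>w. w \<in> ball 0 1 \<Longrightarrow> g w \<in> S \<and> f (g w) = w"
    using Riemann_mapping_theorem [of S] assms convex_imp_simply_connected by blast
  have b: "f 0 \<in> ball 0 1" using fS assms(4) by blast
  obtain m m' where m: "m (f 0) = 0" "m holomorphic_on ball 0 1" "m ` ball 0 1 \<subseteq> ball 0 1"
    "m' holomorphic_on ball 0 1" "m' ` ball 0 1 \<subseteq> ball 0 1"
    "\<And>z. z \<in> ball 0 1 \<Longrightarrow> m (m' z) = z" "\<And>z. z \<in> ball 0 1 \<Longrightarrow> m' (m z) = z"
    using ball_biholomorphism_exists [OF b] by blast
  define F0 where "F0 w = g (m' w)" for w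
  have holF0: "F0 holomorphic_on ball 0 1"
    unfolding F0_def using holomorphic_on_compose_gen [OF m(4) g m(5)] by (simp add: o_def)
  have injF0: "inj_on F0 (ball 0 1)"
  proof (rule inj_on_inverseI [of _ "\<lambda>z. m (f z)"])
    fix w :: complex assume w: "w \<in> ball 0 1"
    then have "m' w \<in> ball 0 1" using m(5) by blast
    then show "m (f (F0 w)) = w" using gB m(6) [OF w] by (simp add: F0_def)
  qed
  define D where "D = deriv F0 0"
  have D: "D \<noteq> 0" unfolding D_def
    using holF0 injF0 by (intro holomorphic_injective_imp_regular [of _ "ball 0 1"]) auto
  define e where "e = cnj (sgn D)"
  have e1: "cmod e = 1" using D by (simp add: e_def norm_sgn)
  then have e0: "e \<noteq> 0" by auto
  have eD: "e * D = of_real (cmod D)"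
  proof -
    have "e * D = (D * cnj D) / of_real (cmod D)" by (simp add: e_def sgn_eq mult.commute)
    also have "\<dots> = of_real ((cmod D)\<^sup>2) / of_real (cmod D)" unfolding complex_norm_square ..
    also have "\<dots> = of_real (cmod D)" by (simp add: power2_eq_square)
    finally show ?thesis .
  qed
  show ?thesis
  proof (rule that [of "\<lambda>w. F0 (e * w)" "\<lambda>z. m (f z) / e" "cmod D"])
    have sub: "(\<lambda>w. e * w) ` ball 0 1 \<subseteq> ball 0 1" using e1 by (auto simp: norm_mult)
    show "(\<lambda>w. F0 (e * w)) holomorphic_on ball 0 1"
      using holomorphic_on_compose_gen [OF _ holF0 sub] by (simp add: o_def holomorphic_intros)
    have "(\<lambda>z. m (f z)) holomorphic_on S"
    proof -
      have "f ` S \<subseteq> ball 0 1" using fS by blast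
      then show ?thesis using holomorphic_on_compose_gen [OF f m(2)] by (simp add: o_def)
    qed
    then show "(\<lambda>z. m (f z) / e) holomorphic_on S" using e0 by (intro holomorphic_intros)
    fix w :: complex assume "cmod w < 1"
    then have ew: "e * w \<in> ball 0 1" using e1 by (simp add: norm_mult)
    then have "m' (e * w) \<in> ball 0 1" using m(5) by blast
    then show "F0 (e * w) \<in> S" "m (f (F0 (e * w))) / e = w"
      using gB m(6) [OF ew] e0 by (auto simp: F0_def)
  next
    fix z assume z: "z \<in> S"
    then have "m (f z) \<in> ball 0 1" using fS m(3) by blast
    then show "cmod (m (f z) / e) < 1" using e1 by (simp add: norm_divide)
    show "F0 (e * (m (f z) / e)) = z" using e0 fS [OF z] m(7) by (simp add: F0_def)
  next
    show "F0 (e * 0) = 0" using fS [OF assms(4)] m(7) [OF b] m(1) by (simp add: F0_def)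
    have "(F0 has_field_derivative D) (at (e * 0))"
      unfolding D_def using holF0 by (simp add: holomorphic_derivI [of _ "ball 0 1"])
    then have "((\<lambda>w. F0 (e * w)) has_field_derivative D * e) (at 0)"
      by (rule DERIV_chain2) (auto intro!: derivative_eq_intros)
    then show "deriv (\<lambda>w. F0 (e * w)) 0 = of_real (cmod D)"
      using eD by (metis DERIV_imp_deriv mult.commute)
    show "cmod D > 0" using D by simp
  qed
qed

section \<open>The Riemann map and its symmetries\<close>

text \<open>What the function theory needs of the interior of the numerical range: convexity, the
  dihedral symmetry, and the decrease of the radial function on a half-sector. The inverse map
  \<open>F\<close> is carried along because symmetries and inequalities are easier to state on the
  disc.\<close>

locale symmetric_conformal =
  fixes d :: nat and S :: "complex set" and F \<phi> :: "complex \<Rightarrow> complex" and c :: real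
  assumes d2: "d \<ge> 2" and S: "open S" "convex S" "bounded S" "0 \<in> S"
    and holF: "F holomorphic_on ball 0 1" and hol\<phi>: "\<phi> holomorphic_on S"
    and F_in: "\<And>w. cmod w < 1 \<Longrightarrow> F w \<in> S" and \<phi>_in: "\<And>z. z \<in> S \<Longrightarrow> cmod (\<phi> z) < 1"
    and \<phi>F: "\<And>w. cmod w < 1 \<Longrightarrow> \<phi> (F w) = w" and F\<phi>: "\<And>z. z \<in> S \<Longrightarrow> F (\<phi> z) = z"
    and F0: "F 0 = 0" and F'0: "deriv F 0 = of_real c" and c: "c > 0"
    and S_rot: "\<And>z. z \<in> S \<Longrightarrow> unit_root d * z \<in> S" and S_cnj: "\<And>z. z \<in> S \<Longrightarrow> cnj z \<in> S"
    and S_radial: "\<And>R \<theta>1 \<theta>2. \<lbrakk>of_real R * cis \<theta>1 \<in> S; 0 \<le> R; 0 \<le> \<theta>2; \<theta>2 \<le> \<theta>1; \<theta>1 \<le> pi / d\<rbrakk>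
        \<Longrightarrow> of_real R * cis \<theta>2 \<in> S"
begin

lemma d_positive: "d > 0" using d2 by simp

lemma F_inj: "cmod v < 1 \<Longrightarrow> cmod w < 1 \<Longrightarrow> F v = F w \<Longrightarrow> v = w"
  using \<phi>F by metis

lemma \<phi>0: "\<phi> 0 = 0" using \<phi>F [of 0] F0 by simp

lemma S_rot_power: "z \<in> S \<Longrightarrow> unit_root d ^ j * z \<in> S"
  by (induction j) (use S_rot in \<open>auto simp: mult.assoc\<close>)

lemma F_deriv: "cmod w < 1 \<Longrightarrow> (F has_field_derivative deriv F w) (at w)"
  using holF by (intro holomorphic_derivI [of _ "ball 0 1"]) auto

lemma \<phi>_deriv: "z \<in> S \<Longrightarrow> (\<phi> has_field_derivative deriv \<phi> z) (at z)"
  using hol\<phi> S by (intro holomorphic_derivI [of _ S]) auto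

lemma \<phi>F_deriv: assumes "cmod w < 1" shows "deriv \<phi> (F w) * deriv F w = 1"
proof -
  have "((\<lambda>w. \<phi> (F w)) has_field_derivative deriv \<phi> (F w) * deriv F w) (at w)"
    using \<phi>_deriv [OF F_in [OF assms]] F_deriv [OF assms] by (rule DERIV_chain2)
  moreover have "((\<lambda>w. \<phi> (F w)) has_field_derivative 1) (at w)"
  proof (rule has_field_derivative_transform_within_open [of "\<lambda>w. w" _ _ "ball 0 1"])
  qed (use assms \<phi>F in \<open>auto intro!: derivative_eq_intros\<close>)
  ultimately show ?thesis by (rule DERIV_unique)
qed

text \<open>Following \<open>H\<close> by \<phi> gives a self-map of the disc that fixes 0 with
  derivative 1, the equality case of Schwarz's lemma. Applied to conjugates of \<open>F\<close> by a
  symmetry of \<open>S\<close>, this shows that \<open>F\<close> commutes with the symmetry.\<close>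

lemma F_unique:
  assumes H: "H holomorphic_on ball 0 1" "\<And>w. cmod w < 1 \<Longrightarrow> H w \<in> S" "H 0 = 0"
    "(H has_field_derivative of_real c) (at 0)" and w: "cmod w < 1"
  shows "H w = F w"
proof -
  define G where "G w = \<phi> (H w)" for w
  have holG: "G holomorphic_on ball 0 1"
  proof -
    have "H ` ball 0 1 \<subseteq> S" using H(2) by auto
    then show ?thesis unfolding G_def using holomorphic_on_compose_gen [OF H(1) hol\<phi>] by (simp add: o_def)
  qed
  have G0: "G 0 = 0" by (simp add: G_def H(3) \<phi>0)
  have "(G has_field_derivative deriv \<phi> 0 * of_real c) (at 0)"
    unfolding G_def using \<phi>_deriv [OF S(4)] H(3,4) by (metis DERIV_chain2)
  then have dG: "(G has_field_derivative 1) (at 0)"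
    using \<phi>F_deriv [of 0] F0 F'0 by simp
  have Gb: "cmod (G w) < 1" if "cmod w < 1" for w using H(2) \<phi>_in that by (simp add: G_def)
  have "cmod (deriv G 0) = 1" using dG DERIV_imp_deriv by (metis norm_one)
  then obtain \<alpha> where \<alpha>: "\<And>z. cmod z < 1 \<Longrightarrow> G z = \<alpha> * z"
    using Schwarz_Lemma(3) [OF holG G0 Gb, of 0] by auto
  have "(G has_field_derivative \<alpha>) (at 0)"
    by (rule has_field_derivative_transform_within_open [of "\<lambda>w. \<alpha> * w" _ _ "ball 0 1"])
       (use \<alpha> in \<open>auto intro!: derivative_eq_intros\<close>)
  then have "\<alpha> = 1" using dG by (rule DERIV_unique)
  then show ?thesis using \<alpha> [OF w] F\<phi> [OF H(2) [OF w]] by (simp add: G_def)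
qed

lemma F_rot: assumes w: "cmod w < 1" shows "F (unit_root d * w) = unit_root d * F w"
proof -
  define H where "H w = F (unit_root d * w) / unit_root d" for w
  have inv: "inverse (unit_root d) = unit_root d ^ (d - 1)"
    using unit_root_power [OF d_positive] d_positive by (simp add: power_eq_if field_simps)
  have sub: "(\<lambda>w. unit_root d * w) ` ball 0 1 \<subseteq> ball 0 1" by (auto simp: norm_mult)
  have "H w = F w"
  proof (rule F_unique [OF _ _ _ _ w])
    have "(\<lambda>w. F (unit_root d * w)) holomorphic_on ball 0 1"
      using holomorphic_on_compose_gen [OF _ holF sub] by (simp add: o_def holomorphic_intros)
    then show "H holomorphic_on ball 0 1" unfolding H_def by (intro holomorphic_intros) auto
    show "H w \<in> S" if "cmod w < 1" for w
    proof -
      have "H w = unit_root d ^ (d - 1) * F (unit_root d * w)"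
        unfolding H_def inv [symmetric] by (simp add: divide_inverse mult.commute)
      then show ?thesis using S_rot_power F_in [of "unit_root d * w"] that by (simp add: norm_mult)
    qed
    show "H 0 = 0" by (simp add: H_def F0)
    have "(F has_field_derivative of_real c) (at (unit_root d * 0))" using F_deriv [of 0] F'0 by simp
    then have "((\<lambda>w. F (unit_root d * w)) has_field_derivative of_real c * unit_root d) (at 0)"
      by (rule DERIV_chain2) (auto intro!: derivative_eq_intros)
    then show "(H has_field_derivative of_real c) (at 0)"
      unfolding H_def by (auto intro!: derivative_eq_intros)
  qed
  then show ?thesis by (simp add: H_def field_simps)
qed

lemma F_cnj: assumes w: "cmod w < 1" shows "F (cnj w) = cnj (F w)"
proof -
  have "(cnj \<circ> F \<circ> cnj) w = F w"
  proof (rule F_unique [OF _ _ _ _ w])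
    have "cnj ` ball 0 1 = ball 0 1"
    proof (intro equalityI subsetI)
      fix x :: complex assume "x \<in> ball 0 1"
      then show "x \<in> cnj ` ball 0 1" by (intro image_eqI [of _ _ "cnj x"]) auto
    qed auto
    then show "(cnj \<circ> F \<circ> cnj) holomorphic_on ball 0 1"
      using holF by (intro holomorphic_on_compose_cnj_cnj) auto
    show "(cnj \<circ> F \<circ> cnj) w \<in> S" if "cmod w < 1" for w
      using F_in S_cnj that by simp
    show "(cnj \<circ> F \<circ> cnj) 0 = 0" by (simp add: F0)
    show "((cnj \<circ> F \<circ> cnj) has_field_derivative of_real c) (at 0)"
      using has_field_derivative_cnj_cnj [of F "of_real c" 0] F_deriv [of 0] F'0 by simp
  qed
  then show ?thesis by (metis complex_cnj_cnj comp_apply)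
qed

lemma \<phi>_rot: assumes "z \<in> S" shows "\<phi> (unit_root d * z) = unit_root d * \<phi> z"
proof -
  have "F (unit_root d * \<phi> z) = unit_root d * z" using F_rot [of "\<phi> z"] \<phi>_in F\<phi> assms by simp
  then show ?thesis using \<phi>F [of "unit_root d * \<phi> z"] \<phi>_in [OF assms] by (simp add: norm_mult)
qed

lemma \<phi>_rot_power: assumes "z \<in> S" shows "\<phi> (unit_root d ^ j * z) = unit_root d ^ j * \<phi> z"
proof (induction j)
  case (Suc j)
  then show ?case using \<phi>_rot [OF S_rot_power [OF assms, of j]] by (simp add: mult.assoc)
qed simp

lemma \<phi>_cnj: assumes "z \<in> S" shows "\<phi> (cnj z) = cnj (\<phi> z)"
  using F_cnj [of "\<phi> z"] \<phi>_in [OF assms] F\<phi> [OF assms] \<phi>F [of "cnj (\<phi> z)"] by simp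

text \<open>Study: \<open>z \<mapsto> \<phi> ((1 - t) F z + t F (v z / w))\<close> maps the disc to itself and fixes 0; Schwarz at
  \<open>w\<close> and differentiation in \<open>t\<close> at 0.\<close>

lemma Study_inequality:
  assumes w: "cmod w < 1" "w \<noteq> 0" and v: "cmod v \<le> cmod w"
  shows "0 \<le> Re ((F w - F v) / (w * deriv F w))"
proof -
  define z where "z t = F w + of_real t * (F v - F w)" for t :: real
  have v1: "cmod v < 1" using v w by simp
  have le: "cmod (\<phi> (z t)) \<le> cmod w" if t: "0 \<le> t" "t \<le> 1" for t
  proof -
    define H where "H x = (1 - t) *\<^sub>R F x + t *\<^sub>R F (v / w * x)" for x
    have vw: "cmod (v / w) \<le> 1" using v w by (simp add: norm_divide divide_le_eq_1)
    have vx: "cmod (v / w * x) < 1" if "cmod x < 1" for x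
    proof -
      have "cmod (v / w * x) \<le> 1 * cmod x"
        unfolding norm_mult [of "v / w"] using vw by (intro mult_right_mono) auto
      then show ?thesis using that by simp
    qed
    have HS: "H x \<in> S" if "cmod x < 1" for x
      unfolding H_def using t F_in [OF that] F_in [OF vx [OF that]] by (intro convexD [OF S(2)]) auto
    have "(\<lambda>x. F (v / w * x)) holomorphic_on ball 0 1"
    proof -
      have sub: "(\<lambda>x. v / w * x) ` ball 0 1 \<subseteq> ball 0 1" using vx by auto
      have "(\<lambda>x. v / w * x) holomorphic_on ball 0 1" by (intro holomorphic_intros) (use w in auto)
      from holomorphic_on_compose_gen [OF this holF sub] show ?thesis by (simp add: o_def)
    qed
    then have "H holomorphic_on ball 0 1"
      unfolding H_def scaleR_conv_of_real using holF by (intro holomorphic_intros)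
    then have hol: "(\<lambda>x. \<phi> (H x)) holomorphic_on ball 0 1"
    proof -
      assume hH: "H holomorphic_on ball 0 1"
      have "H ` ball 0 1 \<subseteq> S" using HS by auto
      then show ?thesis using holomorphic_on_compose_gen [OF hH hol\<phi>] by (simp add: o_def)
    qed
    have "cmod (\<phi> (H w)) \<le> cmod w"
      using HS \<phi>_in by (intro Schwarz_Lemma(1) [OF hol _ _ w(1)]) (auto simp: H_def F0 \<phi>0)
    moreover have "H w = z t"
      using w by (simp add: H_def z_def scaleR_conv_of_real algebra_simps)
    ultimately show ?thesis by simp
  qed
  define D where "D = deriv \<phi> (F w) * (F v - F w)"
  have z0: "z 0 = F w" by (simp add: z_def)
  have dz: "((\<lambda>t. \<phi> (z t)) has_vector_derivative D) (at 0)"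
  proof -
    have "(z has_vector_derivative (F v - F w)) (at 0)"
      unfolding z_def scaleR_conv_of_real [symmetric] by (auto intro!: derivative_eq_intros)
    moreover have "(\<phi> has_field_derivative deriv \<phi> (F w)) (at (z 0))"
      unfolding z0 by (rule \<phi>_deriv [OF F_in [OF w(1)]])
    ultimately have "((\<phi> \<circ> z) has_vector_derivative (F v - F w) * deriv \<phi> (F w)) (at 0)"
      using field_vector_diff_chain_at by blast
    then show ?thesis by (simp add: o_def D_def mult.commute)
  qed
  have dd: "((\<lambda>t. inner (\<phi> (z t)) (\<phi> (z t))) has_real_derivative (2 * inner w D)) (at 0)"
  proof -
    have "((\<lambda>t. inner (\<phi> (z t)) (\<phi> (z t))) has_vector_derivative (inner (\<phi> (z 0)) D + inner D (\<phi> (z 0)))) (at 0)"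
      using bounded_bilinear.has_vector_derivative [OF bounded_bilinear_inner dz dz] .
    moreover have "\<phi> (z 0) = w" using z0 \<phi>F w by simp
    ultimately show ?thesis by (simp add: has_real_derivative_iff_has_vector_derivative inner_commute)
  qed
  \<comment> \<open>The modulus of \<open>\<phi> (z t)\<close> equals that of \<open>w\<close> at
    \<open>t = 0\<close> and does not exceed it on \<open>[0, 1]\<close>, so its square cannot have
    a positive derivative at 0.\<close>
  have "2 * inner w D \<le> 0"
  proof (rule ccontr)
    assume "\<not> 2 * inner w D \<le> 0"
    then have "0 < 2 * inner w D" by simp
    from DERIV_pos_inc_right [OF dd this] obtain e where e: "e > 0"
      "\<And>h. 0 < h \<Longrightarrow> h < e \<Longrightarrow> inner (\<phi> (z 0)) (\<phi> (z 0)) < inner (\<phi> (z (0 + h))) (\<phi> (z (0 + h)))"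
      by blast
      define h where "h = min 1 (e / 2)"
      have h: "0 < h" "h < e" "h \<le> 1" using e(1) by (auto simp: h_def)
      have "(cmod (\<phi> (z 0)))\<^sup>2 < (cmod (\<phi> (z h)))\<^sup>2"
        using e(2) [OF h(1,2)] by (simp add: dot_square_norm)
      moreover have "(cmod (\<phi> (z h)))\<^sup>2 \<le> (cmod w)\<^sup>2" using le [of h] h by (intro power_mono) auto
      ultimately show False using z0 \<phi>F w by simp
  qed
  then have "Re (cnj w * D) \<le> 0" by (simp add: inner_complex_def)
  moreover have "deriv F w \<noteq> 0" using \<phi>F_deriv [OF w(1)] by auto
  then have De: "D = - ((F w - F v) / deriv F w)"
    using \<phi>F_deriv [OF w(1)] by (simp add: D_def field_simps)
  ultimately have "0 \<le> Re (cnj w * ((F w - F v) / deriv F w))"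
    unfolding De mult_minus_right uminus_complex.sel by linarith
  also have "cnj w * ((F w - F v) / deriv F w) = of_real ((cmod w)\<^sup>2) * ((F w - F v) / (w * deriv F w))"
    unfolding complex_norm_square using w by simp
  finally have "0 \<le> (cmod w)\<^sup>2 * Re ((F w - F v) / (w * deriv F w))" unfolding Re_of_real_mult .
  moreover have "0 < (cmod w)\<^sup>2" using w by simp
  ultimately show ?thesis by (simp only: zero_le_mult_iff) linarith
qed

end

section \<open>Reflection, and the growth of the Riemann map along the real ray\<close>

lemma closed_sector_polar:
  assumes z: "0 \<le> Im (cis (- \<beta>) * z)" "Im (cis (- (\<beta> + \<alpha>)) * z) \<le> 0" and \<alpha>: "0 < \<alpha>" "\<alpha> < pi"
  obtains R \<psi> where "0 \<le> R" "\<beta> \<le> \<psi>" "\<psi> \<le> \<beta> + \<alpha>" "z = of_real R * cis \<psi>"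
proof (cases "z = 0")
  case True
  then show ?thesis using that [of 0 \<beta>] \<alpha> by simp
next
  case False
  define w where "w = cis (- \<beta>) * z"
  define R where "R = cmod w"
  define \<omega> where "\<omega> = Arg w"
  have w0: "w \<noteq> 0" using False by (simp add: w_def)
  then have R: "R > 0" by (simp add: R_def)
  have w: "w = of_real R * cis \<omega>" using rcis_cmod_Arg [of w] by (simp add: rcis_def R_def \<omega>_def)
  have \<omega>: "- pi < \<omega>" "\<omega> \<le> pi" using Arg_bounded [of w] by (auto simp: \<omega>_def)
  have zw: "z = cis \<beta> * w" by (simp add: w_def cis_mult flip: mult.assoc)
  have "0 \<le> R * sin \<omega>" using z(1) unfolding w_def [symmetric] w by simp
  then have s: "0 \<le> sin \<omega>" using R by (simp add: zero_le_mult_iff)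
  have \<omega>0: "0 \<le> \<omega>"
  proof (rule ccontr)
    assume "\<not> 0 \<le> \<omega>"
    then have "sin (- \<omega>) > 0" using \<omega> by (intro sin_gt_zero) auto
    then show False using s by simp
  qed
  have "cis (- (\<beta> + \<alpha>)) * z = of_real R * cis (\<omega> - \<alpha>)"
    unfolding zw w by (simp add: cis_mult)
  then have "R * sin (\<omega> - \<alpha>) \<le> 0" using z(2) by simp
  then have s2: "sin (\<omega> - \<alpha>) \<le> 0" using R by (simp add: mult_le_0_iff)
  have "\<omega> \<le> \<alpha>"
  proof (rule ccontr)
    assume "\<not> \<omega> \<le> \<alpha>"
    then have "sin (\<omega> - \<alpha>) > 0" using \<omega> \<alpha> by (intro sin_gt_zero) auto
    then show False using s2 by simp
  qed
  then show ?thesis using that [of R "\<beta> + \<omega>"] R \<omega>0 zw w by (simp add: cis_mult [symmetric] ac_simps)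
qed

context symmetric_conformal
begin

text \<open>Rotational symmetry forces \<open>F\<close> to be \<open>w\<close> times a function of
  \<open>w ^ d\<close>. All later integrals are taken in the variable \<open>v = w ^ d\<close>,
  where the preimages of the \<open>d\<close> eigenvalues are a single point.\<close>

definition E where "E = (SOME E. E holomorphic_on ball 0 1 \<and> (\<forall>w. cmod w < 1 \<longrightarrow> F w = w * E (w ^ d)) \<and> E 0 = of_real c)"

lemma E: "E holomorphic_on ball 0 1" "cmod w < 1 \<Longrightarrow> F w = w * E (w ^ d)" "E 0 = of_real c"
proof -
  obtain h where h: "h holomorphic_on ball 0 1" "\<And>z. cmod z < 1 \<Longrightarrow> F z = z * h z" "deriv F 0 = h 0"
    using Schwarz3 [OF holF F0] by blast
  have rot: "h (unit_root d * w) = h w" if w: "cmod w < 1" for w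
  proof (cases "w = 0")
    case False
    have "unit_root d * w * h (unit_root d * w) = unit_root d * (w * h w)"
      using F_rot [OF w] h(2) [of w] h(2) [of "unit_root d * w"] w by (simp add: norm_mult)
    then show ?thesis using False by simp
  qed simp
  obtain E1 where E1: "E1 holomorphic_on ball 0 1" "\<And>w. cmod w < 1 \<Longrightarrow> h w = E1 (w ^ d)"
    using rotation_invariant_factor [OF d_positive h(1) rot] by blast
  have "E1 0 = of_real c" using E1(2) [of 0] h(3) F'0 by (simp add: zero_power [OF d_positive])
  then have "\<exists>E. E holomorphic_on ball 0 1 \<and> (\<forall>w. cmod w < 1 \<longrightarrow> F w = w * E (w ^ d)) \<and> E 0 = of_real c"
    using E1 h(2) by auto
  from someI_ex [OF this, folded E_def]
  show "E holomorphic_on ball 0 1" "cmod w < 1 \<Longrightarrow> F w = w * E (w ^ d)" "E 0 = of_real c" by blast+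
qed

lemma E_nonzero: assumes "cmod v < 1" shows "E v \<noteq> 0"
proof (cases "v = 0")
  case True
  then show ?thesis using E(3) c by simp
next
  case False
  obtain w where w: "cmod w < 1" "w ^ d = v" using disc_power_root [OF d_positive assms] by blast
  have "w \<noteq> 0" using w False d_positive by auto
  then have "F w \<noteq> 0" using F_inj [OF w(1), of 0] F0 by auto
  then show ?thesis using E(2) [OF w(1)] w(2) by auto
qed

lemma E_cnj: assumes "cmod v < 1" shows "E (cnj v) = cnj (E v)"
proof (cases "v = 0")
  case True
  then show ?thesis using E(3) by simp
next
  case False
  obtain w where w: "cmod w < 1" "w ^ d = v" using disc_power_root [OF d_positive assms] by blast
  have w0: "w \<noteq> 0" using w False d_positive by auto
  have cw: "cnj w ^ d = cnj v" using w(2) by (metis complex_cnj_power)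
  have "cnj w * E (cnj v) = cnj w * cnj (E v)"
    using E(2) [OF w(1)] E(2) [of "cnj w"] F_cnj [OF w(1)] w unfolding cw by auto
  then show ?thesis using w0 by simp
qed

text \<open>Conjugation symmetry makes \<open>E\<close> real on the real diameter. It has no zero in
  the disc, so it keeps there the sign of \<open>E 0 = c\<close>.\<close>

lemma E_real: assumes "\<bar>x\<bar> < 1" shows "E (of_real x) = of_real (Re (E (of_real x)))" "Re (E (of_real x)) > 0"
proof -
  have re: "E (of_real y) = of_real (Re (E (of_real y)))" if "\<bar>y\<bar> < 1" for y
    using E_cnj [of "of_real y"] that by (simp add: complex_eq_iff)
  show "E (of_real x) = of_real (Re (E (of_real x)))" using re assms .
  show "Re (E (of_real x)) > 0"
  proof (rule ccontr)
    assume neg: "\<not> Re (E (of_real x)) > 0"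
    define g where "g s = Re (E (of_real (s * x)))" for s
    have sx: "\<bar>s * x\<bar> < 1" if "0 \<le> s" "s \<le> 1" for s
    proof -
      have "\<bar>s * x\<bar> \<le> 1 * \<bar>x\<bar>" unfolding abs_mult using that by (intro mult_right_mono) auto
      then show ?thesis using assms by simp
    qed
    have "continuous_on {0..1} g"
      unfolding g_def
    proof (intro continuous_intros continuous_on_compose2 [OF holomorphic_on_imp_continuous_on [OF E(1)]])
      show "(\<lambda>s. complex_of_real (s * x)) ` {0..1} \<subseteq> ball 0 1" using sx by (auto simp del: of_real_mult)
    qed
    moreover have "g 0 = c" using E(3) by (simp add: g_def)
    ultimately have "\<exists>s\<ge>0. s \<le> 1 \<and> g s = 0" using neg c by (intro IVT2') (auto simp: g_def)
    then obtain s where s: "0 \<le> s" "s \<le> 1" "g s = 0" by auto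
    then show False using E_nonzero [of "of_real (s * x)"] re [OF sx [OF s(1,2)]] sx [OF s(1,2)]
      by (simp add: g_def del: of_real_mult)
  qed
qed

text \<open>The restriction of \<open>E\<close> to the real diameter. A non-negative real point of
  \<open>S\<close> with preimage \<open>t\<close> is \<open>t * e (t ^ d)\<close>, so the factor of
  \<phi> at that point is \<open>1 / e (t ^ d)\<close>.\<close>

definition e where "e x = Re (E (of_real x))"

lemma E_of_real: "\<bar>x\<bar> < 1 \<Longrightarrow> E (of_real x) = of_real (e x)"
  unfolding e_def by (rule E_real)

lemma e_pos: "\<bar>x\<bar> < 1 \<Longrightarrow> e x > 0"
  unfolding e_def by (rule E_real)

lemma e_0: "e 0 = c" by (simp add: e_def E(3))

lemma F_of_real: assumes "\<bar>t\<bar> < 1" shows "F (of_real t) = of_real (t * e (t ^ d))"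
proof -
  have "\<bar>t\<bar> ^ d < 1" using assms d_positive by (simp add: power_less_one_iff)
  then show ?thesis using E(2) [of "of_real t"] E_of_real [of "t ^ d"] assms by (simp add: power_abs)
qed

lemma \<phi>_of_real:
  assumes R: "of_real R \<in> S" "0 \<le> R"
  obtains t where "0 \<le> t" "t < 1" "\<phi> (of_real R) = of_real t" "R = t * e (t ^ d)"
proof -
  define t where "t = Re (\<phi> (of_real R))"
  have "cnj (\<phi> (of_real R)) = \<phi> (of_real R)" using \<phi>_cnj [OF R(1)] by simp
  then have \<phi>t: "\<phi> (of_real R) = of_real t" by (simp add: t_def complex_eq_iff)
  have t1: "\<bar>t\<bar> < 1" using \<phi>_in [OF R(1)] unfolding \<phi>t by simp
  have "of_real R = complex_of_real (t * e (t ^ d))" using F\<phi> [OF R(1)] F_of_real [OF t1] \<phi>t by simp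
  then have Rt: "R = t * e (t ^ d)" unfolding of_real_eq_iff .
  have "\<bar>t ^ d\<bar> < 1" using t1 d_positive by (simp add: power_abs power_less_one_iff)
  then have "0 \<le> t" using Rt R(2) e_pos by (metis zero_le_mult_iff not_less order_less_imp_le)
  then show ?thesis using that \<phi>t Rt t1 by simp
qed

text \<open>On the radius \<open>F\<close> is real, starts at 0 and is injective; a decrease would
  repeat a value by the intermediate value theorem.\<close>

lemma F_mono:
  assumes "0 \<le> s" "s \<le> t" "t < 1" shows "s * e (s ^ d) \<le> t * e (t ^ d)"
proof (rule ccontr)
  define f where "f x = Re (F (of_real x))" for x
  have f: "f x = x * e (x ^ d)" "F (of_real x) = of_real (f x)" if "0 \<le> x" "x < 1" for x
    using F_of_real [of x] that by (auto simp: f_def)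
  assume "\<not> s * e (s ^ d) \<le> t * e (t ^ d)"
  then have lt: "f t < f s" using f assms by simp
  then have st: "s < t" using assms by (cases "s = t") auto
  have "\<bar>t ^ d\<bar> < 1" using assms d_positive by (simp add: power_abs power_less_one_iff)
  then have "0 \<le> f t" using f(1) [of t] e_pos [of "t ^ d"] assms by simp
  moreover have "continuous_on {0..s} f"
    unfolding f_def
  proof (intro continuous_intros continuous_on_compose2 [OF holomorphic_on_imp_continuous_on [OF holF]])
    show "complex_of_real ` {0..s} \<subseteq> ball 0 1" using assms by auto
  qed
  moreover have "f 0 = 0" by (simp add: f_def F0)
  ultimately have "\<exists>u\<ge>0. u \<le> s \<and> f u = f t" using lt assms by (intro IVT') auto
  then obtain u where u: "0 \<le> u" "u \<le> s" "f u = f t" by auto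
  have ut: "u < 1" "0 \<le> t" using u(2) assms st by linarith+
  then have Fut: "F (of_real u) = F (of_real t)" using f(2) [of u] f(2) [of t] u assms(3) by simp
  have "cmod (of_real u) < 1" "cmod (of_real t) < 1" using u(1) ut assms(3) by simp_all
  from F_inj [OF this Fut] have "u = t" by simp
  then show False using u(2) st by simp
qed

text \<open>\<open>\<phi> z / z\<close> with the singularity at 0 removed. It has no zeros, so the
  quotient of the reflected map by \<phi> is holomorphic at 0 as well.\<close>

definition G where "G z = (if z = 0 then deriv \<phi> 0 else (\<phi> z - \<phi> 0) / (z - 0))"

lemma G: "G holomorphic_on S" "z \<in> S \<Longrightarrow> G z \<noteq> 0" "\<phi> z = z * G z"
proof -
  show "G holomorphic_on S" unfolding G_def by (rule pole_lemma_open [OF hol\<phi> S(1)])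
  show "\<phi> z = z * G z" by (simp add: G_def \<phi>0)
  show "G z \<noteq> 0" if "z \<in> S"
  proof (cases "z = 0")
    case True
    then show ?thesis using \<phi>F_deriv [of 0] F0 by (auto simp: G_def)
  next
    case False
    have "\<phi> z \<noteq> 0" using F\<phi> [OF that] F0 False by auto
    then show ?thesis using False by (simp add: G_def \<phi>0)
  qed
qed

text \<open>Reflection across the ray at angle \<open>\<theta> / 2\<close>: on the sector of opening \<open>pi / d\<close> above that ray the
  quotient of the reflected map by \<open>\<phi>\<close> has modulus 1 on both bounding rays and at most 1 in the
  limit at the boundary of \<open>S\<close>.\<close>

lemma \<phi>_min_on_ray_aux:
  assumes z: "of_real R * cis \<theta> \<in> S" and R: "0 < R" and th: "0 < \<theta>" "\<theta> \<le> pi / d"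
  shows "cmod (\<phi> (of_real R)) \<le> cmod (\<phi> (of_real R * cis \<theta>))"
proof -
  define \<alpha> where "\<alpha> = pi / d"
  have \<alpha>: "0 < \<alpha>" "\<alpha> < pi" using d2 by (auto simp: \<alpha>_def divide_less_eq)
  have root\<alpha>: "unit_root d = cis (2 * \<alpha>)" by (simp add: unit_root_def \<alpha>_def)
  have root\<alpha>': "unit_root d ^ (d - 1) = cis (- 2 * \<alpha>)"
  proof -
    have "unit_root d ^ (d - 1) * unit_root d = 1" using unit_root_power [OF d_positive] d_positive by (metis power_minus_mult)
    moreover have "cis (- 2 * \<alpha>) * unit_root d = 1" by (simp add: root\<alpha> cis_mult)
    ultimately show ?thesis by (metis mult_right_cancel unit_root_nonzero)
  qed
  define \<beta> where "\<beta> = \<theta> / 2"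
  have \<beta>: "0 < \<beta>" "2 * \<beta> = \<theta>" "2 * \<beta> \<le> \<alpha>" using th by (auto simp: \<beta>_def \<alpha>_def)
  define rf where "rf x = cis \<theta> * cnj x" for x
  have rf_polar: "rf (of_real Q * cis \<psi>) = of_real Q * cis (\<theta> - \<psi>)" for Q \<psi>
    by (simp add: rf_def cis_cnj cis_mult mult.left_commute)
  have pm: "of_real Q * cis \<omega> \<in> S" if "of_real Q * cis \<bar>\<omega>\<bar> \<in> S" for Q \<omega>
    using S_cnj [OF that] that by (cases "\<omega> \<ge> 0") (auto simp: cis_cnj)
  define C where "C = {x. 0 \<le> Im (cis (- \<beta>) * x) \<and> Im (cis (- (\<beta> + \<alpha>)) * x) \<le> 0}"
  define C0 where "C0 = {x. 0 < Im (cis (- \<beta>) * x) \<and> Im (cis (- (\<beta> + \<alpha>)) * x) < 0}"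
  have clC: "closed C"
    unfolding C_def by (intro closed_Collect_conj closed_Collect_le continuous_intros)
  have opC0: "open C0"
    unfolding C0_def by (intro open_Collect_conj open_Collect_less continuous_intros)
  have C0C: "C0 \<subseteq> C" by (auto simp: C_def C0_def)
  have polarC: "\<exists>Q \<psi>. 0 \<le> Q \<and> \<beta> \<le> \<psi> \<and> \<psi> \<le> \<beta> + \<alpha> \<and> x = of_real Q * cis \<psi>" if "x \<in> C" for x
  proof -
    have "0 \<le> Im (cis (- \<beta>) * x)" "Im (cis (- (\<beta> + \<alpha>)) * x) \<le> 0" using that unfolding C_def by blast+
    from closed_sector_polar [OF this \<alpha>] show ?thesis by metis
  qed
  \<comment> \<open>Reflection sends a polar angle \<psi> to \<open>\<theta> - \<psi>\<close>. Up to
    \<open>\<alpha>\<close> this angle is at most \<psi> in modulus; beyond \<open>\<alpha>\<close>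
    the point is first reflected at the symmetry axis at angle \<open>\<alpha>\<close>. Either way
    the radial function at the new angle is at least as large.\<close>
  have rfS: "rf x \<in> S" if x: "x \<in> S" "x \<in> C" for x
  proof -
    obtain Q \<psi> where Q: "0 \<le> Q" "\<beta> \<le> \<psi>" "\<psi> \<le> \<beta> + \<alpha>" "x = of_real Q * cis \<psi>"
      using polarC [OF x(2)] by metis
    show ?thesis
    proof (cases "\<psi> \<le> \<alpha>")
      case True
      have "of_real Q * cis \<bar>\<theta> - \<psi>\<bar> \<in> S"
      proof (rule S_radial [OF x(1) [unfolded Q(4)] Q(1) abs_ge_zero])
        show "\<bar>\<theta> - \<psi>\<bar> \<le> \<psi>" using Q(2) \<beta> by linarith
        show "\<psi> \<le> pi / d" using True by (simp only: \<alpha>_def)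
      qed
      then show ?thesis unfolding Q(4) rf_polar by (rule pm)
    next
      case False
      have "cnj (unit_root d ^ (d - 1) * x) \<in> S" using S_cnj S_rot_power x(1) by blast
      moreover have "cnj (unit_root d ^ (d - 1) * x) = of_real Q * cis (2 * \<alpha> - \<psi>)"
        unfolding root\<alpha>' Q(4) by (simp add: cis_cnj cis_mult mult.left_commute)
      ultimately have QS: "of_real Q * cis (2 * \<alpha> - \<psi>) \<in> S" by (simp only:)
      have "of_real Q * cis \<bar>\<theta> - \<psi>\<bar> \<in> S"
      proof (rule S_radial [OF QS Q(1) abs_ge_zero])
        show "\<bar>\<theta> - \<psi>\<bar> \<le> 2 * \<alpha> - \<psi>" using Q(2,3) False \<beta> by linarith
        have "2 * \<alpha> - \<psi> \<le> \<alpha>" using False by linarith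
        then show "2 * \<alpha> - \<psi> \<le> pi / d" by (simp only: \<alpha>_def)
      qed
      then show ?thesis unfolding Q(4) rf_polar by (rule pm)
    qed
  qed
  define q where "q x = cnj (G (rf x)) / G x" for x
  define S2 where "S2 = {x \<in> S. rf x \<in> S}"
  have "S2 = S \<inter> rf -` S" by (auto simp: S2_def)
  moreover have "open (rf -` S)"
    unfolding rf_def by (intro open_vimage S(1) continuous_intros)
  ultimately have opS2: "open S2" using S(1) by (auto intro: open_Int)
  have holq: "q holomorphic_on S2"
  proof -
    have sub: "cnj ` S2 \<subseteq> {y. cis \<theta> * y \<in> S}" by (auto simp: S2_def rf_def)
    have "(\<lambda>y. G (cis \<theta> * y)) holomorphic_on {y. cis \<theta> * y \<in> S}"
      using holomorphic_on_compose_gen [of "\<lambda>y. cis \<theta> * y" "{y. cis \<theta> * y \<in> S}" G S] G(1)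
      by (auto simp: o_def intro!: holomorphic_intros)
    then have "(cnj \<circ> (\<lambda>y. G (cis \<theta> * y)) \<circ> cnj) holomorphic_on S2"
      using sub opS2 by (intro holomorphic_on_compose_cnj_cnj) (auto intro: holomorphic_on_subset)
    then have "(\<lambda>x. cnj (G (rf x))) holomorphic_on S2" by (simp add: o_def rf_def)
    moreover have "G holomorphic_on S2" using G(1) by (rule holomorphic_on_subset) (auto simp: S2_def)
    ultimately show ?thesis unfolding q_def using G(2) by (intro holomorphic_intros) (auto simp: S2_def)
  qed
  have nrf: "cmod (rf x) = cmod x" for x by (simp add: rf_def norm_mult)
  have q_norm: "cmod (q x) * cmod (\<phi> x) = cmod (\<phi> (rf x))" if "x \<in> S" for x
  proof -
    have "cmod (q x) * cmod (x * G x) = cmod (rf x * G (rf x))"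
      using G(2) [OF that] by (simp add: q_def norm_mult norm_divide nrf)
    then show ?thesis unfolding G(3) [of x, symmetric] G(3) [of "rf x", symmetric] .
  qed
  define \<xi> where "\<xi> = of_real R * cis \<theta>"
  have \<xi>S: "\<xi> \<in> S" using z by (simp add: \<xi>_def)
  have \<xi>C: "\<xi> \<in> C0"
  proof -
    have cc: "cis y * \<xi> = of_real R * cis (y + \<theta>)" for y
      by (simp add: \<xi>_def cis_mult mult.left_commute)
    have "- \<beta> + \<theta> = \<beta>" "- (\<beta> + \<alpha>) + \<theta> = - (\<alpha> - \<beta>)" using \<beta>(2) by simp_all
    then have 1: "cis (- \<beta>) * \<xi> = of_real R * cis \<beta>"
      and 2: "cis (- (\<beta> + \<alpha>)) * \<xi> = of_real R * cis (- (\<alpha> - \<beta>))"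
      using cc [of "- \<beta>"] cc [of "- (\<beta> + \<alpha>)"] by metis+
    have "sin \<beta> > 0" "sin (\<alpha> - \<beta>) > 0" using \<beta> \<alpha> by (auto intro!: sin_gt_zero)
    then have "0 < R * sin \<beta>" "R * sin (- (\<alpha> - \<beta>)) < 0" using R by (simp_all only: sin_minus mult_pos_pos) simp
    then show ?thesis unfolding C0_def mem_Collect_eq 1 2 by simp
  qed
  \<comment> \<open>The quotient need not extend to the boundary of \<open>S\<close>, so the maximum
    principle is used on the part of the sector where \<open>\<phi>\<close> has modulus below
    \<open>r\<close>. On the curved piece the numerator is still below 1, which gives
    \<open>1 / r\<close>.\<close>
  have bound: "cmod (q \<xi>) \<le> 1 / r" if r: "cmod (\<phi> \<xi>) < r" "r < 1" for r
  proof -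
    have r0: "r > 0" using r(1) by (smt (verit) norm_ge_zero)
    define T where "T = {x \<in> S. cmod (\<phi> x) < r} \<inter> C0"
    have "{x \<in> S. cmod (\<phi> x) < r} = S \<inter> (\<lambda>x. \<phi> x) -` ball 0 r" by auto
    then have opT1: "open {x \<in> S. cmod (\<phi> x) < r}"
      using continuous_open_preimage [OF holomorphic_on_imp_continuous_on [OF hol\<phi>] S(1) open_ball] by simp
    then have opT: "open T" using opC0 by (auto simp: T_def)
    define K where "K = F ` cball 0 r \<inter> C"
    have "compact (F ` cball 0 r)"
      using r by (intro compact_continuous_image continuous_on_subset [OF holomorphic_on_imp_continuous_on [OF holF]]) auto
    then have "closed K" using clC by (auto simp: K_def compact_imp_closed)
    moreover have "T \<subseteq> K"
    proof
      fix x assume "x \<in> T"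
      then have x: "x \<in> S" "cmod (\<phi> x) < r" "x \<in> C" using C0C by (auto simp: T_def)
      then have "x = F (\<phi> x)" "\<phi> x \<in> cball 0 r" using F\<phi> by auto
      then show "x \<in> K" using x by (auto simp: K_def)
    qed
    ultimately have clT: "closure T \<subseteq> K" by (rule closure_minimal [rotated])
    have KS: "x \<in> S" "cmod (\<phi> x) \<le> r" "x \<in> C" if "x \<in> K" for x
      using that F_in \<phi>F r by (auto simp: K_def)
    have KS2: "K \<subseteq> S2" using KS rfS by (auto simp: S2_def)
    show ?thesis
    proof (rule maximum_modulus_frontier [of q T])
      show "q holomorphic_on interior T"
        using holq clT KS2 by (meson closure_subset holomorphic_on_subset interior_subset order_trans)
      show "continuous_on (closure T) q"
        using holq clT KS2 by (meson continuous_on_subset holomorphic_on_imp_continuous_on order_trans)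
      show "bounded T" using S(3) by (rule bounded_subset) (auto simp: T_def)
      show "\<xi> \<in> T" using \<xi>S \<xi>C r by (simp add: T_def)
    next
      fix x assume x: "x \<in> frontier T"
      then have xK: "x \<in> K" using clT by (auto simp: frontier_def)
      have xT: "x \<notin> T" using x opT by (auto simp: frontier_def interior_open)
      note xS = KS [OF xK]
      have r1: "1 \<le> 1 / r" using r r0 by simp
      show "cmod (q x) \<le> 1 / r"
      proof (cases "cmod (\<phi> x) = r")
        case True
        have "cmod (q x) * r < 1" using q_norm [OF xS(1)] \<phi>_in [OF rfS [OF xS(1,3)]] True by simp
        then show ?thesis using r0 by (simp add: field_simps)
      next
        case False
        then have "x \<notin> C0" using xT xS by (auto simp: T_def)
        then have ln: "Im (cis (- \<beta>) * x) = 0 \<or> Im (cis (- (\<beta> + \<alpha>)) * x) = 0"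
          using xS(3) unfolding C_def C0_def by auto
        obtain Q \<psi> where Q: "0 \<le> Q" "\<beta> \<le> \<psi>" "\<psi> \<le> \<beta> + \<alpha>" "x = of_real Q * cis \<psi>"
          using polarC [OF xS(3)] by metis
        have "cmod (q x) = 1"
        proof (cases "Q = 0")
          case True
          then have "x = 0" using Q by simp
          then show ?thesis using G(2) [OF S(4)] by (simp add: q_def rf_def norm_divide)
        next
          case False
          then have Q0: "Q > 0" using Q by simp
          have cc: "cis y * x = of_real Q * cis (y + \<psi>)" for y
            unfolding Q(4) by (simp add: cis_mult mult.left_commute)
          have "- \<beta> + \<psi> = \<psi> - \<beta>" "- (\<beta> + \<alpha>) + \<psi> = - (\<beta> + \<alpha> - \<psi>)" by simp_all
          then have e1: "cis (- \<beta>) * x = of_real Q * cis (\<psi> - \<beta>)"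
            and e2: "cis (- (\<beta> + \<alpha>)) * x = of_real Q * cis (- (\<beta> + \<alpha> - \<psi>))"
            using cc [of "- \<beta>"] cc [of "- (\<beta> + \<alpha>)"] by metis+
          have "sin (\<psi> - \<beta>) = 0 \<or> sin (\<beta> + \<alpha> - \<psi>) = 0"
          proof -
            have "Q * sin (\<psi> - \<beta>) = 0 \<or> Q * sin (- (\<beta> + \<alpha> - \<psi>)) = 0"
              using ln unfolding e1 e2 by simp
            then show ?thesis using Q0 by (metis mult_eq_0_iff neg_equal_0_iff_equal not_less_iff_gr_or_eq sin_minus)
          qed
          moreover have "\<psi> - \<beta> < pi" "\<beta> + \<alpha> - \<psi> < pi" using Q \<alpha> by auto
          ultimately have "\<psi> = \<beta> \<or> \<psi> = \<beta> + \<alpha>"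
            using Q sin_gt_zero [of "\<psi> - \<beta>"] sin_gt_zero [of "\<beta> + \<alpha> - \<psi>"] by fastforce
          then have "cmod (\<phi> (rf x)) = cmod (\<phi> x)"
          proof
            assume "\<psi> = \<beta>"
            then have "\<theta> - \<psi> = \<psi>" using \<beta>(2) by linarith
            then have "rf x = x" unfolding Q(4) rf_polar by (simp only:)
            then show ?thesis by (simp only:)
          next
            \<comment> \<open>On the upper ray the reflection coincides with the rotation by
              \<open>- 2 * \<alpha>\<close>, a symmetry of \<open>S\<close>.\<close>
            assume "\<psi> = \<beta> + \<alpha>"
            then have "\<theta> - \<psi> = - 2 * \<alpha> + \<psi>" using \<beta>(2) by linarith
            then have "rf x = cis (- 2 * \<alpha>) * x" unfolding cc unfolding Q(4) rf_polar by (simp only:)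
            then have "rf x = unit_root d ^ (d - 1) * x" unfolding root\<alpha>' .
            then show ?thesis using \<phi>_rot_power [OF xS(1)] by (simp add: norm_mult norm_power)
          qed
          moreover have "\<phi> x \<noteq> 0" using F\<phi> [OF xS(1)] F0 Q(4) Q0 by auto
          ultimately show ?thesis using q_norm [OF xS(1)] by simp
        qed
        then show ?thesis using r1 by simp
      qed
    qed
  qed
  have "cmod (q \<xi>) \<le> 1"
  proof (rule ccontr)
    assume gt: "\<not> cmod (q \<xi>) \<le> 1"
    \<comment> \<open>Halfway between 1 and the two values that \<open>r\<close> has to exceed: one
      for \<open>\<xi>\<close> to lie in the region, one for the contradiction.\<close>
    define r where "r = (max (cmod (\<phi> \<xi>)) (1 / cmod (q \<xi>)) + 1) / 2"
    have lt: "max (cmod (\<phi> \<xi>)) (1 / cmod (q \<xi>)) < 1"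
      using \<phi>_in [OF \<xi>S] gt by (auto simp: divide_less_eq)
    then have r: "cmod (\<phi> \<xi>) < r" "1 / cmod (q \<xi>) < r" "r < 1" by (auto simp: r_def)
    have q0: "cmod (q \<xi>) > 0" using gt by linarith
    then have r0: "r > 0" using r(2) by (smt (verit) zero_less_divide_1_iff)
    have "1 < r * cmod (q \<xi>)" using r(2) q0 by (simp add: divide_less_eq)
    moreover have "cmod (q \<xi>) * r \<le> 1" using bound [OF r(1,3)] r0 by (simp add: le_divide_eq)
    ultimately show False by (simp add: mult.commute)
  qed
  then have "cmod (q \<xi>) * cmod (\<phi> \<xi>) \<le> 1 * cmod (\<phi> \<xi>)" by (intro mult_right_mono) auto
  moreover have "rf \<xi> = of_real R" unfolding \<xi>_def rf_polar by simp
  ultimately show ?thesis using q_norm [OF \<xi>S] by (simp add: \<xi>_def)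
qed

text \<open>Symmetries fold \<open>F w\<close> into the half-sector without changing its modulus or
  that of its preimage. On a circle about 0 the modulus of \<phi> is least at the positive point, so
  that point has a preimage \<open>t \<le> cmod w\<close>, and \<open>F\<close> increases along the
  radius.\<close>

lemma F_max_on_real:
  assumes w: "cmod w < 1" shows "cmod (F w) \<le> cmod w * e (cmod w ^ d)"
proof (cases "w = 0")
  case True
  then show ?thesis by (simp add: F0)
next
  case False
  define z where "z = F w"
  have zS: "z \<in> S" using F_in [OF w] by (simp add: z_def)
  define R where "R = cmod z"
  have "z \<noteq> 0" using F_inj [OF w, of 0] F0 False by (auto simp: z_def)
  then have R0: "R > 0" by (simp add: R_def)
  have zR: "z = of_real R * cis (Arg z)" using rcis_cmod_Arg [of z] by (simp add: rcis_def R_def)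
  obtain l p s where "0 \<le> p" "p \<le> pi / d" "s = p \<or> s = - p" "cis (Arg z) = unit_root d ^ l * cis s"
    using cis_fold [OF d_positive] by metis
  then have lp: "0 \<le> p" "p \<le> pi / d" "cis (Arg z) = unit_root d ^ l * cis p \<or> cis (Arg z) = unit_root d ^ l * cis (- p)"
    by auto
  obtain x where x: "x \<in> S" "cmod (\<phi> x) = cmod (\<phi> z)" "x = of_real R * cis p \<or> x = of_real R * cis (- p)"
  proof -
    define x where "x = unit_root d ^ ((d - 1) * l) * z"
    have 1: "unit_root d ^ ((d - 1) * l) * unit_root d ^ l = 1"
    proof -
      have "(d - 1) * l + l = d * l" using d_positive by (simp add: algebra_simps)
      then have "unit_root d ^ ((d - 1) * l + l) = (unit_root d ^ d) ^ l" by (simp only: power_mult)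
      then show ?thesis unfolding unit_root_power [OF d_positive] by (simp only: power_add power_one)
    qed
    have "x = of_real R * ((unit_root d ^ ((d - 1) * l) * unit_root d ^ l) * cis p) \<or> x = of_real R * ((unit_root d ^ ((d - 1) * l) * unit_root d ^ l) * cis (- p))"
      using lp(3) zR unfolding x_def by (metis mult.assoc mult.left_commute)
    then have "x = of_real R * cis p \<or> x = of_real R * cis (- p)" unfolding 1 by simp
    moreover have "x \<in> S" unfolding x_def by (rule S_rot_power [OF zS])
    moreover have "cmod (\<phi> x) = cmod (\<phi> z)" unfolding x_def \<phi>_rot_power [OF zS] by (simp add: norm_mult norm_power)
    ultimately show ?thesis using that by blast
  qed
  have y: "of_real R * cis p \<in> S" "cmod (\<phi> (of_real R * cis p)) = cmod (\<phi> z)"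
  proof -
    have "of_real R * cis p = x \<or> of_real R * cis p = cnj x" using x(3) by (auto simp: cis_cnj)
    then show "of_real R * cis p \<in> S" "cmod (\<phi> (of_real R * cis p)) = cmod (\<phi> z)"
      using x(1,2) S_cnj [OF x(1)] \<phi>_cnj [OF x(1)] by auto
  qed
  have RS: "of_real R \<in> S" using S_radial [OF y(1), of 0] lp R0 by simp
  have "cmod (\<phi> (of_real R)) \<le> cmod (\<phi> z)"
    using \<phi>_min_on_ray_aux [OF y(1) R0] lp y(2) by (cases "p = 0") auto
  moreover have "\<phi> z = w" unfolding z_def by (rule \<phi>F [OF w])
  moreover obtain t where t: "0 \<le> t" "t < 1" "\<phi> (of_real R) = of_real t" "R = t * e (t ^ d)"
    using \<phi>_of_real [OF RS] R0 by auto
  ultimately have "t \<le> cmod w" by simp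
  then show ?thesis using F_mono [OF t(1) _ w] t(4) by (simp add: R_def z_def)
qed

lemma E_max_on_real: assumes "cmod v < 1" shows "cmod (E v) \<le> e (cmod v)"
proof (cases "v = 0")
  case True
  then show ?thesis using E(3) e_0 c by simp
next
  case False
  obtain w where w: "cmod w < 1" "w ^ d = v" using disc_power_root [OF d_positive assms] by blast
  have w0: "cmod w > 0" using w False d_positive by auto
  have "cmod w * cmod (E v) \<le> cmod w * e (cmod v)"
    using F_max_on_real [OF w(1)] E(2) [OF w(1)] w(2) by (auto simp: norm_mult norm_power)
  then show ?thesis using w0 by simp
qed

lemma e_ge: assumes v: "0 \<le> v" "v < 1" and x: "cmod x \<le> v" shows "cmod (E x) \<le> e v"
proof (rule maximum_modulus_frontier [of E "cball 0 v"])
  show "E holomorphic_on interior (cball 0 v)" using E(1) by (rule holomorphic_on_subset) (use v in auto)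
  show "continuous_on (closure (cball 0 v)) E"
    using holomorphic_on_imp_continuous_on [OF E(1)] by (rule continuous_on_subset) (use v in auto)
  show "cmod (E z) \<le> e v" if "z \<in> frontier (cball 0 v)" for z
    using that E_max_on_real [of z] v by simp
qed (use x in auto)

lemma c_le_e: "0 \<le> v \<Longrightarrow> v < 1 \<Longrightarrow> c \<le> e v"
  using e_ge [of v 0] E(3) c by simp

text \<open>If \<open>e v = E 0\<close>, then \<open>E\<close> attains its maximum modulus over a
  disc at the centre and is constant. So \<open>F\<close> is linear and \<open>S\<close> is a
  disc.\<close>

lemma c_less_e:
  assumes v: "0 < v" "v < 1" and S_not: "S \<noteq> ball 0 c" shows "c < e v"
proof (rule ccontr)
  assume "\<not> c < e v"
  then have eq: "e v = c" using c_le_e [of v] v by linarith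
  have "E constant_on ball 0 1"
  proof (rule maximum_modulus_principle [OF E(1) open_ball _ open_ball, of 0 v 0])
    show "cmod (E z) \<le> cmod (E 0)" if "z \<in> ball 0 v" for z
      using e_ge [of v z] that v eq E(3) c by simp
  qed (use v in auto)
  then obtain y where y: "\<And>x. x \<in> ball 0 1 \<Longrightarrow> E x = y" unfolding constant_on_def by blast
  have Ec: "E v = of_real c" if "cmod v < 1" for v
    using y [of 0] y [of v] E(3) that by simp
  have Fc: "F w = of_real c * w" if "cmod w < 1" for w
  proof -
    have "cmod (w ^ d) < 1" using that d_positive by (simp add: norm_power power_less_one_iff)
    then show ?thesis using E(2) [OF that] Ec by simp
  qed
  have "S = ball 0 c"
  proof (intro equalityI subsetI)
    fix z assume "z \<in> S"
    then have "z = of_real c * \<phi> z" "cmod (\<phi> z) < 1" using F\<phi> Fc \<phi>_in by metis+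
    then have "cmod z < c * 1" using c by (metis mult_strict_left_mono norm_mult norm_of_real abs_of_pos)
    then show "z \<in> ball 0 c" by simp
  next
    fix z :: complex assume "z \<in> ball 0 c"
    then have "cmod (z / of_real c) < 1" using c by (simp add: norm_divide)
    then show "z \<in> S" using F_in [of "z / of_real c"] Fc [of "z / of_real c"] c by simp
  qed
  then show False using S_not by simp
qed

end

section \<open>The mean inequality\<close>

text \<open>On the circle \<open>dv\<close> is \<open>2 * pi * \<i> * v\<close> times the
  differential of the parameter, so \<open>L\<close> is the mean value of
  \<open>v * g v\<close>.\<close>

lemma Re_nonneg_of_contour_integral:
  assumes g: "(g has_contour_integral (2 * of_real pi * \<i> * L)) (circlepath 0 r)"
    and pos: "\<And>v. cmod v = r \<Longrightarrow> 0 \<le> Re (v * g v)" and r: "r > 0"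
  shows "0 \<le> Re L"
proof -
  define \<gamma> where "\<gamma> = circlepath 0 r"
  have "((\<lambda>x. g (\<gamma> x) * vector_derivative \<gamma> (at x within {0..1})) has_integral (2 * of_real pi * \<i> * L)) {0..1}"
    using g unfolding has_contour_integral_def \<gamma>_def .
  then have "((\<lambda>x. (2 * of_real pi * \<i>) * (\<gamma> x * g (\<gamma> x))) has_integral (2 * of_real pi * \<i> * L)) {0..1}"
  proof (rule has_integral_eq [rotated])
    fix x :: real assume "x \<in> {0..1}"
    then have "vector_derivative \<gamma> (at x within {0..1}) = 2 * of_real pi * \<i> * \<gamma> x"
      unfolding \<gamma>_def by (subst vector_derivative_circlepath01) (auto simp: circlepath)
    then show "g (\<gamma> x) * vector_derivative \<gamma> (at x within {0..1}) = 2 * of_real pi * \<i> * (\<gamma> x * g (\<gamma> x))"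
      by simp
  qed
  then have "((\<lambda>x. (1 / (2 * of_real pi * \<i>)) * ((2 * of_real pi * \<i>) * (\<gamma> x * g (\<gamma> x)))) has_integral (1 / (2 * of_real pi * \<i>)) * (2 * of_real pi * \<i> * L)) {0..1}"
    by (rule has_integral_mult_right)
  then have "((\<lambda>x. \<gamma> x * g (\<gamma> x)) has_integral L) {0..1}" by simp
  then have "((\<lambda>x. Re (\<gamma> x * g (\<gamma> x))) has_integral Re L) {0..1}"
    using has_integral_linear [OF _ bounded_linear_Re] unfolding o_def by blast
  moreover have "0 \<le> Re (\<gamma> x * g (\<gamma> x))" for x
    using r by (intro pos) (simp add: \<gamma>_def circlepath norm_mult)
  ultimately show ?thesis by (rule has_integral_nonneg)
qed

lemma num_range_scale:
  "num_range d (\<lambda>i. s * a i) = (\<lambda>z. of_real s * z) ` num_range d a"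
proof -
  have "cform d (\<lambda>i. s * a i) x = of_real s * cform d a x" for x
    by (simp add: cform_def csesq_def sum_distrib_left mult.assoc)
  then show ?thesis by (auto simp: num_range_def image_iff)
qed

lemma root_of_unity: assumes "d > 0" "x ^ d = 1" obtains j where "x = unit_root d ^ j"
proof -
  have "x \<in> (\<lambda>k. cis (2 * pi * real k / real d)) ` {..<d}"
    using Complex.bij_betw_roots_unity [OF assms(1)] assms(2) unfolding bij_betw_def by auto
  then obtain k where "x = cis (2 * pi * real k / real d)" by auto
  also have "\<dots> = unit_root d ^ k" by (simp only: unit_root_def Complex.DeMoivre) (simp add: ac_simps)
  finally show ?thesis using that by blast
qed

section \<open>The quotient by the rotations and its residues\<close>

context symmetric_conformal
begin

text \<open>The map that \<open>F\<close> induces between the quotients by the rotations: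
  \<open>F w ^ d\<close> as a function of \<open>w ^ d\<close>.\<close>

definition Psi where "Psi v = v * E v ^ d"

text \<open>The derivative of \<open>F\<close> at \<open>w\<close>, which is also a function of
  \<open>v = w ^ d\<close> only.\<close>

definition F_slope where "F_slope v = E v + of_nat d * v * deriv E v"

lemma E_deriv: "cmod v < 1 \<Longrightarrow> (E has_field_derivative deriv E v) (at v)"
  using E(1) by (intro holomorphic_derivI [of _ "ball 0 1"]) auto

lemma Psi_deriv: assumes "cmod v < 1" shows "(Psi has_field_derivative E v ^ (d - 1) * F_slope v) (at v)"
proof -
  have "E v ^ d = E v ^ (d - 1) * E v" using d_positive by (metis power_minus_mult)
  then show ?thesis unfolding Psi_def F_slope_def
    using E_deriv [OF assms] by (auto intro!: derivative_eq_intros simp: algebra_simps)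
qed

lemma F_deriv_slope: assumes w: "cmod w < 1" shows "deriv F w = F_slope (w ^ d)"
proof -
  have wd: "cmod (w ^ d) < 1" using w d_positive by (simp add: norm_power power_less_one_iff)
  have "((\<lambda>w. w * E (w ^ d)) has_field_derivative F_slope (w ^ d)) (at w)"
  proof -
    have "((\<lambda>w. E (w ^ d)) has_field_derivative deriv E (w ^ d) * (of_nat d * w ^ (d - 1))) (at w)"
      by (rule DERIV_chain2 [where f = E and g = "\<lambda>w. w ^ d", OF E_deriv [OF wd]]) (auto intro!: derivative_eq_intros)
    moreover have "w * w ^ (d - 1) = w ^ d" using d_positive by (metis mult.commute power_minus_mult)
    ultimately show ?thesis unfolding F_slope_def
      by (auto intro!: derivative_eq_intros simp: algebra_simps)
  qed
  then have "(F has_field_derivative F_slope (w ^ d)) (at w)"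
    by (rule has_field_derivative_transform_within_open [of _ _ _ "ball 0 1"]) (use w E(2) in auto)
  then show ?thesis by (rule DERIV_imp_deriv)
qed

lemma F_power: "cmod w < 1 \<Longrightarrow> F w ^ d = Psi (w ^ d)"
  using E(2) [of w] by (simp add: Psi_def power_mult_distrib)

text \<open>Values of \<open>F\<close> with equal \<open>d\<close>-th powers differ by a root of
  unity, and \<phi> carries this root over to the preimages.\<close>

lemma Psi_inj: assumes "cmod u < 1" "cmod v < 1" "Psi u = Psi v" shows "u = v"
proof -
  obtain x where x: "cmod x < 1" "x ^ d = u" using disc_power_root [OF d_positive assms(1)] by blast
  obtain y where y: "cmod y < 1" "y ^ d = v" using disc_power_root [OF d_positive assms(2)] by blast
  have eq: "F x ^ d = F y ^ d" using assms(3) F_power x y by simp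
  show ?thesis
  proof (cases "F y = 0")
    case True
    then have "F x = 0" using eq d_positive by (simp add: zero_power)
    then have "x = y" using F_inj [OF x(1) y(1)] True by simp
    then show ?thesis using x y by simp
  next
    case False
    then have "(F x / F y) ^ d = 1" using eq by (simp add: power_divide)
    then obtain j where "F x / F y = unit_root d ^ j" using root_of_unity [OF d_positive] by blast
    then have "F x = unit_root d ^ j * F y" using False by (simp add: field_simps)
    then have "\<phi> (F x) = unit_root d ^ j * y" using \<phi>_rot_power [OF F_in [OF y(1)]] \<phi>F [OF y(1)] by simp
    then have "x = unit_root d ^ j * y" using \<phi>F [OF x(1)] by simp
    then have "u = (unit_root d ^ j) ^ d * v" using x y by (simp add: power_mult_distrib)
    then show ?thesis using unit_root_power_power [OF d_positive] by simp
  qed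
qed

lemma Psi_holo: "Psi holomorphic_on ball 0 1"
  unfolding Psi_def using E(1) by (intro holomorphic_intros)

lemma F_slope_holo: "F_slope holomorphic_on ball 0 1"
  unfolding F_slope_def using E(1) by (intro holomorphic_intros holomorphic_deriv) auto

text \<open>Both poles of the integrand, at \<open>t\<close> and at 0, are simple.\<close>

lemma Psi_contour_integral:
  assumes R: "0 < R" "R < 1" and t: "cmod t < R" and C: "Psi t = C" and h: "h holomorphic_on ball 0 1"
  shows "((\<lambda>v. E v ^ (d - 1) * F_slope v / (Psi v - C) * h v + B * E v ^ k * F_slope v / (v * E v))
    has_contour_integral (2 * of_real pi * \<i> * (h t + B * of_real c ^ k))) (circlepath 0 R)"
proof -
  \<comment> \<open>Divides out the zero of \<open>Psi v - C\<close> at \<open>t\<close>;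
    injectivity of \<open>Psi\<close> makes the cofactor zero-free on the disc.\<close>
  define U where "U v = (if v = t then deriv Psi t else (Psi v - Psi t) / (v - t))" for v
  have U: "U holomorphic_on ball 0 1" unfolding U_def by (rule pole_lemma_open [OF Psi_holo open_ball])
  have t1: "cmod t < 1" using t R by simp
  have dPsi: "deriv Psi t = E t ^ (d - 1) * F_slope t" using Psi_deriv [OF t1] by (rule DERIV_imp_deriv)
  have "inj_on Psi (ball 0 1)" using Psi_inj by (auto intro!: inj_onI)
  then have dPsi0: "deriv Psi t \<noteq> 0" using t1
    by (intro holomorphic_injective_imp_regular [OF Psi_holo]) auto
  have U0: "U v \<noteq> 0" if "cmod v < 1" for v
    using dPsi0 Psi_inj [OF that t1] by (auto simp: U_def)
  define N1 where "N1 v = E v ^ (d - 1) * F_slope v / U v * h v" for v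
  define N2 where "N2 v = B * E v ^ k * F_slope v / E v" for v
  have sub: "ball 0 R \<subseteq> ball 0 (1::real)" "cball 0 R \<subseteq> ball (0::complex) 1" using R by auto
  have N1: "N1 holomorphic_on ball 0 1"
    unfolding N1_def using E(1) F_slope_holo U h U0 by (intro holomorphic_intros) auto
  have N2: "N2 holomorphic_on ball 0 1"
    unfolding N2_def using E(1) F_slope_holo E_nonzero by (intro holomorphic_intros) auto
  have c1: "((\<lambda>v. N1 v / (v - t)) has_contour_integral (2 * of_real pi * \<i> * N1 t)) (circlepath 0 R)"
    using t R N1 sub
    by (intro Cauchy_integral_circlepath)
       (auto intro: holomorphic_on_subset continuous_on_subset [OF holomorphic_on_imp_continuous_on])
  have c2: "((\<lambda>v. N2 v / (v - 0)) has_contour_integral (2 * of_real pi * \<i> * N2 0)) (circlepath 0 R)"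
    using R N2 sub
    by (intro Cauchy_integral_circlepath)
       (auto intro: holomorphic_on_subset continuous_on_subset [OF holomorphic_on_imp_continuous_on])
  \<comment> \<open>\<open>E v ^ (d - 1) * F_slope v\<close> is the derivative of
    \<open>Psi\<close>. It cancels against the cofactor at \<open>t\<close> and leaves the residue
    \<open>h t\<close>.\<close>
  have "N1 t = deriv Psi t / deriv Psi t * h t" by (simp add: N1_def U_def dPsi)
  then have N1t: "N1 t = h t" using dPsi0 by simp
  have N20: "N2 0 = B * of_real c ^ k" using E(3) c by (simp add: N2_def F_slope_def)
  from has_contour_integral_add [OF c1 c2]
  have "((\<lambda>v. N1 v / (v - t) + N2 v / (v - 0)) has_contour_integral (2 * of_real pi * \<i> * (h t + B * of_real c ^ k))) (circlepath 0 R)"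
    by (simp add: N1t N20 distrib_left)
  then show ?thesis
  proof (rule has_contour_integral_eq)
    fix v assume "v \<in> path_image (circlepath 0 R)"
    then have v: "cmod v = R" using R by simp
    then have vt: "v \<noteq> t" using t by auto
    have "Psi v - C = (v - t) * U v" using vt C by (simp add: U_def)
    then show "N1 v / (v - t) + N2 v / (v - 0) = E v ^ (d - 1) * F_slope v / (Psi v - C) * h v + B * E v ^ k * F_slope v / (v * E v)"
      by (simp add: N1_def N2_def ac_simps)
  qed
qed

end

section \<open>Double layer positivity on level curves\<close>

locale cyclic_conformal =
  cyclic_weights d a + symmetric_conformal d "interior (num_range d a)" F \<phi> c
  for d a F \<phi> c +
  fixes \<rho> :: real
  assumes \<rho>: "\<rho> > 0" "\<rho> ^ d = (\<Prod>i<d. a i)"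
begin

lemma a_pos: "i < d \<Longrightarrow> 0 < a i"
proof -
  assume "i < d"
  have "(\<Prod>i<d. a i) \<noteq> 0" using \<rho> by (metis power_not_zero less_irrefl)
  then have "a i \<noteq> 0" using \<open>i < d\<close> by auto
  then show ?thesis using a_nonneg [of i] by simp
qed

lemma \<rho>_interior: "of_real \<rho> \<in> interior W"
  using geometric_mean_interior [of \<rho>] \<rho> by simp

lemma s\<rho>_interior: "0 \<le> s \<Longrightarrow> s \<le> 1 \<Longrightarrow> of_real (s * \<rho>) \<in> interior W"
  using shrink_interior [of "of_real \<rho>" s] \<rho>_interior interior_subset closure_subset
  by (cases "s = 1") (auto simp: subset_iff)

text \<open>The preimage under \<open>F\<close> of \<open>s * \<rho>\<close>, the geometric mean of
  the dilated weights.\<close>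

definition t where "t s = Re (\<phi> (of_real (s * \<rho>)))"

lemma t:
  assumes s: "0 \<le> s" "s \<le> 1"
  shows "0 \<le> t s" "t s < 1" "\<phi> (of_real (s * \<rho>)) = of_real (t s)" "s * \<rho> = t s * e (t s ^ d)" "0 \<le> t s ^ d" "t s ^ d < 1"
    "F (of_real (t s)) = of_real (s * \<rho>)"
proof -
  have "0 \<le> s * \<rho>" using s \<rho> by simp
  then obtain u where u: "0 \<le> u" "u < 1" "\<phi> (of_real (s * \<rho>)) = of_real u" "s * \<rho> = u * e (u ^ d)"
    using \<phi>_of_real [OF s\<rho>_interior [OF s]] by blast
  have "t s = u" using u(3) by (simp add: t_def)
  then show "0 \<le> t s" "t s < 1" "\<phi> (of_real (s * \<rho>)) = of_real (t s)" "s * \<rho> = t s * e (t s ^ d)"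
    using u by auto
  then show "0 \<le> t s ^ d" "t s ^ d < 1" using d_positive by (auto simp: power_less_one_iff)
  show "F (of_real (t s)) = of_real (s * \<rho>)"
    using F\<phi> [OF s\<rho>_interior [OF s]] \<open>\<phi> (of_real (s * \<rho>)) = of_real (t s)\<close> by simp
qed

text \<open>Dilation makes the range a compact subset of the interior, so a level curve of \<phi> of
  some radius below 1 surrounds it.\<close>

lemma scaled_range_compact:
  assumes s: "0 \<le> s" "s < 1"
  obtains r where "0 < r" "r < 1" "\<And>\<zeta>. \<zeta> \<in> num_range d (\<lambda>i. s * a i) \<Longrightarrow> \<zeta> \<in> interior W \<and> cmod (\<phi> \<zeta>) \<le> r"
proof -
  have K: "num_range d (\<lambda>i. s * a i) \<subseteq> interior W"
    unfolding num_range_scale using shrink_interior [OF _ s] closure_subset by blast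
  have "compact (\<phi> ` num_range d (\<lambda>i. s * a i))"
    using K by (intro compact_continuous_image compact_num_range continuous_on_subset [OF holomorphic_on_imp_continuous_on [OF hol\<phi>]])
  moreover have ne: "num_range d (\<lambda>i. s * a i) \<noteq> {}" unfolding num_range_scale using W_nonempty by simp
  ultimately obtain y where y: "y \<in> \<phi> ` num_range d (\<lambda>i. s * a i)" "\<And>x. x \<in> \<phi> ` num_range d (\<lambda>i. s * a i) \<Longrightarrow> cmod x \<le> cmod y"
    using continuous_attains_sup [of "\<phi> ` num_range d (\<lambda>i. s * a i)" norm] by (auto intro: continuous_intros)
  have "cmod y < 1" using y(1) K \<phi>_in by auto
  then have r: "0 < (cmod y + 1) / 2" "(cmod y + 1) / 2 < 1" "cmod y \<le> (cmod y + 1) / 2"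
    using norm_ge_zero [of y] by (simp_all add: field_simps add_pos_nonneg)
  have "\<zeta> \<in> interior W \<and> cmod (\<phi> \<zeta>) \<le> (cmod y + 1) / 2" if "\<zeta> \<in> num_range d (\<lambda>i. s * a i)" for \<zeta>
    using y(2) [OF imageI [OF that]] K that r(3) by force
  then show ?thesis using that r by blast
qed

text \<open>For \<open>w\<close> on the circle of radius \<open>r\<close>, Study's inequality says
  that the half-plane at \<open>F w\<close> with normal \<open>w * deriv F w\<close> contains the
  dilated range, so \<open>resolvent_positivity\<close> applies with
  \<open>\<nu> = w * F_slope v\<close>. With a suitable phase the positive quantity has the form
  \<open>v * g v\<close> with \<open>g\<close> meromorphic, and its mean over the circle is
  evaluated by residues at \<open>v'\<close> and 0.\<close>

lemma mean_inequality_scaled: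
  assumes s: "0 < s" "s < 1" and i: "i < d" and k: "0 < k" "k < d"
    and r: "r < 1" "t s < r" and r\<phi>: "\<And>\<zeta>. \<zeta> \<in> num_range d (\<lambda>i. s * a i) \<Longrightarrow> \<zeta> \<in> interior W \<and> cmod (\<phi> \<zeta>) \<le> r"
  shows "s ^ k * cyc_prod d a i k / (r ^ k * e (t s ^ d) ^ k) + r ^ k * (e (t s ^ d) ^ k - c ^ k) / (s ^ k * cyc_prod d a i k) \<le> 2"
proof -
  define b where "b i = s * a i" for i
  have cb: "cyc_prod d b x n = s ^ n * cyc_prod d a x n" for x n
    by (simp add: cyc_prod_def b_def prod.distrib)
  define q where "q = cyc_prod d b i k"
  define p where "p = cyc_prod d b ((i + k) mod d) (d - k)"
  have q0: "q > 0"
  proof -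
    have "cyc_prod d a i k > 0" unfolding cyc_prod_def using d_positive a_pos by (intro prod_pos) auto
    then show ?thesis using s by (simp add: q_def cb)
  qed
  define C where "C = (\<Prod>j<d. b j)"
  have Cs: "C = (s * \<rho>) ^ d" using \<rho> by (simp add: C_def b_def prod.distrib power_mult_distrib)
  have C0: "C > 0" using s \<rho> by (simp add: Cs)
  have qp: "q * p = C"
    unfolding q_def p_def C_def using cyc_prod_add [of d b i k "d - k"] k cyc_prod_full [of d b i] by simp
  have s1: "0 \<le> s" "s \<le> 1" using s by auto
  note ts = t [OF s1]
  have r0: "r > 0" using r ts(1) by simp
  define R where "R = r ^ d"
  have R: "0 < R" "R < 1" using r0 r d_positive by (auto simp: R_def power_less_one_iff)
  define v' where "v' = complex_of_real (t s ^ d)"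
  have v': "cmod v' < R"
    unfolding v'_def R_def norm_of_real using ts(1,5) r d_positive by (simp add: power_strict_mono)
  have Ev': "E v' = of_real (e (t s ^ d))" unfolding v'_def using ts by (intro E_of_real) auto
  have Psiv': "Psi v' = of_real C"
    using F_power [of "of_real (t s)"] ts(1,2,7) by (simp add: v'_def Cs)
  \<comment> \<open>This is \<open>2 - x - 1 / x\<close> for
    \<open>x = q / (r ^ k * E v ^ k)\<close>. At \<open>v'\<close>, after \<open>r\<close> and
    \<open>s\<close> have tended to 1, \<open>x\<close> becomes the entry to be bounded.\<close>
  define h where "h v = 2 - of_real q / (of_real (r ^ k) * E v ^ k) - of_real (r ^ k / q) * E v ^ k" for v
  have h: "h holomorphic_on ball 0 1"
    unfolding h_def using E(1) E_nonzero r0 by (intro holomorphic_intros) auto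
  define g where "g v = E v ^ (d - 1) * F_slope v / (Psi v - of_real C) * h v + of_real (r ^ k / q) * E v ^ k * F_slope v / (v * E v)" for v
  have "(g has_contour_integral (2 * of_real pi * \<i> * (h v' + of_real (r ^ k / q) * of_real c ^ k))) (circlepath 0 R)"
    unfolding g_def by (rule Psi_contour_integral [OF R v' Psiv' h])
  moreover have "0 \<le> Re (v * g v)" if v: "cmod v = R" for v
  proof -
    have v1: "cmod v < 1" using v R by simp
    obtain w where w: "cmod w < 1" "w ^ d = v" using disc_power_root [OF d_positive v1] by blast
    have "cmod w ^ d = r ^ d" using w v by (simp add: R_def flip: norm_power)
    then have wr: "cmod w = r" using r0 d_positive by (metis less_eq_real_def norm_ge_zero power_eq_imp_eq_base)
    then have w0: "w \<noteq> 0" using r0 by auto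
    define z where "z = F w"
    have zE: "z = w * E v" using E(2) [OF w(1)] w(2) by (simp add: z_def)
    have E0: "E v \<noteq> 0" by (rule E_nonzero [OF v1])
    have z0: "z \<noteq> 0" using zE E0 w0 by simp
    have zd: "z ^ d = Psi v" using F_power [OF w(1)] w(2) by (simp add: z_def)
    have v0: "v \<noteq> 0" using v R by auto
    have Psi0: "Psi v \<noteq> 0" using E0 v0 by (simp add: Psi_def)
    have zC: "z ^ d \<noteq> of_real C"
    proof
      assume "z ^ d = of_real C"
      then have "v = v'" using Psi_inj [OF v1, of v'] v' R zd Psiv' by simp
      then show False using v v' by simp
    qed
    \<comment> \<open>The power of \<open>w\<close> in \<mu> cancels the one in
      \<open>z ^ k = (w * E v) ^ k\<close>, so only \<open>v\<close> remains. On this circle the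
      conjugate of \<mu> is a power of \<open>r / w\<close>, hence the other off-diagonal term
      becomes a function of \<open>v\<close> in the same way. The sign makes \<open>x\<close> and
      \<open>1 / x\<close> enter negatively.\<close>
    define \<mu> where "\<mu> = - ((w / of_real r) ^ k)"
    have \<mu>1: "cmod \<mu> = 1" using wr r0 by (simp add: \<mu>_def norm_power norm_divide)
    have w_cnj: "cnj w = of_real (r\<^sup>2) / w"
      using complex_norm_square [of w] w0 wr by (simp add: field_simps)
    have cnj\<mu>: "cnj \<mu> = - ((of_real r / w) ^ k)"
      using r0 unfolding \<mu>_def by (simp add: w_cnj power2_eq_square)
    have dF: "deriv F w = F_slope v" using F_deriv_slope [OF w(1)] w(2) by simp
    have T0: "F_slope v \<noteq> 0" using \<phi>F_deriv [OF w(1)] dF by auto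
    have "0 \<le> Re ((w * F_slope v) * (2 * z ^ (d - 1) + \<mu> * (z ^ (d - 1 - k) * of_real q) + cnj \<mu> * (z ^ (k - 1) * of_real p)) / (z ^ d - of_real C))"
      unfolding q_def p_def C_def
    proof (rule resolvent_positivity [OF d2 i k _ \<mu>1])
      show "z ^ d \<noteq> of_real (\<Prod>j<d. b j)" using zC unfolding C_def .
      show "w * F_slope v \<noteq> 0" using w0 T0 by simp
      fix \<zeta> assume "\<zeta> \<in> num_range d b"
      then have \<zeta>: "\<zeta> \<in> interior W" "cmod (\<phi> \<zeta>) \<le> r" using r\<phi> by (auto simp: b_def [abs_def])
      have "0 \<le> Re ((F w - F (\<phi> \<zeta>)) / (w * deriv F w))"
        using \<zeta>(2) wr by (intro Study_inequality [OF w(1) w0]) auto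
      then show "0 \<le> Re ((z - \<zeta>) / (w * F_slope v))" unfolding F\<phi> [OF \<zeta>(1)] dF z_def .
    qed
    also have "(w * F_slope v) * (2 * z ^ (d - 1) + \<mu> * (z ^ (d - 1 - k) * of_real q) + cnj \<mu> * (z ^ (k - 1) * of_real p)) / (z ^ d - of_real C) = v * g v"
    proof -
      have A1: "\<mu> * z ^ (d - 1 - k) = z ^ (d - 1) * (- 1 / (of_real (r ^ k) * E v ^ k))"
      proof -
        have "z ^ (d - 1) = z ^ (d - 1 - k) * z ^ k" using k by (simp flip: power_add)
        moreover have "\<mu> = z ^ k * (- 1 / (of_real (r ^ k) * E v ^ k))"
          unfolding \<mu>_def zE using E0 by (simp add: power_mult_distrib power_divide)
        ultimately show ?thesis by simp
      qed
      have A2: "cnj \<mu> * z ^ (k - 1) = z ^ (d - 1) * (- of_real (r ^ k) * E v ^ k / Psi v)"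
      proof -
        have "z ^ (k - 1) * z ^ d = z ^ (d - 1) * z ^ k" using k d2 by (simp add: add.commute flip: power_add)
        then have 1: "z ^ (k - 1) = z ^ (d - 1) * z ^ k / Psi v" using Psi0 zd by (simp add: field_simps)
        have cz: "cnj \<mu> * z ^ k = - of_real (r ^ k) * E v ^ k"
          unfolding cnj\<mu> zE using w0 by (simp add: power_mult_distrib power_divide)
        have "cnj \<mu> * (z ^ (d - 1) * z ^ k / Psi v) = z ^ (d - 1) * ((cnj \<mu> * z ^ k) / Psi v)" by simp
        then show ?thesis unfolding 1 cz .
      qed
      have A3: "w * z ^ (d - 1) = v * E v ^ (d - 1)"
      proof -
        have "w * w ^ (d - 1) = v" using w(2) d_positive by (metis mult.commute power_minus_mult)
        then show ?thesis unfolding zE power_mult_distrib by (metis mult.assoc)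
      qed
      have PT: "Psi v = v * E v ^ (d - 1) * E v" unfolding Psi_def using d_positive by (metis mult.assoc power_minus_mult)
      have pC: "of_real p = complex_of_real C / of_real q" using qp q0 by (simp add: field_simps flip: of_real_mult)
      define K where "K = v * E v ^ (d - 1) * F_slope v"
      define X where "X = Psi v - of_real C"
      have X0: "X \<noteq> 0" using zC zd by (simp add: X_def)
      have "(w * F_slope v) * (2 * z ^ (d - 1) + \<mu> * (z ^ (d - 1 - k) * of_real q) + cnj \<mu> * (z ^ (k - 1) * of_real p)) / (z ^ d - of_real C)
        = F_slope v * (w * (2 * z ^ (d - 1) + (\<mu> * z ^ (d - 1 - k)) * of_real q + (cnj \<mu> * z ^ (k - 1)) * of_real p)) / X"
        by (simp add: zd X_def ac_simps)
      also have "\<dots> = F_slope v * ((w * z ^ (d - 1)) * (2 - of_real q / (of_real (r ^ k) * E v ^ k) - of_real (r ^ k) * E v ^ k / Psi v * of_real p)) / X"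
        unfolding A1 A2 by (simp add: algebra_simps)
      also have "\<dots> = K * (2 - of_real q / (of_real (r ^ k) * E v ^ k) - of_real (r ^ k) * E v ^ k / Psi v * of_real p) / X"
        unfolding A3 K_def by (simp add: ac_simps)
      also have "\<dots> = K / X * (2 - of_real q / (of_real (r ^ k) * E v ^ k)) - K * (of_real (r ^ k) / of_real q * E v ^ k) * (of_real C / (Psi v * X))"
        unfolding pC by (simp add: right_diff_distrib diff_divide_distrib ac_simps)
      \<comment> \<open>Partial fractions separate the pole at the eigenvalue from the pole at
        0.\<close>
      also have "of_real C / (Psi v * X) = 1 / X - 1 / Psi v"
        using X0 Psi0 by (simp add: X_def field_simps)
      also have "K / X * (2 - of_real q / (of_real (r ^ k) * E v ^ k)) - K * (of_real (r ^ k) / of_real q * E v ^ k) * (1 / X - 1 / Psi v)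
         = K / X * h v + of_real (r ^ k / q) * E v ^ k * (K / Psi v)"
      proof -
        have "K / X * (2 - A) - K * Y * (1 / X - 1 / P) = K / X * (2 - A - Y) + Y * (K / P)" for A Y P :: complex
          by (simp add: right_diff_distrib)
        then show ?thesis unfolding h_def of_real_divide .
      qed
      also have "K / Psi v = F_slope v / E v"
        using E0 v0 unfolding K_def PT by simp
      also have "K / X * h v + of_real (r ^ k / q) * E v ^ k * (F_slope v / E v) = v * g v"
        unfolding g_def K_def X_def using v0 by (simp add: algebra_simps)
      finally show ?thesis .
    qed
    finally show ?thesis .
  qed
  ultimately have "0 \<le> Re (h v' + of_real (r ^ k / q) * of_real c ^ k)"
    using Re_nonneg_of_contour_integral R(1) by blast
  also have "h v' + of_real (r ^ k / q) * of_real c ^ k =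
      of_real (2 - q / (r ^ k * e (t s ^ d) ^ k) - (r ^ k / q) * e (t s ^ d) ^ k + r ^ k / q * c ^ k)"
    unfolding h_def Ev' by simp
  finally show ?thesis unfolding Re_complex_of_real q_def cb by (simp add: algebra_simps diff_divide_distrib)
qed

lemma t_continuous: "continuous_on {0..1} t"
proof -
  have "continuous_on {0..1} (\<lambda>s. \<phi> (complex_of_real (s * \<rho>)))"
    using s\<rho>_interior
    by (intro continuous_on_compose2 [OF holomorphic_on_imp_continuous_on [OF hol\<phi>]] continuous_intros) (auto simp del: of_real_mult)
  then show ?thesis unfolding t_def by (intro continuous_intros)
qed

lemma e_t_continuous: "continuous_on {0..1} (\<lambda>s. e (t s ^ d))"
proof -
  have "continuous_on {0..1} (\<lambda>s. E (complex_of_real (t s ^ d)))"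
    using t_continuous t(5,6)
    by (intro continuous_on_compose2 [OF holomorphic_on_imp_continuous_on [OF E(1)]] continuous_intros)
       (auto simp del: of_real_power)
  then show ?thesis unfolding e_def by (intro continuous_intros)
qed

text \<open>The limit \<open>r\<close> to 1 for fixed \<open>s\<close>. All radii close to 1 are
  admissible, but how close depends on \<open>s\<close>, so this limit comes before the one in
  \<open>s\<close>.\<close>

lemma mean_inequality_aux:
  assumes s: "0 < s" "s < 1" and i: "i < d" and k: "0 < k" "k < d"
  shows "s ^ k * cyc_prod d a i k / e (t s ^ d) ^ k + (e (t s ^ d) ^ k - c ^ k) / (s ^ k * cyc_prod d a i k) \<le> 2"
proof -
  obtain r0 where r0: "0 < r0" "r0 < 1" "\<And>\<zeta>. \<zeta> \<in> num_range d (\<lambda>i. s * a i) \<Longrightarrow> \<zeta> \<in> interior W \<and> cmod (\<phi> \<zeta>) \<le> r0"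
    using scaled_range_compact [of s] s by auto
  define f where "f r = s ^ k * cyc_prod d a i k / (r ^ k * e (t s ^ d) ^ k) + r ^ k * (e (t s ^ d) ^ k - c ^ k) / (s ^ k * cyc_prod d a i k)" for r :: real
  have ts: "0 \<le> t s ^ d" "t s ^ d < 1" "t s < 1" using t [of s] s by auto
  have e0: "e (t s ^ d) > 0" using ts by (intro e_pos) auto
  have "eventually (\<lambda>r. f r \<le> 2) (at_left 1)"
  proof -
    have "max r0 (t s) < 1" using r0 ts by simp
    then have "eventually (\<lambda>r. r \<in> {max r0 (t s)<..<1}) (at_left 1)" by (rule eventually_at_left_real)
    then show ?thesis
    proof (rule eventually_mono)
      fix r assume r: "r \<in> {max r0 (t s)<..<1}"
      show "f r \<le> 2" unfolding f_def using r r0(3)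
        by (intro mean_inequality_scaled [OF s i k]) (auto intro: order_trans less_imp_le)
    qed
  qed
  moreover have "(f \<longlongrightarrow> f 1) (at_left 1)"
  proof -
    have "cyc_prod d a i k > 0" unfolding cyc_prod_def using d_positive a_pos by (intro prod_pos) auto
    then show ?thesis unfolding f_def using e0 s by (intro tendsto_intros) auto
  qed
  ultimately have "f 1 \<le> 2" using tendsto_upperbound trivial_limit_at_left_real by blast
  then show ?thesis by (simp add: f_def)
qed

text \<open>The limit \<open>s\<close> to 1. It costs nothing at the boundary because
  \<open>\<rho>\<close> itself is an interior point, so \<open>t\<close> and
  \<open>e (t s ^ d)\<close> are continuous up to \<open>s = 1\<close>.\<close>

lemma mean_inequality:
  assumes i: "i < d" and k: "0 < k" "k < d"
  shows "cyc_prod d a i k / e (t 1 ^ d) ^ k + (e (t 1 ^ d) ^ k - c ^ k) / cyc_prod d a i k \<le> 2"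
proof -
  define Q where "Q = cyc_prod d a i k"
  have Q: "Q > 0" unfolding Q_def cyc_prod_def using d_positive a_pos by (intro prod_pos) auto
  define f where "f s = s ^ k * Q / e (t s ^ d) ^ k + (e (t s ^ d) ^ k - c ^ k) / (s ^ k * Q)" for s :: real
  have e0: "e (t s ^ d) > 0" if "0 \<le> s" "s \<le> 1" for s
    using t(5,6) [OF that] by (intro e_pos) auto
  have "eventually (\<lambda>s. s \<in> {0<..<1}) (at_left (1::real))" by (rule eventually_at_left_real) simp
  then have ev: "eventually (\<lambda>s. f s \<le> 2) (at_left 1)"
    by (rule eventually_mono) (use mean_inequality_aux i k in \<open>auto simp: f_def Q_def\<close>)
  have "continuous_on {1/2..1} f"
  proof -
    have "continuous_on {1/2..1} (\<lambda>s. e (t s ^ d))" using e_t_continuous by (rule continuous_on_subset) auto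
    moreover have "e (t x ^ d) ^ k \<noteq> 0" if "x \<in> {1/2..1}" for x
      using e0 [of x] that by auto
    ultimately show ?thesis unfolding f_def using Q by (intro continuous_intros) auto
  qed
  then have "(f \<longlongrightarrow> f 1) (at 1 within {1/2..1})" by (auto simp: continuous_on_def)
  then have "(f \<longlongrightarrow> f 1) (at_left 1)"
    by (simp add: at_within_Icc_at_left)
  then have "f 1 \<le> 2" using tendsto_upperbound [OF _ ev trivial_limit_at_left_real] by blast
  then show ?thesis by (simp add: f_def Q_def)
qed

definition \<kappa> where "\<kappa> = t 1 / \<rho>"

lemma \<kappa>: "0 < \<kappa>" "\<kappa> = 1 / e (t 1 ^ d)" "\<kappa> * \<rho> = t 1" "0 < t 1" "t 1 < 1"
proof -
  have e0: "e (t 1 ^ d) > 0" using t(5,6) [of 1] by (intro e_pos) auto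
  have eq: "\<rho> = t 1 * e (t 1 ^ d)" using t(4) [of 1] by simp
  then have "t 1 \<noteq> 0" using \<rho>(1) by auto
  then show "0 < t 1" using t(1) [of 1] by simp
  then show "\<kappa> = 1 / e (t 1 ^ d)" unfolding \<kappa>_def by (subst eq) simp
  then show "0 < \<kappa>" using e0 by simp
  show "\<kappa> * \<rho> = t 1" using \<rho> by (simp add: \<kappa>_def)
  show "t 1 < 1" using t(2) [of 1] by simp
qed

text \<open>The two positive summands of \<open>mean_inequality\<close> add up to at most 2; the
  second is strictly positive because \<open>c < e (t 1 ^ d)\<close>, the range not being a
  disc.\<close>

lemma power_bound:
  assumes i: "i < d" and k: "k < d"
  shows "\<kappa> ^ k * cyc_prod d a i k < 2"
proof (cases "k = 0")
  case False
  define Q where "Q = cyc_prod d a i k"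
  have Q: "Q > 0" unfolding Q_def cyc_prod_def using d_positive a_pos by (intro prod_pos) auto
  have "c < e (t 1 ^ d)"
  proof (rule c_less_e)
    show "0 < t 1 ^ d" "t 1 ^ d < 1" using \<kappa>(4,5) d_positive by (auto simp: power_less_one_iff)
    show "interior W \<noteq> ball 0 c" by (rule num_range_not_disc [OF a_pos])
  qed
  then have "c ^ k < e (t 1 ^ d) ^ k" using c False by (intro power_strict_mono) auto
  then have "0 < (e (t 1 ^ d) ^ k - c ^ k) / Q" using Q by simp
  moreover have "\<kappa> ^ k * Q = Q / e (t 1 ^ d) ^ k" by (simp add: \<kappa>(2) power_divide)
  ultimately show ?thesis using mean_inequality [OF i, of k] False k unfolding Q_def by simp
qed simp

end

section \<open>Von Neumann inequality for cyclic shifts\<close>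

definition l2n :: "nat \<Rightarrow> (nat \<Rightarrow> complex) \<Rightarrow> real" where
  "l2n m \<xi> = L2_set (\<lambda>a. cmod (\<xi> a)) {..<m}"

text \<open>The bound \<open>K\<close> for the operator norm, in weak form and for arrays indexed by
  naturals. It combines with entrywise perturbations and finite Fourier sums without matrix
  carriers.\<close>

definition opbound :: "nat \<Rightarrow> (nat \<Rightarrow> nat \<Rightarrow> complex) \<Rightarrow> real \<Rightarrow> bool" where
  "opbound m X K \<longleftrightarrow>
     (\<forall>\<xi> \<eta>. cmod (\<Sum>a<m. \<Sum>c<m. X a c * \<eta> c * cnj (\<xi> a)) \<le> K * l2n m \<xi> * l2n m \<eta>)"

definition l2nn :: "nat \<Rightarrow> nat \<Rightarrow> (nat \<Rightarrow> nat \<Rightarrow> complex) \<Rightarrow> real" where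
  "l2nn m d y = sqrt (\<Sum>a<m. \<Sum>i<d. (cmod (y a i))\<^sup>2)"

text \<open>The sesquilinear form of \<open>\<Sum>n\<le>N. R n \<otimes> T ^ n\<close> for the cyclic shift \<open>T\<close> with weights \<open>b\<close>.\<close>

definition shift_form :: "nat \<Rightarrow> nat \<Rightarrow> nat \<Rightarrow> (nat \<Rightarrow> nat \<Rightarrow> nat \<Rightarrow> complex) \<Rightarrow> (nat \<Rightarrow> complex)
    \<Rightarrow> (nat \<Rightarrow> nat \<Rightarrow> complex) \<Rightarrow> (nat \<Rightarrow> nat \<Rightarrow> complex) \<Rightarrow> complex" where
  "shift_form d m N R b y z = (\<Sum>n\<le>N. \<Sum>a<m. \<Sum>c<m. \<Sum>i<d.
     R n a c * cyc_prod d b i n * y c ((i + n) mod d) * cnj (z a i))"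

lemma norm_eq_1_of_power:
  fixes w :: complex assumes "d > 0" "cmod (w ^ d) = 1" shows "cmod w = 1"
proof -
  have "cmod w ^ d = 1 ^ d" using assms by (simp add: norm_power)
  then show ?thesis using assms(1) power_eq_imp_eq_base [of "cmod w" d 1] by simp
qed

lemma l2n_nonneg [simp]: "0 \<le> l2n m \<xi>" by (simp add: l2n_def)
lemma l2nn_nonneg [simp]: "0 \<le> l2nn m d y" by (simp add: l2nn_def sum_nonneg)

text \<open>The Fourier transform on the integers modulo \<open>d\<close> diagonalises the
  unweighted cyclic shift; its \<open>n\<close>-th power becomes multiplication by
  \<open>(unit_root d ^ j) ^ n\<close>.\<close>

lemma dft_form:
  fixes Y Z :: "nat \<Rightarrow> complex"
  assumes d: "d > 0"
  shows "(\<Sum>i<d. Y ((i + n) mod d) * cnj (Z i)) = (1 / of_nat d) * (\<Sum>j<d. (unit_root d ^ j) ^ n *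
      (\<Sum>l<d. cnj ((unit_root d ^ j) ^ l) * Y l) * cnj (\<Sum>l<d. cnj ((unit_root d ^ j) ^ l) * Z l))"
proof -
  have "(\<Sum>j<d. (unit_root d ^ j) ^ n *
      (\<Sum>l<d. cnj ((unit_root d ^ j) ^ l) * Y l) * cnj (\<Sum>l<d. cnj ((unit_root d ^ j) ^ l) * Z l))
      = (\<Sum>j<d. \<Sum>i<d. \<Sum>l<d. (unit_root d ^ j) ^ (i + n) * cnj ((unit_root d ^ j) ^ l) * (Y l * cnj (Z i)))"
  proof (rule sum.cong [OF refl])
    fix j
    have "(unit_root d ^ j) ^ n * (\<Sum>l<d. cnj ((unit_root d ^ j) ^ l) * Y l) * cnj (\<Sum>l<d. cnj ((unit_root d ^ j) ^ l) * Z l)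
      = (unit_root d ^ j) ^ n * ((\<Sum>l<d. (unit_root d ^ j) ^ l * cnj (Z l)) * (\<Sum>l<d. cnj ((unit_root d ^ j) ^ l) * Y l))"
      by (simp add: ac_simps)
    also have "\<dots> = (\<Sum>i<d. \<Sum>l<d. (unit_root d ^ j) ^ (i + n) * cnj ((unit_root d ^ j) ^ l) * (Y l * cnj (Z i)))"
      unfolding sum_product unfolding sum_distrib_left by (intro sum.cong refl) (simp add: power_add ac_simps)
    finally show "(unit_root d ^ j) ^ n * (\<Sum>l<d. cnj ((unit_root d ^ j) ^ l) * Y l) * cnj (\<Sum>l<d. cnj ((unit_root d ^ j) ^ l) * Z l) = \<dots>" .
  qed
  also have "\<dots> = (\<Sum>i<d. \<Sum>l<d. (\<Sum>j<d. (unit_root d ^ j) ^ ((i + n) mod d) * cnj ((unit_root d ^ j) ^ l)) * (Y l * cnj (Z i)))"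
    unfolding sum_distrib_right unit_root_power_mod [OF d]
    by (subst sum.swap, rule sum.cong [OF refl], subst sum.swap, simp)
  also have "\<dots> = (\<Sum>i<d. \<Sum>l<d. (if l = (i + n) mod d then of_nat d * (Y l * cnj (Z i)) else 0))"
    using d by (intro sum.cong refl) (subst unit_root_orthogonal, auto)
  also have "\<dots> = (\<Sum>i<d. of_nat d * (Y ((i + n) mod d) * cnj (Z i)))"
    using d by (intro sum.cong refl) simp
  finally show ?thesis
    using d by (simp add: sum_distrib_left [symmetric])
qed

lemma dft_parseval:
  assumes d: "d > 0"
  shows "(\<Sum>j<d. (cmod (\<Sum>l<d. cnj ((unit_root d ^ j) ^ l) * Y l))\<^sup>2) = d * (\<Sum>i<d. (cmod (Y i))\<^sup>2)"
proof -
  have "complex_of_real (\<Sum>i<d. (cmod (Y i))\<^sup>2) = (\<Sum>i<d. Y ((i + 0) mod d) * cnj (Y i))"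
    by (simp add: complex_norm_square del: of_real_power)
  also have "\<dots> = (1 / of_nat d) * complex_of_real (\<Sum>j<d. (cmod (\<Sum>l<d. cnj ((unit_root d ^ j) ^ l) * Y l))\<^sup>2)"
    unfolding dft_form [OF d] by (simp add: complex_norm_square del: of_real_power cnj_sum)
  finally have "complex_of_real (d * (\<Sum>i<d. (cmod (Y i))\<^sup>2)) =
      complex_of_real (\<Sum>j<d. (cmod (\<Sum>l<d. cnj ((unit_root d ^ j) ^ l) * Y l))\<^sup>2)"
    using d by simp
  then show ?thesis unfolding of_real_eq_iff by simp
qed

text \<open>Diagonal conjugation for the form: \<open>y\<close> takes the diagonal matrix and
  \<open>z\<close> the inverse of its adjoint. The two differ when \<open>g\<close> is not
  unimodular.\<close>

lemma shift_form_gauge: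
  assumes "d > 0" "\<And>i. i < d \<Longrightarrow> b i = \<kappa> * b' i * g ((i + 1) mod d) / g i" "\<And>i. i < d \<Longrightarrow> g i \<noteq> 0"
  shows "shift_form d m N R b y z =
    shift_form d m N (\<lambda>n a c. R n a c * \<kappa> ^ n) b' (\<lambda>c i. g i * y c i) (\<lambda>a i. z a i / cnj (g i))"
  unfolding shift_form_def
  by (intro sum.cong refl) (simp add: cyc_prod_gauge [of d b \<kappa> b' g, OF assms])

lemma sum_rotate: "(\<Sum>n\<in>A. \<Sum>a\<in>B. \<Sum>c\<in>C. \<Sum>j\<in>D. g n a c j) = (\<Sum>j\<in>D. \<Sum>a\<in>B. \<Sum>c\<in>C. \<Sum>n\<in>A. g n a c j)"
proof -
  have "(\<Sum>n\<in>A. \<Sum>a\<in>B. \<Sum>c\<in>C. \<Sum>j\<in>D. g n a c j) = (\<Sum>n\<in>A. \<Sum>a\<in>B. \<Sum>j\<in>D. \<Sum>c\<in>C. g n a c j)"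
    by (rule sum.cong [OF refl], rule sum.cong [OF refl], rule sum.swap)
  also have "\<dots> = (\<Sum>n\<in>A. \<Sum>j\<in>D. \<Sum>a\<in>B. \<Sum>c\<in>C. g n a c j)"
    by (rule sum.cong [OF refl], rule sum.swap)
  also have "\<dots> = (\<Sum>j\<in>D. \<Sum>n\<in>A. \<Sum>a\<in>B. \<Sum>c\<in>C. g n a c j)"
    by (rule sum.swap)
  also have "\<dots> = (\<Sum>j\<in>D. \<Sum>a\<in>B. \<Sum>n\<in>A. \<Sum>c\<in>C. g n a c j)"
    by (rule sum.cong [OF refl], rule sum.swap)
  also have "\<dots> = (\<Sum>j\<in>D. \<Sum>a\<in>B. \<Sum>c\<in>C. \<Sum>n\<in>A. g n a c j)"
    by (rule sum.cong [OF refl], rule sum.cong [OF refl], rule sum.swap)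
  finally show ?thesis .
qed

text \<open>With unimodular weights the shift is unitarily equivalent to \<tau> times the plain
  cyclic shift. The Fourier transform splits the form into blocks, one for each eigenvalue
  \<open>\<tau> * unit_root d ^ j\<close>; Cauchy-Schwarz over \<open>j\<close> and Parseval put the
  blocks together.\<close>

lemma shift_form_unimodular:
  assumes d: "d > 0" and b: "\<And>i. i < d \<Longrightarrow> cmod (b i) = 1" and \<tau>: "\<tau> ^ d = (\<Prod>l<d. b l)"
    and K: "K \<ge> 0" "\<And>j. j < d \<Longrightarrow> opbound m (\<lambda>a c. \<Sum>n\<le>N. R n a c * (\<tau> * unit_root d ^ j) ^ n) K"
  shows "cmod (shift_form d m N R b y z) \<le> K * l2nn m d y * l2nn m d z"
proof -
  have "cmod (\<Prod>l<d. b l) = 1"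
    unfolding prod_norm [symmetric] by (rule prod.neutral) (use b in auto)
  then have "cmod (\<tau> ^ d) = 1" unfolding \<tau> .
  then have \<tau>1: "cmod \<tau> = 1" by (rule norm_eq_1_of_power [OF d])
  then have \<tau>0: "\<tau> \<noteq> 0" by auto
  \<comment> \<open>Partial products with the factor \<tau> removed at each step;
    \<open>\<tau> ^ d\<close> being the full product makes \<open>u\<close> close up around the
    cycle.\<close>
  define u where "u i = (\<Prod>l<i. b l) / \<tau> ^ i" for i
  have u1: "cmod (u i) = 1" if "i < d" for i
  proof -
    have "cmod (\<Prod>l<i. b l) = 1"
      unfolding prod_norm [symmetric] by (rule prod.neutral) (use b that in auto)
    then show ?thesis using \<tau>1 by (simp add: u_def norm_divide norm_power)
  qed
  have u0: "u i \<noteq> 0" if "i < d" for i using u1 [OF that] by auto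
  have ub: "b i = \<tau> * 1 * u ((i + 1) mod d) / u i" if "i < d" for i
  proof (cases "i + 1 < d")
    case True
    then show ?thesis using u0 [OF that] \<tau>0 by (simp add: u_def)
  next
    case False
    then have i: "d = Suc i" using that by simp
    have "u d = 1" using \<tau>0 by (simp add: u_def \<tau> [symmetric])
    then have "u (Suc i) = 1" using i by simp
    moreover have "u 0 = 1" by (simp add: u_def)
    moreover have "b i = \<tau> * u (Suc i) / u i" using u0 [OF that] \<tau>0 by (simp add: u_def)
    ultimately show ?thesis using i by simp
  qed
  define Y where "Y c i = u i * y c i" for c i
  define Z where "Z a i = z a i / cnj (u i)" for a i
  define fY where "fY j c = (\<Sum>l<d. cnj ((unit_root d ^ j) ^ l) * Y c l)" for j c
  define fZ where "fZ j c = (\<Sum>l<d. cnj ((unit_root d ^ j) ^ l) * Z c l)" for j c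
  have dft: "(\<Sum>i<d. Y c ((i + n) mod d) * cnj (Z a i)) =
      (1 / of_nat d) * (\<Sum>j<d. (unit_root d ^ j) ^ n * fY j c * cnj (fZ j a))" for a c n
    unfolding fY_def fZ_def by (rule dft_form [OF d])
  have one: "cyc_prod d (\<lambda>_. 1::complex) i n = 1" for i n by (simp add: cyc_prod_def)
  have "shift_form d m N R b y z = shift_form d m N (\<lambda>n a c. R n a c * \<tau> ^ n) (\<lambda>_. 1) Y Z"
    unfolding Y_def Z_def using d ub u0 by (rule shift_form_gauge)
  also have "\<dots> = (\<Sum>n\<le>N. \<Sum>a<m. \<Sum>c<m. R n a c * \<tau> ^ n * (\<Sum>i<d. Y c ((i + n) mod d) * cnj (Z a i)))"
    unfolding shift_form_def one by (simp add: sum_distrib_left ac_simps)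
  also have "\<dots> = (\<Sum>n\<le>N. \<Sum>a<m. \<Sum>c<m. \<Sum>j<d. (1 / of_nat d) * (R n a c * (\<tau> * unit_root d ^ j) ^ n * fY j c * cnj (fZ j a)))"
    unfolding dft sum_distrib_left
    by (intro sum.cong refl) (simp add: power_mult_distrib ac_simps)
  also have "\<dots> = (\<Sum>j<d. \<Sum>a<m. \<Sum>c<m. \<Sum>n\<le>N. (1 / of_nat d) * (R n a c * (\<tau> * unit_root d ^ j) ^ n * fY j c * cnj (fZ j a)))"
    by (rule sum_rotate)
  also have "\<dots> = (\<Sum>j<d. (1 / of_nat d) * (\<Sum>a<m. \<Sum>c<m. (\<Sum>n\<le>N. R n a c * (\<tau> * unit_root d ^ j) ^ n) * fY j c * cnj (fZ j a)))"
    by (simp add: sum_distrib_left sum_distrib_right)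
  finally have eq: "shift_form d m N R b y z = \<dots>" .
  have "cmod (shift_form d m N R b y z) \<le> (\<Sum>j<d. (1 / d) * (K * l2n m (fZ j) * l2n m (fY j)))"
    unfolding eq
  proof (rule sum_norm_le)
    fix j assume "j \<in> {..<d}"
    then show "cmod ((1 / of_nat d) * (\<Sum>a<m. \<Sum>c<m. (\<Sum>n\<le>N. R n a c * (\<tau> * unit_root d ^ j) ^ n) * fY j c * cnj (fZ j a)))
       \<le> (1 / d) * (K * l2n m (fZ j) * l2n m (fY j))"
      using K(2) [of j] d unfolding opbound_def norm_mult
      by (intro mult_mono) (auto simp: norm_divide)
  qed
  also have "\<dots> = (K / d) * (\<Sum>j<d. \<bar>l2n m (fY j)\<bar> * \<bar>l2n m (fZ j)\<bar>)"
    by (simp add: sum_distrib_left ac_simps)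
  also have "\<dots> \<le> (K / d) * (L2_set (\<lambda>j. l2n m (fY j)) {..<d} * L2_set (\<lambda>j. l2n m (fZ j)) {..<d})"
    using K(1) by (intro mult_left_mono L2_set_mult_ineq) auto
  also have "L2_set (\<lambda>j. l2n m (fY j)) {..<d} = sqrt d * l2nn m d y"
  proof -
    have "(\<Sum>j<d. (l2n m (fY j))\<^sup>2) = (\<Sum>a<m. \<Sum>j<d. (cmod (fY j a))\<^sup>2)"
      by (subst sum.swap) (simp add: l2n_def L2_set_def sum_nonneg)
    also have "\<dots> = (\<Sum>a<m. d * (\<Sum>i<d. (cmod (Y a i))\<^sup>2))"
      unfolding fY_def dft_parseval [OF d] by simp
    also have "\<dots> = d * (\<Sum>a<m. \<Sum>i<d. (cmod (y a i))\<^sup>2)"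
      unfolding sum_distrib_left [symmetric] Y_def norm_mult using u1 by simp
    finally show ?thesis by (simp add: L2_set_def l2nn_def real_sqrt_mult)
  qed
  also have "L2_set (\<lambda>j. l2n m (fZ j)) {..<d} = sqrt d * l2nn m d z"
  proof -
    have "(\<Sum>j<d. (l2n m (fZ j))\<^sup>2) = (\<Sum>a<m. \<Sum>j<d. (cmod (fZ j a))\<^sup>2)"
      by (subst sum.swap) (simp add: l2n_def L2_set_def sum_nonneg)
    also have "\<dots> = (\<Sum>a<m. d * (\<Sum>i<d. (cmod (Z a i))\<^sup>2))"
      unfolding fZ_def dft_parseval [OF d] by simp
    also have "\<dots> = d * (\<Sum>a<m. \<Sum>i<d. (cmod (z a i))\<^sup>2)"
      unfolding sum_distrib_left [symmetric] Z_def norm_divide using u1 by simp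
    finally show ?thesis by (simp add: L2_set_def l2nn_def real_sqrt_mult)
  qed
  also have "(K / d) * (sqrt d * l2nn m d y * (sqrt d * l2nn m d z)) = (K / d) * (sqrt d * sqrt d) * (l2nn m d y * l2nn m d z)"
    by (simp only: ac_simps)
  also have "\<dots> = K * l2nn m d y * l2nn m d z" using d by simp
  finally show ?thesis .
qed

text \<open>The form is a polynomial in each single weight. The maximum principle moves the weights
  to the unit circle one after another, and there the shift is unitary; no dilation of the
  contraction is constructed.\<close>

lemma shift_form_von_Neumann:
  assumes d: "d > 0" and b: "\<And>i. i < d \<Longrightarrow> cmod (b i) \<le> 1"
    and K: "K \<ge> 0" "\<And>w. cmod w = 1 \<Longrightarrow> opbound m (\<lambda>a c. \<Sum>n\<le>N. R n a c * w ^ n) K"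
  shows "cmod (shift_form d m N R b y z) \<le> K * l2nn m d y * l2nn m d z"
proof -
  \<comment> \<open>Only weights at positions below \<open>k\<close> may lie inside the disc. The
    statement ranges over all \<open>b\<close>, as the induction step replaces one entry.\<close>
  have "\<forall>b. (\<forall>i<d. cmod (b i) \<le> 1) \<and> (\<forall>i<d. i \<ge> k \<longrightarrow> cmod (b i) = 1) \<longrightarrow>
    cmod (shift_form d m N R b y z) \<le> K * l2nn m d y * l2nn m d z" for k
  proof (induction k)
    case 0
    show ?case
    proof (intro allI impI)
      fix b :: "nat \<Rightarrow> complex" assume "(\<forall>i<d. cmod (b i) \<le> 1) \<and> (\<forall>i<d. i \<ge> 0 \<longrightarrow> cmod (b i) = 1)"
      then have b: "\<And>i. i < d \<Longrightarrow> cmod (b i) = 1" by auto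
      obtain \<tau> where \<tau>: "\<tau> ^ d = (\<Prod>l<d. b l)"
      proof
        show "(cis (Arg (\<Prod>l<d. b l) / d)) ^ d = (\<Prod>l<d. b l)"
        proof -
          have "cmod (\<Prod>l<d. b l) = 1"
            unfolding prod_norm [symmetric] by (rule prod.neutral) (use b in auto)
          then have "cis (Arg (\<Prod>l<d. b l)) = (\<Prod>l<d. b l)"
            using cis_Arg [of "\<Prod>l<d. b l"] by (metis div_by_1 norm_zero of_real_1 sgn_eq zero_neq_one)
          then show ?thesis using d by (simp only: Complex.DeMoivre) simp
        qed
      qed
      have "cmod (\<Prod>l<d. b l) = 1"
        unfolding prod_norm [symmetric] by (rule prod.neutral) (use b in auto)
      then have "cmod (\<tau> ^ d) = 1" unfolding \<tau> .
      then have "cmod \<tau> = 1" by (rule norm_eq_1_of_power [OF d])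
      then show "cmod (shift_form d m N R b y z) \<le> K * l2nn m d y * l2nn m d z"
        using d b \<tau> K by (intro shift_form_unimodular) (auto simp: norm_mult norm_power)
    qed
  next
    case (Suc k)
    show ?case
    proof (intro allI impI)
      fix b :: "nat \<Rightarrow> complex"
      assume b: "(\<forall>i<d. cmod (b i) \<le> 1) \<and> (\<forall>i<d. i \<ge> Suc k \<longrightarrow> cmod (b i) = 1)"
      show "cmod (shift_form d m N R b y z) \<le> K * l2nn m d y * l2nn m d z"
      proof (cases "k < d")
        case False
        then show ?thesis using Suc.IH b by auto
      next
        case True
        define f where "f w = shift_form d m N R (b(k := w)) y z" for w
        have up: "(\<lambda>w. (b(k := w)) x) holomorphic_on UNIV" for x
          by (cases "x = k") (auto intro: holomorphic_intros)
        have hol: "f holomorphic_on UNIV"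
          unfolding f_def shift_form_def cyc_prod_def by (intro holomorphic_intros up)
        have "cmod (f (b k)) \<le> K * l2nn m d y * l2nn m d z"
        proof (rule maximum_modulus_frontier [of f "cball 0 1"])
          show "f holomorphic_on interior (cball 0 1)" using hol by (rule holomorphic_on_subset) auto
          show "continuous_on (closure (cball 0 1)) f"
            using hol by (meson continuous_on_subset holomorphic_on_imp_continuous_on subset_UNIV)
          show "b k \<in> cball 0 1" using b True by auto
          fix w :: complex assume "w \<in> frontier (cball 0 1)"
          then have "cmod w = 1" by simp
          then have "(\<forall>i<d. cmod ((b(k := w)) i) \<le> 1) \<and> (\<forall>i<d. i \<ge> k \<longrightarrow> cmod ((b(k := w)) i) = 1)"
            using b by auto
          then show "cmod (f w) \<le> K * l2nn m d y * l2nn m d z" using Suc.IH unfolding f_def by blast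
        qed auto
        then show ?thesis by (simp add: f_def)
      qed
    qed
  qed
  from this [of d] show ?thesis using b by auto
qed

section \<open>Polynomial approximation\<close>

text \<open>Cauchy's estimates and a geometric series. The bound involves only \<open>B\<close>,
  \<theta> and \<open>N\<close>, so it is uniform in the centre \<open>\<xi>\<close> and in
  \<open>x\<close>.\<close>

lemma Taylor_remainder_le:
  assumes f: "f holomorphic_on ball \<xi> \<delta>" "continuous_on (cball \<xi> \<delta>) f" and \<delta>: "0 < \<delta>"
    and B: "\<And>x. cmod (\<xi> - x) = \<delta> \<Longrightarrow> cmod (f x) \<le> B" and \<theta>: "0 \<le> \<theta>" "\<theta> < 1" and x: "cmod x \<le> \<theta> * \<delta>"
  shows "cmod (f (\<xi> + x) - (\<Sum>n<N. (deriv ^^ n) f \<xi> / fact n * x ^ n)) \<le> B * \<theta> ^ N / (1 - \<theta>)"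
proof -
  have "\<theta> * \<delta> < \<delta>" using \<theta> \<delta> by simp
  then have xb: "\<xi> + x \<in> ball \<xi> \<delta>" using x by (simp add: dist_norm)
  have "(\<lambda>n. (deriv ^^ n) f \<xi> / fact n * x ^ n) sums f (\<xi> + x)"
    using holomorphic_power_series [OF f(1) xb] by simp
  then have s: "(\<lambda>n. (deriv ^^ (n + N)) f \<xi> / fact (n + N) * x ^ (n + N)) sums
     (f (\<xi> + x) - (\<Sum>n<N. (deriv ^^ n) f \<xi> / fact n * x ^ n))"
    by (rule sums_split_initial_segment)
  have g: "(\<lambda>n. B * \<theta> ^ N * \<theta> ^ n) sums (B * \<theta> ^ N * (1 / (1 - \<theta>)))"
    using \<theta> by (intro sums_mult geometric_sums) auto
  have t: "cmod ((deriv ^^ n) f \<xi> / fact n * x ^ n) \<le> B * \<theta> ^ n" for n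
  proof -
    have "cmod ((deriv ^^ n) f \<xi>) \<le> fact n * B / \<delta> ^ n"
      by (rule Cauchy_inequality [OF f \<delta> B])
    then have 1: "cmod ((deriv ^^ n) f \<xi>) / fact n \<le> B / \<delta> ^ n"
      by (simp add: field_simps)
    have B0: "B \<ge> 0" using B [of "\<xi> + of_real \<delta>"] \<delta> by (smt (verit) add_diff_cancel_left' norm_ge_zero norm_minus_commute norm_of_real)
    have "cmod x ^ n \<le> (\<theta> * \<delta>) ^ n" using x by (intro power_mono) auto
    then have "cmod ((deriv ^^ n) f \<xi>) / fact n * cmod x ^ n \<le> B / \<delta> ^ n * (\<theta> * \<delta>) ^ n"
      using 1 B0 \<delta> by (intro mult_mono) auto
    also have "\<dots> = B * \<theta> ^ n" using \<delta> by (simp add: power_mult_distrib)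
    finally show ?thesis by (simp add: norm_mult norm_divide norm_power)
  qed
  have "cmod ((deriv ^^ (n + N)) f \<xi> / fact (n + N) * x ^ (n + N)) \<le> B * \<theta> ^ N * \<theta> ^ n" for n
  proof -
    have "B * \<theta> ^ (n + N) = B * \<theta> ^ N * \<theta> ^ n" by (simp add: power_add)
    then show ?thesis using t [of "n + N"] by (simp only:)
  qed
  from norm_sums_le [OF s g this] show ?thesis by simp
qed

definition poly_approximable :: "complex set \<Rightarrow> (complex \<Rightarrow> complex) \<Rightarrow> bool" where
  "poly_approximable W f \<longleftrightarrow> (\<forall>\<epsilon>>0. \<exists>p. \<forall>z\<in>W. cmod (f z - poly p z) < \<epsilon>)"

lemma poly_approximable_const: "poly_approximable W (\<lambda>_. c)"
  unfolding poly_approximable_def by (intro allI impI exI [of _ "[:c:]"]) simp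

lemma poly_approximable_add:
  assumes "poly_approximable W f" "poly_approximable W g" shows "poly_approximable W (\<lambda>z. f z + g z)"
  unfolding poly_approximable_def
proof (intro allI impI)
  fix \<epsilon> :: real assume "\<epsilon> > 0"
  then obtain p q where p: "\<forall>z\<in>W. cmod (f z - poly p z) < \<epsilon> / 2" and q: "\<forall>z\<in>W. cmod (g z - poly q z) < \<epsilon> / 2"
    using assms unfolding poly_approximable_def by (meson half_gt_zero)
  have "cmod (f z + g z - poly (p + q) z) < \<epsilon>" if "z \<in> W" for z
  proof -
    have "cmod ((f z - poly p z) + (g z - poly q z)) < \<epsilon> / 2 + \<epsilon> / 2"
      using p q that by (intro norm_triangle_lt add_strict_mono) auto
    then show ?thesis by (simp add: algebra_simps)
  qed
  then show "\<exists>p. \<forall>z\<in>W. cmod (f z + g z - poly p z) < \<epsilon>" by blast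
qed

lemma poly_approximable_sum:
  "(\<And>i. i \<in> A \<Longrightarrow> poly_approximable W (f i)) \<Longrightarrow> poly_approximable W (\<lambda>z. \<Sum>i\<in>A. f i z)"
  by (induction A rule: infinite_finite_induct) (auto intro: poly_approximable_const poly_approximable_add)

lemma poly_approximable_mult_poly:
  assumes W: "bounded W" and f: "poly_approximable W f" shows "poly_approximable W (\<lambda>z. f z * poly q z)"
  unfolding poly_approximable_def
proof (intro allI impI)
  fix \<epsilon> :: real assume \<epsilon>: "\<epsilon> > 0"
  have "bounded (poly q ` closure W)"
    using W by (intro compact_imp_bounded compact_continuous_image) (auto intro: continuous_intros simp: compact_closure)
  then obtain B where B: "B > 0" "\<And>z. z \<in> W \<Longrightarrow> cmod (poly q z) \<le> B"
    using closure_subset unfolding bounded_pos by (metis image_eqI subsetD)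
  obtain p where p: "\<forall>z\<in>W. cmod (f z - poly p z) < \<epsilon> / B"
    using f \<epsilon> B unfolding poly_approximable_def by (meson divide_pos_pos)
  have "cmod (f z * poly q z - poly (p * q) z) < \<epsilon>" if "z \<in> W" for z
  proof -
    have "cmod (f z * poly q z - poly (p * q) z) = cmod (f z - poly p z) * cmod (poly q z)"
      by (simp add: left_diff_distrib flip: norm_mult)
    also have "\<dots> \<le> cmod (f z - poly p z) * B" using B(2) [OF that] by (intro mult_left_mono) auto
    also have "\<dots> < \<epsilon> / B * B" using p that B(1) by (intro mult_strict_right_mono) auto
    finally show ?thesis using B by simp
  qed
  then show "\<exists>p. \<forall>z\<in>W. cmod (f z * poly q z - poly p z) < \<epsilon>" by blast
qed

lemma poly_approximable_limit:
  assumes "\<And>\<epsilon>. \<epsilon> > 0 \<Longrightarrow> \<exists>g. poly_approximable W g \<and> (\<forall>z\<in>W. cmod (f z - g z) < \<epsilon>)"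
  shows "poly_approximable W f"
  unfolding poly_approximable_def
proof (intro allI impI)
  fix \<epsilon> :: real assume "\<epsilon> > 0"
  then obtain g where g: "poly_approximable W g" "\<forall>z\<in>W. cmod (f z - g z) < \<epsilon> / 2"
    using assms [of "\<epsilon> / 2"] by auto
  then obtain p where p: "\<forall>z\<in>W. cmod (g z - poly p z) < \<epsilon> / 2"
    using \<open>\<epsilon> > 0\<close> unfolding poly_approximable_def by (meson half_gt_zero)
  have "cmod (f z - poly p z) < \<epsilon>" if "z \<in> W" for z
  proof -
    have "cmod ((f z - g z) + (g z - poly p z)) < \<epsilon> / 2 + \<epsilon> / 2"
      using p g(2) that by (intro norm_triangle_lt add_strict_mono) auto
    then show ?thesis by simp
  qed
  then show "\<exists>p. \<forall>z\<in>W. cmod (f z - poly p z) < \<epsilon>" by blast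
qed

text \<open>The set of dilation factors \<open>s\<close> for which every \<open>f (s z)\<close> is approximable is advanced from 0
  in steps of fixed length by Taylor expansion in \<open>s\<close>.\<close>

lemma poly_approximable_dilation:
  assumes S: "open S" and K: "compact K" "K \<subseteq> S" and W: "bounded W"
    and WK: "\<And>s z. 0 \<le> s \<Longrightarrow> s \<le> s0 \<Longrightarrow> z \<in> W \<Longrightarrow> of_real s * z \<in> K"
    and s0: "0 \<le> s0" and f: "f holomorphic_on S"
  shows "poly_approximable W (\<lambda>z. f (of_real s0 * z))"
proof -
  obtain \<delta>0 where \<delta>0: "\<delta>0 > 0" "(\<Union>x\<in>K. ball x \<delta>0) \<subseteq> S"
    using compact_subset_open_imp_ball_epsilon_subset [OF K(1) S K(2)] by blast
  define \<delta> where "\<delta> = \<delta>0 / 2"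
  have \<delta>: "\<delta> > 0" "\<And>x. x \<in> K \<Longrightarrow> cball x \<delta> \<subseteq> S"
    using \<delta>0 by (auto simp: \<delta>_def subset_eq)
  obtain B where B: "B > 0" "\<And>z. z \<in> W \<Longrightarrow> cmod z \<le> B"
    using W unfolding bounded_pos by blast
  have step: "poly_approximable W (\<lambda>z. g (of_real (s + \<eta>) * z))"
    if s: "0 \<le> s" "s \<le> s0" and \<eta>: "0 \<le> \<eta>" "\<eta> * B \<le> \<delta> / 2" and g: "g holomorphic_on S"
      and IH: "\<And>f. f holomorphic_on S \<Longrightarrow> poly_approximable W (\<lambda>z. f (of_real s * z))" for s \<eta> g
  proof (rule poly_approximable_limit)
    fix \<epsilon> :: real assume \<epsilon>: "\<epsilon> > 0"
    define K' where "K' = {x + y |x y. x \<in> K \<and> y \<in> cball 0 \<delta>}"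
    have K': "compact K'" unfolding K'_def by (intro compact_sums K compact_cball)
    have "K' \<subseteq> S" using \<delta>(2) by (fastforce simp: K'_def dist_norm subset_eq)
    then have "bounded (g ` K')"
      using K' g by (intro compact_imp_bounded compact_continuous_image) (auto intro: holomorphic_on_imp_continuous_on continuous_on_subset)
    then obtain M where M: "M > 0" "\<And>x. x \<in> K' \<Longrightarrow> cmod (g x) \<le> M"
      unfolding bounded_pos by blast
    obtain N where N: "(1/2) ^ N < \<epsilon> / (2 * M)"
      using real_arch_pow_inv [of "\<epsilon> / (2 * M)" "1/2"] \<epsilon> M by auto
    \<comment> \<open>Each Taylor term is a derivative of \<open>g\<close> at the smaller dilation
      times a monomial. The induction therefore has to treat all holomorphic functions on
      \<open>S\<close> at once, derivatives included.\<close>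
    define h where "h z = (\<Sum>n<N. (deriv ^^ n) g (of_real s * z) * poly (monom (of_real \<eta> ^ n / fact n) n) z)" for z
    have "poly_approximable W h"
      unfolding h_def
      by (intro poly_approximable_sum poly_approximable_mult_poly W IH holomorphic_higher_deriv g S)
    moreover have "cmod (g (of_real (s + \<eta>) * z) - h z) < \<epsilon>" if z: "z \<in> W" for z
    proof -
      define \<xi> where "\<xi> = of_real s * z"
      have \<xi>: "\<xi> \<in> K" using WK s z by (simp add: \<xi>_def)
      have hz: "h z = (\<Sum>n<N. (deriv ^^ n) g \<xi> / fact n * (of_real \<eta> * z) ^ n)"
        by (simp add: h_def \<xi>_def poly_monom power_mult_distrib)
      have "cmod (g (\<xi> + of_real \<eta> * z) - h z) \<le> M * (1/2) ^ N / (1 - 1/2)"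
        unfolding hz
      proof (rule Taylor_remainder_le [where \<delta> = \<delta>])
        show "g holomorphic_on ball \<xi> \<delta>" "continuous_on (cball \<xi> \<delta>) g"
          using g \<delta>(2) [OF \<xi>] ball_subset_cball
          by (meson holomorphic_on_subset order_trans, meson continuous_on_subset holomorphic_on_imp_continuous_on)
        show "cmod (g x) \<le> M" if "cmod (\<xi> - x) = \<delta>" for x
        proof (rule M(2))
          have "x = \<xi> + (x - \<xi>)" "x - \<xi> \<in> cball 0 \<delta>" using that by (auto simp: norm_minus_commute)
          then show "x \<in> K'" using \<xi> unfolding K'_def by blast
        qed
        have "cmod (of_real \<eta> * z) \<le> \<eta> * B" using \<eta> B z by (simp add: norm_mult mult_left_mono)
        then show "cmod (of_real \<eta> * z) \<le> 1 / 2 * \<delta>" using \<eta> by simp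
      qed (use \<delta> in auto)
      also have "\<dots> = (2 * M) * (1/2) ^ N" by simp
      also have "\<dots> < (2 * M) * (\<epsilon> / (2 * M))" using N M by (intro mult_strict_left_mono) auto
      finally show ?thesis using M by (simp add: \<xi>_def distrib_right)
    qed
    ultimately show "\<exists>h. poly_approximable W h \<and> (\<forall>z\<in>W. cmod (g (of_real (s + \<eta>) * z) - h z) < \<epsilon>)" by blast
  qed
  obtain n where n: "s0 * B / (\<delta> / 2) < real n" using reals_Archimedean2 by blast
  \<comment> \<open>Equal steps, \<open>n + 1\<close> in number, that reach \<open>s0\<close>
    exactly; each displaces a point by at most half the radius \<delta>, so the Taylor ratio is
    \<open>1/2\<close>.\<close>
  define \<eta> where "\<eta> = s0 / (real n + 1)"
  have \<eta>: "0 \<le> \<eta>" "\<eta> * B \<le> \<delta> / 2"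
  proof -
    show "0 \<le> \<eta>" using s0 by (simp add: \<eta>_def)
    have "s0 * B \<le> \<delta> / 2 * (real n + 1)" using n \<delta>(1) by (simp add: field_simps)
    then show "\<eta> * B \<le> \<delta> / 2" by (simp add: \<eta>_def field_simps)
  qed
  have "\<forall>g. g holomorphic_on S \<longrightarrow> poly_approximable W (\<lambda>z. g (of_real (real k * \<eta>) * z))" if "k \<le> Suc n" for k
    using that
  proof (induction k)
    case 0
    then show ?case by (simp add: poly_approximable_const)
  next
    case (Suc k)
    have "real k * \<eta> \<le> (real n + 1) * \<eta>" using Suc.prems \<eta> by (intro mult_right_mono) auto
    also have "\<dots> = s0" by (simp add: \<eta>_def add_nonneg_eq_0_iff)
    finally have "real k * \<eta> \<le> s0" .
    then show ?case
      using step [of "real k * \<eta>" \<eta>] Suc \<eta> by (simp add: distrib_right add.commute)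
  qed
  from this [of "Suc n"] have "poly_approximable W (\<lambda>z. f (of_real (real (Suc n) * \<eta>) * z))" using f by blast
  moreover have "(real n + 1) * \<eta> = s0" by (simp add: \<eta>_def add_nonneg_eq_0_iff)
  then have "real (Suc n) * \<eta> = s0" by (simp only: of_nat_Suc add.commute)
  ultimately show ?thesis by (simp only:)
qed

section \<open>The extremal constant\<close>

text \<open>The upper estimate for the completely bounded constant of the shift, tested on pairs of
  vectors.\<close>

definition shift_bound :: "nat \<Rightarrow> (nat \<Rightarrow> real) \<Rightarrow> real \<Rightarrow> bool" where
  "shift_bound d a \<Lambda> \<longleftrightarrow> (\<forall>m N C y z.
     (\<forall>x\<in>num_range d a. opbound m (\<lambda>e c. \<Sum>n\<le>N. C n e c * x ^ n) 1) \<longrightarrow>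
     cmod (shift_form d m N C (\<lambda>i. of_real (a i)) y z) \<le> \<Lambda> * l2nn m d y * l2nn m d z)"

text \<open>The sum is the entry in row \<open>i\<close> and column \<open>(i + k) mod d\<close> of
  \<open>p\<close> at the shift. One such entry already bounds the operator norm from below.\<close>

definition poly_attains :: "nat \<Rightarrow> (nat \<Rightarrow> real) \<Rightarrow> real \<Rightarrow> bool" where
  "poly_attains d a \<Lambda> \<longleftrightarrow> (\<forall>\<epsilon>>0. \<exists>p i k. i < d \<and> k < d \<and> (\<forall>x\<in>num_range d a. cmod (poly p x) \<le> 1) \<and>
     \<Lambda> - \<epsilon> \<le> cmod (\<Sum>n\<in>{n. n \<le> degree p \<and> n mod d = k}. coeff p n * cyc_prod d (\<lambda>i. of_real (a i)) i n))"

lemma cyc_prod_of_real: "cyc_prod d (\<lambda>i. of_real (a i)) i n = (of_real (cyc_prod d a i n) :: complex)"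
  by (simp add: cyc_prod_def)

lemma cyc_prod_nonneg: "(\<And>i. 0 \<le> a i) \<Longrightarrow> 0 \<le> cyc_prod d (a :: nat \<Rightarrow> real) i n"
  by (simp add: cyc_prod_def prod_nonneg)

text \<open>The longest-path potential: conjugation by it turns \<open>\<kappa> a\<close> into weights at most 1, and its
  condition number is the largest of the norms of the powers.\<close>

lemma longest_path_potential:
  assumes d: "d > 0" and a: "\<And>i. 0 \<le> a i" and \<kappa>: "0 \<le> \<kappa>" "\<kappa> ^ d * (\<Prod>i<d. a i) \<le> 1"
    and \<Lambda>: "\<And>i k. i < d \<Longrightarrow> k < d \<Longrightarrow> \<kappa> ^ k * cyc_prod d a i k \<le> \<Lambda>"
  obtains s :: "nat \<Rightarrow> real" where "\<And>i. 1 \<le> s i" "\<And>i. s i \<le> \<Lambda>"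
    "\<And>i. i < d \<Longrightarrow> \<kappa> * a i * s ((i + 1) mod d) \<le> s i"
proof -
  define s where "s i = Max ((\<lambda>k. \<kappa> ^ k * cyc_prod d a i k) ` {..<d})" for i
  have le: "\<kappa> ^ k * cyc_prod d a i k \<le> s i" if "k < d" for i k
    unfolding s_def using that by (intro Max_ge) auto
  have s1: "1 \<le> s i" for i using le [of 0 i] d by simp
  have s\<Lambda>: "s i \<le> \<Lambda>" for i
    unfolding s_def using d \<Lambda> [of "i mod d"] by (subst Max_le_iff) auto
  have "\<kappa> * a i * s ((i + 1) mod d) \<le> s i" if i: "i < d" for i
  proof -
    have "s ((i + 1) mod d) \<in> (\<lambda>k. \<kappa> ^ k * cyc_prod d a ((i + 1) mod d) k) ` {..<d}"
      unfolding s_def using d by (intro Max_in) auto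
    then obtain k where k: "k < d" "s ((i + 1) mod d) = \<kappa> ^ k * cyc_prod d a ((i + 1) mod d) k" by auto
    \<comment> \<open>An optimal path from the successor of \<open>i\<close>, extended backwards by
      one edge, is a path from \<open>i\<close>.\<close>
    have "\<kappa> * a i * s ((i + 1) mod d) = \<kappa> ^ Suc k * cyc_prod d a i (Suc k)"
      unfolding k(2) cyc_prod_Suc using i by simp
    also have "\<dots> \<le> s i"
    proof (cases "Suc k < d")
      case True
      then show ?thesis by (rule le)
    next
      case False
      \<comment> \<open>A full turn has weight at most 1 and does not beat the empty path.\<close>
      then have "Suc k = d" using k by simp
      then show ?thesis using \<kappa>(2) s1 [of i] unfolding \<open>Suc k = d\<close> cyc_prod_full by linarith
    qed
    finally show ?thesis .
  qed
  then show ?thesis using that s1 s\<Lambda> by blast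
qed

lemma l2nn_scale_le:
  assumes "\<And>e i. i < d \<Longrightarrow> cmod (y' e i) \<le> c * cmod (y e i)" "0 \<le> c"
  shows "l2nn m d y' \<le> c * l2nn m d y"
proof -
  have "l2nn m d y' \<le> sqrt (\<Sum>e<m. \<Sum>i<d. (c * cmod (y e i))\<^sup>2)"
    unfolding l2nn_def using assms(1) by (intro real_sqrt_le_mono sum_mono power_mono) auto
  also have "(\<Sum>e<m. \<Sum>i<d. (c * cmod (y e i))\<^sup>2) = c\<^sup>2 * (\<Sum>e<m. \<Sum>i<d. (cmod (y e i))\<^sup>2)"
    by (simp add: power_mult_distrib sum_distrib_left)
  also have "sqrt \<dots> = c * l2nn m d y"
    using assms(2) by (simp add: l2nn_def real_sqrt_mult)
  finally show ?thesis .
qed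

lemma shift_form_cong:
  assumes "d > 0" "\<And>e i. i < d \<Longrightarrow> y e i = y' e i" "\<And>e i. i < d \<Longrightarrow> z e i = z' e i"
  shows "shift_form d m N R b y z = shift_form d m N R b y' z'"
  unfolding shift_form_def using assms by (intro sum.cong refl) auto

text \<open>Conjugation by the potential \<open>s\<close> makes the weights contractive. One vector
  is divided by \<open>s \<ge> 1\<close> and does not grow, the other is multiplied by
  \<open>s \<le> \<Lambda>\<close>; this is the factor \<Lambda>.\<close>

lemma shift_form_similar_contraction:
  assumes d: "d > 0" and a: "\<And>i. 0 \<le> a i" and \<kappa>: "0 \<le> \<kappa>" "\<kappa> ^ d * (\<Prod>i<d. a i) \<le> 1"
    and \<Lambda>: "\<And>i k. i < d \<Longrightarrow> k < d \<Longrightarrow> \<kappa> ^ k * cyc_prod d a i k \<le> \<Lambda>"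
    and K: "K \<ge> 0" "\<And>w. cmod w = 1 \<Longrightarrow> opbound m (\<lambda>e c. \<Sum>n\<le>N. R n e c * w ^ n) K"
  shows "cmod (shift_form d m N (\<lambda>n e c. R n e c * of_real \<kappa> ^ n) (\<lambda>i. of_real (a i)) y z) \<le> K * \<Lambda> * l2nn m d y * l2nn m d z"
proof -
  obtain s where s: "\<And>i. 1 \<le> s i" "\<And>i. s i \<le> \<Lambda>" "\<And>i. i < d \<Longrightarrow> \<kappa> * a i * s ((i + 1) mod d) \<le> s i"
    using longest_path_potential [of d a \<kappa> \<Lambda>, OF d a \<kappa> \<Lambda>] by blast
  have s0: "0 < s i" for i using s(1) [of i] by linarith
  define b where "b i = of_real \<kappa> * of_real (a i) * of_real (s ((i + 1) mod d)) / complex_of_real (s i)" for i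
  define y' where "y' e i = y e i / of_real (s i)" for e i
  define z' where "z' e i = z e i * of_real (s i)" for e i
  have b1: "cmod (b i) \<le> 1" if "i < d" for i
    using s(3) [OF that] s0 [of i] s0 [of "(i + 1) mod d"] a [of i] \<kappa>(1)
    by (simp add: b_def norm_mult norm_divide divide_le_eq)
  have sc: "complex_of_real (s i) \<noteq> 0" for i using s0 [of i] by simp
  have "shift_form d m N R b y' z' = shift_form d m N (\<lambda>n e c. R n e c * of_real \<kappa> ^ n) (\<lambda>i. of_real (a i))
      (\<lambda>c i. of_real (s i) * y' c i) (\<lambda>e i. z' e i / cnj (of_real (s i)))"
    using d sc by (intro shift_form_gauge) (auto simp: b_def)
  also have "\<dots> = shift_form d m N (\<lambda>n e c. R n e c * of_real \<kappa> ^ n) (\<lambda>i. of_real (a i)) y z"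
    using d sc by (intro shift_form_cong) (auto simp: y'_def z'_def)
  finally have eq: "shift_form d m N R b y' z' = \<dots>" .
  have "cmod (shift_form d m N R b y' z') \<le> K * l2nn m d y' * l2nn m d z'"
    using d b1 K by (rule shift_form_von_Neumann)
  also have "\<dots> \<le> K * (1 * l2nn m d y) * (\<Lambda> * l2nn m d z)"
  proof (intro mult_mono l2nn_scale_le)
    show "cmod (y' e i) \<le> 1 * cmod (y e i)" for e i
      using s0 [of i] mult_left_mono [OF s(1) [of i] norm_ge_zero [of "y e i"]]
      by (simp add: y'_def norm_divide divide_le_eq)
    show "cmod (z' e i) \<le> \<Lambda> * cmod (z e i)" for e i
      using s(2) [of i] s0 [of i] mult_right_mono [of "s i" \<Lambda> "cmod (z e i)"] by (simp add: z'_def norm_mult mult.commute)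
    show "0 \<le> \<Lambda>" using s(1,2) [of 0] by linarith
  qed (use K s(1,2) [of 0] in \<open>auto intro: mult_nonneg_nonneg\<close>)
  finally show ?thesis unfolding eq by (simp add: ac_simps)
qed

lemma l2n_ge: "a < m \<Longrightarrow> cmod (\<xi> a) \<le> l2n m \<xi>"
  unfolding l2n_def using member_le_L2_set [of "{..<m}" a "\<lambda>a. cmod (\<xi> a)"] by simp

text \<open>The crude factor \<open>m * m\<close> suffices: the size \<open>m\<close> is fixed while
  \<epsilon> tends to 0.\<close>

lemma opbound_perturb:
  assumes X: "opbound m X K" and Y: "\<And>e c. e < m \<Longrightarrow> c < m \<Longrightarrow> cmod (Y e c - X e c) \<le> \<epsilon>" and \<epsilon>: "0 \<le> \<epsilon>"
  shows "opbound m Y (K + real m * real m * \<epsilon>)"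
  unfolding opbound_def
proof (intro allI)
  fix \<xi> \<eta>
  have "(\<Sum>e<m. \<Sum>c<m. Y e c * \<eta> c * cnj (\<xi> e)) =
      (\<Sum>e<m. \<Sum>c<m. X e c * \<eta> c * cnj (\<xi> e)) + (\<Sum>e<m. \<Sum>c<m. (Y e c - X e c) * \<eta> c * cnj (\<xi> e))"
    unfolding sum.distrib [symmetric] by (intro sum.cong refl) (simp add: algebra_simps)
  also have "cmod \<dots> \<le> K * l2n m \<xi> * l2n m \<eta> + (\<Sum>e<m. \<Sum>c<m. \<epsilon> * (l2n m \<eta> * l2n m \<xi>))"
  proof (intro norm_triangle_mono)
    show "cmod (\<Sum>e<m. \<Sum>c<m. X e c * \<eta> c * cnj (\<xi> e)) \<le> K * l2n m \<xi> * l2n m \<eta>"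
      using X unfolding opbound_def by blast
    show "cmod (\<Sum>e<m. \<Sum>c<m. (Y e c - X e c) * \<eta> c * cnj (\<xi> e)) \<le> (\<Sum>e<m. \<Sum>c<m. \<epsilon> * (l2n m \<eta> * l2n m \<xi>))"
      unfolding mult.assoc using Y \<epsilon> l2n_ge
      by (intro sum_norm_le) (auto simp: norm_mult intro!: mult_mono)
  qed
  also have "\<dots> = (K + real m * real m * \<epsilon>) * l2n m \<xi> * l2n m \<eta>"
    by (simp add: algebra_simps)
  finally show "cmod (\<Sum>e<m. \<Sum>c<m. Y e c * \<eta> c * cnj (\<xi> e)) \<le> (K + real m * real m * \<epsilon>) * l2n m \<xi> * l2n m \<eta>" .
qed

text \<open>For non-zero \<open>\<rho>\<close> the form depends on the polynomial only through its
  values at the \<open>d\<close> eigenvalues. Convergence there is thus enough for a limit of forms,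
  whatever the degrees.\<close>

lemma shift_form_residue:
  fixes b :: "nat \<Rightarrow> complex"
  assumes d: "d > 0" and \<rho>: "\<rho> ^ d = (\<Prod>l<d. b l)" "\<rho> \<noteq> 0"
  shows "shift_form d m N R b y z = (\<Sum>e<m. \<Sum>c<m. \<Sum>i<d. \<Sum>k<d.
     cyc_prod d b i k / \<rho> ^ k * (1 / of_nat d) *
     (\<Sum>j<d. cnj ((unit_root d ^ j) ^ k) * (\<Sum>n\<le>N. R n e c * (\<rho> * unit_root d ^ j) ^ n)) * (y c ((i + k) mod d) * cnj (z e i)))"
proof -
  have "shift_form d m N R b y z = (\<Sum>e<m. \<Sum>c<m. \<Sum>i<d. \<Sum>n\<le>N. R n e c * cyc_prod d b i n * (y c ((i + n) mod d) * cnj (z e i)))"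
  proof -
    have "shift_form d m N R b y z = (\<Sum>n\<le>N. \<Sum>e<m. \<Sum>c<m. \<Sum>i<d. R n e c * cyc_prod d b i n * (y c ((i + n) mod d) * cnj (z e i)))"
      unfolding shift_form_def by (simp add: mult.assoc)
    also have "\<dots> = (\<Sum>i<d. \<Sum>e<m. \<Sum>c<m. \<Sum>n\<le>N. R n e c * cyc_prod d b i n * (y c ((i + n) mod d) * cnj (z e i)))"
      by (rule sum_rotate)
    also have "\<dots> = (\<Sum>e<m. \<Sum>i<d. \<Sum>c<m. \<Sum>n\<le>N. R n e c * cyc_prod d b i n * (y c ((i + n) mod d) * cnj (z e i)))"
      by (rule sum.swap)
    also have "\<dots> = (\<Sum>e<m. \<Sum>c<m. \<Sum>i<d. \<Sum>n\<le>N. R n e c * cyc_prod d b i n * (y c ((i + n) mod d) * cnj (z e i)))"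
      by (rule sum.cong [OF refl], rule sum.swap)
    finally show ?thesis .
  qed
  also have "\<dots> = (\<Sum>e<m. \<Sum>c<m. \<Sum>i<d. \<Sum>k<d. cyc_prod d b i k / \<rho> ^ k * (1 / of_nat d) *
     (\<Sum>j<d. cnj ((unit_root d ^ j) ^ k) * (\<Sum>n\<le>N. R n e c * (\<rho> * unit_root d ^ j) ^ n)) * (y c ((i + k) mod d) * cnj (z e i)))"
  proof (rule sum.cong [OF refl], rule sum.cong [OF refl], rule sum.cong [OF refl])
    fix e c i
    have "(\<Sum>n\<le>N. R n e c * cyc_prod d b i n * (y c ((i + n) mod d) * cnj (z e i))) =
        (\<Sum>k<d. \<Sum>n\<in>{n \<in> {..N}. n mod d = k}. R n e c * cyc_prod d b i n * (y c ((i + n) mod d) * cnj (z e i)))"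
      by (rule sum.group [symmetric]) (use d in auto)
    also have "\<dots> = (\<Sum>k<d. (\<Sum>n\<in>{n. n \<le> N \<and> n mod d = k}. R n e c * cyc_prod d b i n) * (y c ((i + k) mod d) * cnj (z e i)))"
    proof (rule sum.cong [OF refl])
      fix k
      have "(i + n) mod d = (i + k) mod d" if "n mod d = k" for n
        using that by (metis mod_add_right_eq)
      then show "(\<Sum>n\<in>{n \<in> {..N}. n mod d = k}. R n e c * cyc_prod d b i n * (y c ((i + n) mod d) * cnj (z e i))) =
          (\<Sum>n\<in>{n. n \<le> N \<and> n mod d = k}. R n e c * cyc_prod d b i n) * (y c ((i + k) mod d) * cnj (z e i))"
        unfolding sum_distrib_right by (intro sum.cong) auto
    qed
    also have "\<dots> = (\<Sum>k<d. cyc_prod d b i k / \<rho> ^ k * (1 / of_nat d) *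
     (\<Sum>j<d. cnj ((unit_root d ^ j) ^ k) * (\<Sum>n\<le>N. R n e c * (\<rho> * unit_root d ^ j) ^ n)) * (y c ((i + k) mod d) * cnj (z e i)))"
      using sum_residue_class [OF d _ \<rho>, where N = N and p = "\<lambda>n. R n e c" and i = i] by (intro sum.cong refl) simp
    finally show "(\<Sum>n\<le>N. R n e c * cyc_prod d b i n * (y c ((i + n) mod d) * cnj (z e i))) = \<dots>" .
  qed
  finally show ?thesis .
qed

section \<open>Constant weights, and weights with a zero\<close>

text \<open>The Fourier vectors are eigenvectors, so every eigenvalue lies in the range and the
  unitary case gives the bound 1. The constant polynomial 1 attains it.\<close>

lemma constant_weights:
  assumes d: "d > 0" and a: "\<And>i. i < d \<Longrightarrow> a i = a0"
  shows "shift_bound d a 1" "poly_attains d a 1"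
proof -
  have pt: "of_real a0 * unit_root d ^ j \<in> num_range d a" for j
  proof -
    define x where "x i = (unit_root d ^ j) ^ i / of_real (sqrt d)" for i
    have x1: "nsq d x = 1"
      using d by (simp add: nsq_def x_def norm_divide norm_power power_divide)
    have sq: "complex_of_real (sqrt d) * complex_of_real (sqrt d) = of_nat d"
      by (simp flip: of_real_mult)
    have xx: "x ((i + 1) mod d) * cnj (x i) = unit_root d ^ j / of_nat d" for i
    proof -
      have "cmod ((unit_root d ^ j) ^ i) = 1" by (simp add: norm_power)
      then have 1: "(unit_root d ^ j) ^ i * cnj ((unit_root d ^ j) ^ i) = 1"
        using complex_norm_square [of "(unit_root d ^ j) ^ i"] by simp
      have "x ((i + 1) mod d) * cnj (x i) = unit_root d ^ j * ((unit_root d ^ j) ^ i * cnj ((unit_root d ^ j) ^ i)) / of_nat d"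
        unfolding x_def unit_root_power_mod [OF d] using sq by simp
      then show ?thesis unfolding 1 by simp
    qed
    have "cform d a x = (\<Sum>i<d. of_real a0 * (x ((i + 1) mod d) * cnj (x i)))"
      unfolding cform_def csesq_def using a by (intro sum.cong) auto
    also have "\<dots> = of_real a0 * unit_root d ^ j" unfolding xx using d by simp
    finally show ?thesis using cform_mem_num_range [OF x1, of a] by simp
  qed
  show "shift_bound d a 1"
    unfolding shift_bound_def
  proof (intro allI impI)
    fix m N C y z
    assume H: "\<forall>x\<in>num_range d a. opbound m (\<lambda>e c. \<Sum>n\<le>N. C n e c * x ^ n) 1"
    have "shift_form d m N C (\<lambda>i. of_real (a i)) y z =
        shift_form d m N (\<lambda>n e c. C n e c * of_real a0 ^ n) (\<lambda>_. 1) (\<lambda>c i. 1 * y c i) (\<lambda>e i. z e i / cnj 1)"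
      using d a by (intro shift_form_gauge [where g = "\<lambda>_. 1"]) auto
    also have "cmod \<dots> \<le> 1 * l2nn m d (\<lambda>c i. 1 * y c i) * l2nn m d (\<lambda>e i. z e i / cnj 1)"
    proof (rule shift_form_unimodular [OF d, of _ 1])
      fix j
      show "opbound m (\<lambda>e c. \<Sum>n\<le>N. C n e c * of_real a0 ^ n * (1 * unit_root d ^ j) ^ n) 1"
        using H [rule_format, OF pt [of j]] by (simp add: power_mult_distrib mult.assoc)
    qed auto
    finally show "cmod (shift_form d m N C (\<lambda>i. of_real (a i)) y z) \<le> 1 * l2nn m d y * l2nn m d z" by simp
  qed
  have "{n::nat. n \<le> degree (1 :: complex poly) \<and> n mod d = 0} = {0}" by auto
  then have "(\<Sum>n\<in>{n. n \<le> degree (1 :: complex poly) \<and> n mod d = 0}. coeff 1 n * cyc_prod d (\<lambda>i. complex_of_real (a i)) 0 n) = 1"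
    by simp
  then show "poly_attains d a 1"
    unfolding poly_attains_def using d
    by (intro allI impI exI [of _ "1 :: complex poly"] exI [of _ "0 :: nat"]) simp
qed

context cyclic_weights
begin

text \<open>The range is the disc of radius \<open>R\<close> and the conformal map is
  \<open>z / R\<close>, so von Neumann's inequality applies without any limit, and the extremal
  functions are monomials.\<close>

lemma zero_weight_case:
  assumes j: "j < d" "a j = 0"
  obtains \<Lambda> where "shift_bound d a \<Lambda>" "poly_attains d a \<Lambda>" "\<Lambda> \<le> 2"
proof -
  obtain R where R: "R > 0" "interior W = ball 0 R" "\<And>z. z \<in> W \<Longrightarrow> cmod z \<le> R"
    using interior_disc_of_zero_weight [OF j] by blast
  have W: "cball 0 R \<subseteq> W"
  proof -
    have "closure (interior W) \<subseteq> closure W" by (intro closure_mono interior_subset)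
    moreover have "closure W = W" using compact_num_range by (simp add: compact_imp_closed)
    ultimately show ?thesis using R by simp
  qed
  have c0: "(\<Prod>i<d. a i) = 0" using j by auto
  define \<kappa> where "\<kappa> = 1 / R"
  have \<kappa>: "\<kappa> > 0" using R by (simp add: \<kappa>_def)
  define \<Lambda> where "\<Lambda> = Max ((\<lambda>(i, k). \<kappa> ^ k * cyc_prod d a i k) ` ({..<d} \<times> {..<d}))"
  have ne: "(\<lambda>(i, k). \<kappa> ^ k * cyc_prod d a i k) ` ({..<d} \<times> {..<d}) \<noteq> {}" using d_pos by auto
  have \<Lambda>: "\<kappa> ^ k * cyc_prod d a i k \<le> \<Lambda>" if "i < d" "k < d" for i k
    unfolding \<Lambda>_def using that by (intro Max_ge) auto
  obtain i0 k0 where ik: "i0 < d" "k0 < d" "\<Lambda> = \<kappa> ^ k0 * cyc_prod d a i0 k0"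
    using Max_in [OF _ ne] unfolding \<Lambda>_def by auto
  show ?thesis
  proof
    show "shift_bound d a \<Lambda>"
      unfolding shift_bound_def
    proof (intro allI impI)
      fix m N C y z
      assume H: "\<forall>x\<in>num_range d a. opbound m (\<lambda>e c. \<Sum>n\<le>N. C n e c * x ^ n) 1"
      have "cmod (shift_form d m N (\<lambda>n e c. (C n e c * of_real R ^ n) * of_real \<kappa> ^ n) (\<lambda>i. of_real (a i)) y z) \<le> 1 * \<Lambda> * l2nn m d y * l2nn m d z"
      proof (rule shift_form_similar_contraction [OF d_pos a_nonneg _ _ \<Lambda>])
        fix w :: complex assume "cmod w = 1"
        then have "of_real R * w \<in> num_range d a" using W R by (auto simp: norm_mult subset_eq)
        from H [rule_format, OF this]
        show "opbound m (\<lambda>e c. \<Sum>n\<le>N. C n e c * of_real R ^ n * w ^ n) 1"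
          by (simp add: power_mult_distrib mult.assoc)
      next
        show "\<kappa> ^ d * (\<Prod>i<d. a i) \<le> 1" unfolding c0 by simp
      qed (use \<kappa> in auto)
      moreover have "(C n e c * of_real R ^ n) * of_real \<kappa> ^ n = C n e c" for n e c
        using R by (simp add: \<kappa>_def power_divide)
      ultimately show "cmod (shift_form d m N C (\<lambda>i. of_real (a i)) y z) \<le> \<Lambda> * l2nn m d y * l2nn m d z" by simp
    qed
    show "poly_attains d a \<Lambda>"
      unfolding poly_attains_def
    proof (intro allI impI exI conjI)
      fix \<epsilon> :: real assume \<epsilon>: "\<epsilon> > 0"
      \<comment> \<open>Since \<open>k0 < d\<close>, the monomial alone makes up its residue class
        and yields exactly the extremal entry.\<close>
      define p where "p = monom (complex_of_real (\<kappa> ^ k0)) k0"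
      show "\<forall>x\<in>num_range d a. cmod (poly p x) \<le> 1"
      proof
        fix x assume "x \<in> num_range d a"
        then have "cmod x ^ k0 \<le> R ^ k0" using R(3) by (intro power_mono) auto
        then show "cmod (poly p x) \<le> 1" using R(1)
          by (simp add: p_def poly_monom norm_mult norm_power \<kappa>_def norm_divide power_divide divide_le_eq)
      qed
      have dp: "degree p = k0" using \<kappa> by (simp add: p_def degree_monom_eq)
      have "n mod d = n" if "n \<le> k0" for n using that ik(2) by simp
      then have "{n. n \<le> k0 \<and> n mod d = k0} = {k0}" by auto
      then have "(\<Sum>n\<in>{n. n \<le> degree p \<and> n mod d = k0}. coeff p n * cyc_prod d (\<lambda>i. of_real (a i)) i0 n) = of_real \<Lambda>"
        unfolding dp by (simp add: p_def cyc_prod_of_real ik(3))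
      moreover have "\<Lambda> \<ge> 0" unfolding ik(3) using \<kappa> cyc_prod_nonneg [of a] a_nonneg by simp
      ultimately show "\<Lambda> - \<epsilon> \<le> cmod (\<Sum>n\<in>{n. n \<le> degree p \<and> n mod d = k0}. coeff p n * cyc_prod d (\<lambda>i. of_real (a i)) i0 n)"
        using \<epsilon> by simp
    qed (use ik in auto)
    show "\<Lambda> \<le> 2"
    proof (cases "k0 = 0 \<or> cyc_prod d a i0 k0 = 0")
      case True
      then show ?thesis using ik(3) by auto
    next
      case False
      then have k: "0 < k0" and q: "cyc_prod d a i0 k0 \<noteq> 0" by auto
      \<comment> \<open>A path of non-zero weight avoids the vanishing edge, so the complementary
        path contains it. One off-diagonal term of the resolvent drops out.\<close>
      have "cyc_prod d a i0 k0 * cyc_prod d a ((i0 + k0) mod d) (d - k0) = 0"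
        using cyc_prod_add [of d a i0 k0 "d - k0"] ik(2) cyc_prod_full [of d a i0] c0 by simp
      then have p: "cyc_prod d a ((i0 + k0) mod d) (d - k0) = 0" using q by simp
      have le: "cyc_prod d a i0 k0 \<le> 2 * R' ^ k0" if R': "R' > R" for R'
      proof -
        have R0: "R' > 0" using R R' by simp
        have "0 \<le> Re (1 * (2 * of_real R' ^ (d - 1) + (- 1) * (of_real R' ^ (d - 1 - k0) * of_real (cyc_prod d a i0 k0)) +
         cnj (- 1) * (of_real R' ^ (k0 - 1) * of_real (cyc_prod d a ((i0 + k0) mod d) (d - k0)))) / (of_real R' ^ d - of_real (\<Prod>j<d. a j)))"
        proof (rule resolvent_positivity [OF d2 ik(1) k ik(2)])
          show "of_real R' ^ d \<noteq> complex_of_real (\<Prod>j<d. a j)" unfolding c0 using R0 by simp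
          fix \<zeta> assume "\<zeta> \<in> num_range d a"
          then have "Re \<zeta> \<le> R'" using R(3) R' complex_Re_le_cmod [of \<zeta>] by fastforce
          then show "0 \<le> Re ((of_real R' - \<zeta>) / 1)" by simp
        qed auto
        also have "1 * (2 * of_real R' ^ (d - 1) + (- 1) * (of_real R' ^ (d - 1 - k0) * of_real (cyc_prod d a i0 k0)) +
         cnj (- 1) * (of_real R' ^ (k0 - 1) * of_real (cyc_prod d a ((i0 + k0) mod d) (d - k0)))) / (of_real R' ^ d - of_real (\<Prod>j<d. a j))
           = complex_of_real ((2 * R' ^ (d - 1) - R' ^ (d - 1 - k0) * cyc_prod d a i0 k0) / R' ^ d)"
          unfolding p c0 by simp
        finally have "0 \<le> 2 * R' ^ (d - 1) - R' ^ (d - 1 - k0) * cyc_prod d a i0 k0"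
          unfolding Re_complex_of_real using zero_less_power [OF R0, of d] by (auto simp: zero_le_divide_iff)
        moreover have "R' ^ (d - 1) = R' ^ (d - 1 - k0) * R' ^ k0" using ik(2) by (simp flip: power_add)
        ultimately have "R' ^ (d - 1 - k0) * cyc_prod d a i0 k0 \<le> R' ^ (d - 1 - k0) * (2 * R' ^ k0)" by (simp add: ac_simps)
        then show ?thesis using R0 by simp
      qed
      have "((\<lambda>x. 2 * x ^ k0) \<longlongrightarrow> 2 * R ^ k0) (at_right R)" by (intro tendsto_intros)
      moreover have "eventually (\<lambda>x. cyc_prod d a i0 k0 \<le> 2 * x ^ k0) (at_right R)"
        using eventually_at_right_less [of R] by (rule eventually_mono) (use le in auto)
      ultimately have "cyc_prod d a i0 k0 \<le> 2 * R ^ k0"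
        by (intro tendsto_lowerbound [of "\<lambda>x. 2 * x ^ k0"]) auto
      then show ?thesis unfolding ik(3) \<kappa>_def using R(1) by (simp add: power_divide divide_le_eq)
    qed
  qed
qed

end

section \<open>Positive non-constant weights\<close>

context cyclic_conformal
begin

lemma F_rot_power: assumes w: "cmod w < 1" shows "F (unit_root d ^ j * w) = unit_root d ^ j * F w"
proof (induction j)
  case (Suc j)
  have "F (unit_root d * (unit_root d ^ j * w)) = unit_root d * F (unit_root d ^ j * w)"
    using w by (intro F_rot) (simp add: norm_mult norm_power)
  then show ?case by (simp add: Suc.IH mult.assoc)
qed simp

lemma F_t: "F (of_real (t 1) * unit_root d ^ j) = of_real \<rho> * unit_root d ^ j"
  using F_rot_power [of "of_real (t 1)" j] \<kappa>(4,5) t(7) [of 1] by (simp add: mult.commute)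

text \<open>Composed with \<open>F\<close>, the polynomial becomes a function on the disc bounded by
  1, and evaluating this function at \<kappa> times the shift gives back the polynomial at the
  shift. As the function is no polynomial, its Taylor sections are used on a disc of radius
  \<open>r < 1\<close>, with \<kappa> enlarged to \<open>\<kappa> / r\<close>.\<close>

lemma general_shift_bound:
  assumes \<Lambda>: "\<And>i k. i < d \<Longrightarrow> k < d \<Longrightarrow> \<kappa> ^ k * cyc_prod d a i k \<le> \<Lambda>"
  shows "shift_bound d a \<Lambda>"
  unfolding shift_bound_def
proof (intro allI impI)
  fix m N C y z
  assume H: "\<forall>x\<in>num_range d a. opbound m (\<lambda>e c. \<Sum>n\<le>N. C n e c * x ^ n) 1"
  define Gf where "Gf e c w = (\<Sum>n\<le>N. C n e c * F w ^ n)" for e c w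
  have hG: "Gf e c holomorphic_on ball 0 1" for e c
    unfolding Gf_def using holF by (intro holomorphic_intros)
  define T where "T n e c = (deriv ^^ n) (Gf e c) 0 / fact n" for n e c
  define X where "X M = shift_form d m M (\<lambda>n e c. T n e c * of_real \<kappa> ^ n) (\<lambda>i. of_real (a i)) y z" for M
  have c\<rho>: "complex_of_real \<rho> ^ d = (\<Prod>l<d. complex_of_real (a l))" "complex_of_real \<rho> \<noteq> 0"
    using \<rho> by (simp_all flip: of_real_power of_real_prod)
  have \<Lambda>0: "\<Lambda> \<ge> 1" using \<Lambda> [of 0 0] d_positive by simp
  have T_sums: "(\<lambda>n. T n e c * w ^ n) sums Gf e c w" if "cmod w < 1" for e c w
    using holomorphic_power_series [OF hG, of w] that by (simp add: T_def)
  have Xlim: "X \<longlonglongrightarrow> shift_form d m N C (\<lambda>i. of_real (a i)) y z"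
  proof -
    \<comment> \<open>The eigenvalues of \<kappa> times the shift are
      \<open>t 1 * unit_root d ^ j\<close>, points of the open disc, where the Taylor series
      converges; \<open>F\<close> takes them back to the eigenvalues of the shift.\<close>
    have eig: "(\<lambda>M. \<Sum>n\<le>M. T n e c * of_real \<kappa> ^ n * (of_real \<rho> * unit_root d ^ j) ^ n) \<longlonglongrightarrow>
        (\<Sum>n\<le>N. C n e c * (of_real \<rho> * unit_root d ^ j) ^ n)" for e c j
    proof -
      have k\<rho>: "of_real \<kappa> * complex_of_real \<rho> = of_real (t 1)" using \<kappa>(3) by (simp flip: of_real_mult)
      have "(\<lambda>n. T n e c * (of_real (t 1) * unit_root d ^ j) ^ n) sums Gf e c (of_real (t 1) * unit_root d ^ j)"
        using \<kappa>(4,5) by (intro T_sums) (simp add: norm_mult norm_power)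
      then have "(\<lambda>n. T n e c * of_real \<kappa> ^ n * (of_real \<rho> * unit_root d ^ j) ^ n) sums Gf e c (of_real (t 1) * unit_root d ^ j)"
        by (simp add: k\<rho> [symmetric] power_mult_distrib mult.assoc)
      then show ?thesis unfolding sums_def_le Gf_def F_t .
    qed
    show ?thesis
      unfolding X_def shift_form_residue [OF d_positive c\<rho>]
      by (intro tendsto_intros eig)
  qed
  \<comment> \<open>One parameter serves twice: as the distance of \<open>r\<close> from 1 and as
    the tolerance for the Taylor sections. The condition \<open>t 1 < r\<close> keeps the full cycle
    of the enlarged weights below 1.\<close>
  have bound: "cmod (shift_form d m N C (\<lambda>i. of_real (a i)) y z)
      \<le> (1 + real m * real m * \<epsilon>) * (\<Lambda> / (1 - \<epsilon>) ^ d) * l2nn m d y * l2nn m d z"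
    if \<epsilon>: "0 < \<epsilon>" "\<epsilon> < 1 - t 1" for \<epsilon>
  proof -
    define r where "r = 1 - \<epsilon>"
    have r: "t 1 < r" "0 < r" "r < 1" using \<epsilon> \<kappa>(4) by (auto simp: r_def)
    have ev: "eventually (\<lambda>M. \<forall>w\<in>cball 0 r. cmod ((\<Sum>n\<le>M. T n e c * w ^ n) - Gf e c w) \<le> \<epsilon>) sequentially" for e c
    proof -
      define \<delta> where "\<delta> = (1 + r) / 2"
      have \<delta>: "r < \<delta>" "\<delta> < 1" "0 < \<delta>" using r by (auto simp: \<delta>_def)
      have cont: "continuous_on (cball 0 \<delta>) (Gf e c)"
        using holomorphic_on_imp_continuous_on [OF hG] by (rule continuous_on_subset) (use \<delta> in auto)
      then have "bounded (Gf e c ` cball 0 \<delta>)"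
        by (intro compact_imp_bounded compact_continuous_image) auto
      then obtain B where B: "\<And>x. x \<in> cball 0 \<delta> \<Longrightarrow> cmod (Gf e c x) \<le> B"
        unfolding bounded_iff by blast
      define \<theta> where "\<theta> = r / \<delta>"
      have \<theta>: "0 \<le> \<theta>" "\<theta> < 1" using r \<delta> by (auto simp: \<theta>_def)
      have le: "cmod ((\<Sum>n\<le>M. T n e c * w ^ n) - Gf e c w) \<le> B * \<theta> ^ Suc M / (1 - \<theta>)" if "w \<in> cball 0 r" for w M
      proof -
        have "cmod (Gf e c (0 + w) - (\<Sum>n<Suc M. (deriv ^^ n) (Gf e c) 0 / fact n * w ^ n)) \<le> B * \<theta> ^ Suc M / (1 - \<theta>)"
        proof (rule Taylor_remainder_le [OF _ cont \<delta>(3) _ \<theta>])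
          show "Gf e c holomorphic_on ball 0 \<delta>" using hG by (rule holomorphic_on_subset) (use \<delta> in auto)
          show "cmod w \<le> \<theta> * \<delta>" using that \<delta> by (simp add: \<theta>_def)
        qed (use B in auto)
        then show ?thesis by (simp add: T_def lessThan_Suc_atMost norm_minus_commute del: sum.lessThan_Suc)
      qed
      have "(\<lambda>M. B * \<theta> ^ Suc M / (1 - \<theta>)) \<longlonglongrightarrow> B * 0 / (1 - \<theta>)"
        using \<theta> by (intro tendsto_intros LIMSEQ_Suc [OF LIMSEQ_realpow_zero]) auto
      then have "eventually (\<lambda>M. B * \<theta> ^ Suc M / (1 - \<theta>) < \<epsilon>) sequentially"
        using \<epsilon> by (intro order_tendstoD) auto
      then show ?thesis
      proof (rule eventually_mono)
        fix M assume M: "B * \<theta> ^ Suc M / (1 - \<theta>) < \<epsilon>"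
        show "\<forall>w\<in>cball 0 r. cmod ((\<Sum>n\<le>M. T n e c * w ^ n) - Gf e c w) \<le> \<epsilon>"
          using le M by (meson less_imp_le order_trans)
      qed
    qed
    have "eventually (\<lambda>M. \<forall>e\<in>{..<m}. \<forall>c\<in>{..<m}. \<forall>w\<in>cball 0 r. cmod ((\<Sum>n\<le>M. T n e c * w ^ n) - Gf e c w) \<le> \<epsilon>) sequentially"
      by (rule eventually_ball_finite, simp, rule ballI, rule eventually_ball_finite, simp, rule ballI, rule ev)
    then have "eventually (\<lambda>M. cmod (X M) \<le> (1 + real m * real m * \<epsilon>) * (\<Lambda> / r ^ d) * l2nn m d y * l2nn m d z) sequentially"
    proof (rule eventually_mono)
      fix M assume M: "\<forall>e\<in>{..<m}. \<forall>c\<in>{..<m}. \<forall>w\<in>cball 0 r. cmod ((\<Sum>n\<le>M. T n e c * w ^ n) - Gf e c w) \<le> \<epsilon>"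
      have "cmod (shift_form d m M (\<lambda>n e c. (T n e c * of_real r ^ n) * of_real (\<kappa> / r) ^ n) (\<lambda>i. of_real (a i)) y z)
         \<le> (1 + real m * real m * \<epsilon>) * (\<Lambda> / r ^ d) * l2nn m d y * l2nn m d z"
      proof (rule shift_form_similar_contraction [OF d_positive a_nonneg])
        show "0 \<le> \<kappa> / r" using \<kappa> r by simp
        have "(\<kappa> / r) ^ d * (\<Prod>i<d. a i) = (t 1 / r) ^ d"
          unfolding \<rho>(2) [symmetric] power_mult_distrib [symmetric] \<kappa>(3) [symmetric] by simp
        also have "\<dots> \<le> 1" using r \<kappa>(4) by (intro power_le_one) auto
        finally show "(\<kappa> / r) ^ d * (\<Prod>i<d. a i) \<le> 1" .
        show "(\<kappa> / r) ^ k * cyc_prod d a i k \<le> \<Lambda> / r ^ d" if "i < d" "k < d" for i k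
        proof -
          have "(\<kappa> / r) ^ k * cyc_prod d a i k = (\<kappa> ^ k * cyc_prod d a i k) / r ^ k" by (simp add: power_divide)
          also have "\<dots> \<le> \<Lambda> / r ^ k" using \<Lambda> [OF that] r by (intro divide_right_mono) auto
          also have "\<dots> \<le> \<Lambda> / r ^ d" using that r \<Lambda>0 by (intro divide_left_mono power_decreasing) auto
          finally show ?thesis .
        qed
        show "0 \<le> 1 + real m * real m * \<epsilon>" using \<epsilon> by simp
        fix w :: complex assume w: "cmod w = 1"
        have rw: "of_real r * w \<in> cball 0 r" "cmod (of_real r * w) < 1" using w r by (auto simp: norm_mult)
        have "F (of_real r * w) \<in> num_range d a" using F_in [OF rw(2)] interior_subset by blast
        from H [rule_format, OF this] have "opbound m (\<lambda>e c. Gf e c (of_real r * w)) 1" by (simp add: Gf_def)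
        moreover have "cmod ((\<Sum>n\<le>M. T n e c * of_real r ^ n * w ^ n) - Gf e c (of_real r * w)) \<le> \<epsilon>" if "e < m" "c < m" for e c
          using M rw(1) that by (force simp: power_mult_distrib mult.assoc)
        ultimately show "opbound m (\<lambda>e c. \<Sum>n\<le>M. T n e c * of_real r ^ n * w ^ n) (1 + real m * real m * \<epsilon>)"
          using \<epsilon> by (intro opbound_perturb) auto
      qed
      moreover have "(T n e c * of_real r ^ n) * of_real (\<kappa> / r) ^ n = T n e c * of_real \<kappa> ^ n" for n e c
        using r by (simp add: power_divide)
      ultimately show "cmod (X M) \<le> (1 + real m * real m * \<epsilon>) * (\<Lambda> / r ^ d) * l2nn m d y * l2nn m d z"
        unfolding X_def by (simp only:)
    qed
    then show ?thesis unfolding r_def [symmetric]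
      using tendsto_norm [OF Xlim] by (intro tendsto_upperbound [of "\<lambda>M. cmod (X M)"]) auto
  qed
  define g where "g \<epsilon> = (1 + real m * real m * \<epsilon>) * (\<Lambda> / (1 - \<epsilon>) ^ d) * l2nn m d y * l2nn m d z" for \<epsilon> :: real
  have "(g \<longlongrightarrow> g 0) (at_right 0)" unfolding g_def by (intro tendsto_intros) auto
  moreover have "eventually (\<lambda>\<epsilon>. \<epsilon> \<in> {0<..<1 - t 1}) (at_right 0)"
    using \<kappa>(5) by (intro eventually_at_right_real) simp
  then have "eventually (\<lambda>\<epsilon>. cmod (shift_form d m N C (\<lambda>i. of_real (a i)) y z) \<le> g \<epsilon>) (at_right 0)"
    by (rule eventually_mono) (use bound in \<open>auto simp: g_def\<close>)
  ultimately have "cmod (shift_form d m N C (\<lambda>i. of_real (a i)) y z) \<le> g 0"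
    by (intro tendsto_lowerbound [of g]) auto
  then show "cmod (shift_form d m N C (\<lambda>i. of_real (a i)) y z) \<le> \<Lambda> * l2nn m d y * l2nn m d z"
    by (simp add: g_def)
qed

lemma \<phi>_dilation_approximable:
  assumes s: "0 \<le> s" "s < 1" shows "poly_approximable W (\<lambda>z. \<phi> (of_real s * z) ^ k)"
proof (rule poly_approximable_dilation [of "interior W" "(\<lambda>z. of_real s * z) ` W" _ s "\<lambda>z. \<phi> z ^ k"])
  show "compact ((\<lambda>z. complex_of_real s * z) ` W)"
    by (intro compact_continuous_image compact_num_range continuous_intros)
  show "(\<lambda>z. complex_of_real s * z) ` W \<subseteq> interior W"
    using shrink_interior [OF _ s] closure_subset by blast
  show "bounded W" using compact_num_range compact_imp_bounded by blast
  show "(\<lambda>z. \<phi> z ^ k) holomorphic_on interior W" using hol\<phi> by (intro holomorphic_intros)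
  fix s' z assume s': "0 \<le> s'" "s' \<le> s" "z \<in> W"
  show "of_real s' * z \<in> (\<lambda>z. complex_of_real s * z) ` W"
  proof (cases "s = 0")
    case True
    then show ?thesis using s' by auto
  next
    case False
    have "0 \<in> W" using zero_interior interior_subset by blast
    then have "(1 - s' / s) *\<^sub>R 0 + (s' / s) *\<^sub>R z \<in> W"
      using s' s False by (intro convexD [OF convex_num_range]) auto
    then have "of_real (s' / s) * z \<in> W" by (simp add: scaleR_conv_of_real)
    moreover have "of_real s' * z = of_real s * (of_real (s' / s) * z)" using False by simp
    ultimately show ?thesis by blast
  qed
qed (use s in auto)

text \<open>The candidate \<open>\<phi> z ^ k\<close> has values of modulus below 1 and takes the
  value \<open>t 1 ^ k\<close> at \<open>\<rho>\<close>. Dilation by \<open>s\<close> makes it a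
  uniform limit of polynomials on \<open>W\<close>; residue filtering over the eigenvalues then
  reproduces the wanted entry up to small errors.\<close>

lemma general_poly_attains:
  assumes i: "i < d" and k: "k < d" shows "poly_attains d a (\<kappa> ^ k * cyc_prod d a i k)"
  unfolding poly_attains_def
proof (intro allI impI)
  fix \<epsilon> :: real assume \<epsilon>: "\<epsilon> > 0"
  define Q where "Q = cyc_prod d a i k"
  have Q: "Q \<ge> 0" unfolding Q_def using cyc_prod_nonneg [of a] a_nonneg by simp
  \<comment> \<open>The lower bound that will result for the entry when both the approximation error
    and the loss \<open>1 - s\<close> are \<open>\<eta>\<close>.\<close>
  define g where "g \<eta> = Q / \<rho> ^ k * (t (1 - \<eta>) ^ k / (1 + \<eta>) - \<eta>)" for \<eta> :: real
  have "(t \<longlongrightarrow> t 1) (at 1 within {0..1})" using t_continuous by (auto simp: continuous_on_def)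
  then have "(t \<longlongrightarrow> t 1) (at_left 1)" by (simp add: at_within_Icc_at_left)
  moreover have "filterlim (\<lambda>\<eta>. 1 - \<eta>) (at_left 1) (at_right (0::real))"
    unfolding filterlim_at by (auto intro!: tendsto_eq_intros simp: eventually_at_right_less eventually_at_filter)
  ultimately have "((\<lambda>\<eta>. t (1 - \<eta>)) \<longlongrightarrow> t 1) (at_right 0)" by (rule filterlim_compose)
  then have "(g \<longlongrightarrow> Q / \<rho> ^ k * (t 1 ^ k / (1 + 0) - 0)) (at_right 0)"
    unfolding g_def using \<rho> by (intro tendsto_intros) auto
  moreover have "Q / \<rho> ^ k * (t 1 ^ k / (1 + 0) - 0) = \<kappa> ^ k * Q"
    by (simp add: \<kappa>_def power_divide)
  ultimately have "eventually (\<lambda>\<eta>. \<kappa> ^ k * Q - \<epsilon> < g \<eta>) (at_right 0)"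
    using \<epsilon> by (intro order_tendstoD(1)) auto
  moreover have "eventually (\<lambda>\<eta>. \<eta> \<in> {0<..<1}) (at_right (0::real))" by (rule eventually_at_right_real) simp
  ultimately have "eventually (\<lambda>\<eta>. \<kappa> ^ k * Q - \<epsilon> < g \<eta> \<and> \<eta> \<in> {0<..<1}) (at_right 0)" by (rule eventually_conj)
  then obtain \<eta> where \<eta>: "\<kappa> ^ k * Q - \<epsilon> < g \<eta>" "0 < \<eta>" "\<eta> < 1"
    by (metis (no_types, lifting) eventually_happens greaterThanLessThan_iff trivial_limit_at_right_real)
  define s where "s = 1 - \<eta>"
  have s: "0 \<le> s" "s < 1" "s \<le> 1" using \<eta> by (auto simp: s_def)
  obtain p0 where p0: "\<And>z. z \<in> W \<Longrightarrow> cmod (\<phi> (of_real s * z) ^ k - poly p0 z) < \<eta>"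
    using \<phi>_dilation_approximable [OF s(1,2), of k] \<eta>(2) unfolding poly_approximable_def by blast
  \<comment> \<open>An approximation within \<open>\<eta>\<close> has modulus at most
    \<open>1 + \<eta>\<close> on \<open>W\<close>; the division restores admissibility.\<close>
  define p where "p = Polynomial.smult (1 / of_real (1 + \<eta>)) p0"
  have p1: "cmod (poly p z) \<le> 1" if z: "z \<in> W" for z
  proof -
    have "of_real s * z \<in> interior W" using shrink_interior [OF _ s(1,2)] z closure_subset by blast
    then have "cmod (\<phi> (of_real s * z) ^ k) \<le> 1"
      using \<phi>_in by (simp add: norm_power power_le_one less_imp_le)
    moreover have "cmod (poly p0 z) \<le> cmod (\<phi> (of_real s * z) ^ k) + cmod (\<phi> (of_real s * z) ^ k - poly p0 z)"
      by (metis norm_minus_commute norm_triangle_sub)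
    ultimately have "cmod (poly p0 z) \<le> 1 + \<eta>" using p0 [OF z] by linarith
    then show ?thesis using \<eta> by (simp add: p_def norm_divide divide_le_eq norm_mult del: of_real_add)
  qed
  define A where "A = (\<Sum>n\<in>{n. n \<le> degree p \<and> n mod d = k}. coeff p n * cyc_prod d (\<lambda>i. complex_of_real (a i)) i n)"
  have c\<rho>: "complex_of_real \<rho> ^ d = (\<Prod>l<d. complex_of_real (a l))" "complex_of_real \<rho> \<noteq> 0"
    using \<rho> by (simp_all flip: of_real_power of_real_prod)
  \<comment> \<open>The deviation from the ideal values, whose dependence on \<open>j\<close> is a
    pure character and hence invisible after filtering the class \<open>k\<close>.\<close>
  define D where "D j = poly p (of_real \<rho> * unit_root d ^ j) - of_real (1 / (1 + \<eta>)) * (of_real (t s) * unit_root d ^ j) ^ k" for j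
  have \<rho>W: "of_real \<rho> * unit_root d ^ j \<in> W" for j
    using S_rot_power [OF \<rho>_interior, of j] interior_subset by (auto simp: mult.commute)
  have D: "cmod (D j) \<le> \<eta>" for j
  proof -
    have "\<phi> (of_real s * (of_real \<rho> * unit_root d ^ j)) = of_real (t s) * unit_root d ^ j"
      using \<phi>_rot_power [OF s\<rho>_interior [OF s(1,3)], of j] t(3) [OF s(1,3)] by (simp add: ac_simps)
    then have "cmod ((of_real (t s) * unit_root d ^ j) ^ k - poly p0 (of_real \<rho> * unit_root d ^ j)) < \<eta>"
      using p0 [OF \<rho>W [of j]] by simp
    moreover have "D j = - (1 / of_real (1 + \<eta>)) * ((of_real (t s) * unit_root d ^ j) ^ k - poly p0 (of_real \<rho> * unit_root d ^ j))"
      by (simp add: D_def p_def algebra_simps)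
    ultimately have "cmod (D j) \<le> 1 / (1 + \<eta>) * \<eta>"
      using \<eta> by (simp add: norm_mult norm_divide divide_right_mono less_imp_le del: of_real_add)
    also have "\<dots> \<le> 1 * \<eta>" using \<eta> by (intro mult_right_mono) auto
    finally show ?thesis by simp
  qed
  have "A = of_real (Q / \<rho> ^ k) * ((1 / of_nat d) * (\<Sum>j<d. cnj ((unit_root d ^ j) ^ k) * poly p (of_real \<rho> * unit_root d ^ j)))"
    unfolding A_def sum_residue_class [OF d_positive k c\<rho>] unfolding cyc_prod_of_real poly_altdef Q_def by (simp add: mult.assoc)
  also have "(\<Sum>j<d. cnj ((unit_root d ^ j) ^ k) * poly p (of_real \<rho> * unit_root d ^ j)) =
      (\<Sum>j<d. of_real (t s ^ k / (1 + \<eta>)) + cnj ((unit_root d ^ j) ^ k) * D j)"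
  proof (rule sum.cong [OF refl])
    fix j
    have "cmod ((unit_root d ^ j) ^ k) = 1" by (simp add: norm_power)
    then have 1: "cnj ((unit_root d ^ j) ^ k) * (unit_root d ^ j) ^ k = 1"
      using complex_norm_square [of "(unit_root d ^ j) ^ k"] by (simp add: mult.commute)
    have "cnj ((unit_root d ^ j) ^ k) * (of_real (1 / (1 + \<eta>)) * (of_real (t s) * unit_root d ^ j) ^ k) =
        of_real (t s ^ k / (1 + \<eta>)) * (cnj ((unit_root d ^ j) ^ k) * (unit_root d ^ j) ^ k)"
      by (simp add: power_mult_distrib)
    then have 2: "cnj ((unit_root d ^ j) ^ k) * (of_real (1 / (1 + \<eta>)) * (of_real (t s) * unit_root d ^ j) ^ k) = of_real (t s ^ k / (1 + \<eta>))"
      unfolding 1 by simp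
    show "cnj ((unit_root d ^ j) ^ k) * poly p (of_real \<rho> * unit_root d ^ j) = of_real (t s ^ k / (1 + \<eta>)) + cnj ((unit_root d ^ j) ^ k) * D j"
      unfolding D_def right_diff_distrib 2 by (simp only: add_diff_cancel_left' add_diff_eq)
  qed
  also have "(1 / of_nat d) * \<dots> = of_real (t s ^ k / (1 + \<eta>)) + (1 / of_nat d) * (\<Sum>j<d. cnj ((unit_root d ^ j) ^ k) * D j)"
    using d_positive by (simp add: sum.distrib distrib_left del: of_real_divide of_real_power)
  finally have A: "A = of_real (Q / \<rho> ^ k) * (of_real (t s ^ k / (1 + \<eta>)) + (1 / of_nat d) * (\<Sum>j<d. cnj ((unit_root d ^ j) ^ k) * D j))" .
  have "cmod (\<Sum>j<d. cnj ((unit_root d ^ j) ^ k) * D j) \<le> (\<Sum>j<d. \<eta>)"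
    using D by (intro sum_norm_le) (simp add: norm_mult norm_power)
  then have small: "cmod ((1 / of_nat d) * (\<Sum>j<d. cnj ((unit_root d ^ j) ^ k) * D j)) \<le> \<eta>"
    using d_positive by (simp add: norm_mult norm_divide divide_le_eq mult.commute)
  have "t s ^ k / (1 + \<eta>) - \<eta> \<le> cmod (of_real (t s ^ k / (1 + \<eta>)) + (1 / of_nat d) * (\<Sum>j<d. cnj ((unit_root d ^ j) ^ k) * D j))"
  proof -
    have "cmod (of_real (t s ^ k / (1 + \<eta>))) = t s ^ k / (1 + \<eta>)"
      unfolding norm_of_real using t(1) [OF s(1,3)] \<eta> by simp
    then show ?thesis using small norm_diff_ineq [of "of_real (t s ^ k / (1 + \<eta>))"] by (smt (verit))
  qed
  then have "Q / \<rho> ^ k * (t s ^ k / (1 + \<eta>) - \<eta>) \<le> Q / \<rho> ^ k * cmod (of_real (t s ^ k / (1 + \<eta>)) + (1 / of_nat d) * (\<Sum>j<d. cnj ((unit_root d ^ j) ^ k) * D j))"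
    using Q \<rho> by (intro mult_left_mono) auto
  also have "\<dots> = cmod A" unfolding A norm_mult norm_of_real using Q \<rho> by simp
  finally have "g \<eta> \<le> cmod A" by (simp add: g_def s_def)
  then have "\<kappa> ^ k * Q - \<epsilon> \<le> cmod A" using \<eta> by simp
  then show "\<exists>p i' k'. i' < d \<and> k' < d \<and> (\<forall>x\<in>num_range d a. cmod (poly p x) \<le> 1) \<and>
     \<kappa> ^ k * cyc_prod d a i k - \<epsilon> \<le> cmod (\<Sum>n\<in>{n. n \<le> degree p \<and> n mod d = k'}. coeff p n * cyc_prod d (\<lambda>i. of_real (a i)) i' n)"
    using i k p1 unfolding A_def Q_def by blast
qed

lemma positive_weight_case:
  obtains \<Lambda> where "shift_bound d a \<Lambda>" "poly_attains d a \<Lambda>" "\<Lambda> < 2"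
proof -
  define \<Lambda> where "\<Lambda> = Max ((\<lambda>(i, k). \<kappa> ^ k * cyc_prod d a i k) ` ({..<d} \<times> {..<d}))"
  have ne: "(\<lambda>(i, k). \<kappa> ^ k * cyc_prod d a i k) ` ({..<d} \<times> {..<d}) \<noteq> {}" using d_positive by auto
  have \<Lambda>: "\<kappa> ^ k * cyc_prod d a i k \<le> \<Lambda>" if "i < d" "k < d" for i k
    unfolding \<Lambda>_def using that by (intro Max_ge) auto
  obtain i k where ik: "i < d" "k < d" "\<Lambda> = \<kappa> ^ k * cyc_prod d a i k"
    using Max_in [OF _ ne] unfolding \<Lambda>_def by auto
  show ?thesis
  proof
    show "shift_bound d a \<Lambda>" by (rule general_shift_bound [OF \<Lambda>])
    show "poly_attains d a \<Lambda>" unfolding ik(3) by (rule general_poly_attains [OF ik(1,2)])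
    show "\<Lambda> < 2" unfolding ik(3) by (rule power_bound [OF ik(1,2)])
  qed
qed

end

theorem cyclic_weights_main:
  assumes d: "d \<ge> 1" and a: "\<And>i. 0 \<le> a i"
  obtains \<Lambda> where "shift_bound d a \<Lambda>" "poly_attains d a \<Lambda>" "\<Lambda> \<le> 2" "(\<Prod>i<d. a i) \<noteq> 0 \<Longrightarrow> \<Lambda> < 2"
proof (cases "\<forall>i<d. a i = a 0")
  case True
  then have eq: "\<And>i. i < d \<Longrightarrow> a i = a 0" by blast
  have "0 < d" using d by simp
  from constant_weights [OF this eq] show ?thesis by (rule that) simp_all
next
  case False
  then have "d \<noteq> 1" by auto
  then have "d \<ge> 2" using d by simp
  with False a interpret cyclic_weights d a by unfold_locales blast+
  show ?thesis
  proof (cases "(\<Prod>i<d. a i) = 0")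
    case True
    then obtain j where "j < d" "a j = 0" by auto
    then obtain \<Lambda> where "shift_bound d a \<Lambda>" "poly_attains d a \<Lambda>" "\<Lambda> \<le> 2"
      by (rule zero_weight_case)
    then show ?thesis by (rule that) (use True in simp)
  next
    case False
    define \<rho> where "\<rho> = root d (\<Prod>i<d. a i)"
    have "(\<Prod>i<d. a i) > 0" using False a by (simp add: less_le prod_nonneg)
    then have \<rho>: "\<rho> > 0" "\<rho> ^ d = (\<Prod>i<d. a i)" using d by (auto simp: \<rho>_def)
    have bW: "bounded (interior W)" using compact_num_range compact_imp_bounded bounded_subset interior_subset by blast
    then have ne: "interior W \<noteq> UNIV" using not_bounded_UNIV by metis
    obtain F \<phi> c where F: "F holomorphic_on ball 0 1" "\<phi> holomorphic_on interior W"
      "\<And>w. cmod w < 1 \<Longrightarrow> F w \<in> interior W" "\<And>z. z \<in> interior W \<Longrightarrow> cmod (\<phi> z) < 1"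
      "\<And>w. cmod w < 1 \<Longrightarrow> \<phi> (F w) = w" "\<And>z. z \<in> interior W \<Longrightarrow> F (\<phi> z) = z"
      "F 0 = 0" "deriv F 0 = of_real c" "c > 0"
      by (rule normalised_Riemann_map [OF open_interior convex_interior [OF convex_num_range] ne zero_interior]) blast
    \<comment> \<open>The symmetry is known for \<open>W\<close>: the interior point is moved
      outwards within \<open>W\<close>, rotated, and shrunk back.\<close>
    have rot: "unit_root d * z \<in> interior W" if z: "z \<in> interior W" for z
    proof -
      obtain \<epsilon> where e: "\<epsilon> > 0" "of_real (1 + \<epsilon>) * z \<in> W" using interior_expand [OF z] by blast
      have "of_real (1 / (1 + \<epsilon>)) * (unit_root d * (of_real (1 + \<epsilon>) * z)) \<in> interior W"
        using num_range_unit_root [OF d_pos e(2)] e(1) closure_subset by (intro shrink_interior) auto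
      moreover have "of_real (1 / (1 + \<epsilon>)) * (unit_root d * (of_real (1 + \<epsilon>) * z)) = unit_root d * z"
      proof -
        have "of_real (1 / (1 + \<epsilon>)) * complex_of_real (1 + \<epsilon>) = 1"
        proof -
          have "1 / (1 + \<epsilon>) * (1 + \<epsilon>) = 1" using e(1) by simp
          then show ?thesis by (metis of_real_1 of_real_mult)
        qed
        then show ?thesis by (metis mult.left_commute mult.assoc mult_1)
      qed
      ultimately show ?thesis by simp
    qed
    have cj: "cnj z \<in> interior W" if z: "z \<in> interior W" for z
    proof -
      obtain \<epsilon> where e: "\<epsilon> > 0" "of_real (1 + \<epsilon>) * z \<in> W" using interior_expand [OF z] by blast
      have "of_real (1 / (1 + \<epsilon>)) * cnj (of_real (1 + \<epsilon>) * z) \<in> interior W"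
        using num_range_cnj [OF e(2)] e(1) closure_subset by (intro shrink_interior) auto
      moreover have "of_real (1 / (1 + \<epsilon>)) * cnj (of_real (1 + \<epsilon>) * z) = cnj z"
      proof -
        have "of_real (1 / (1 + \<epsilon>)) * complex_of_real (1 + \<epsilon>) = 1"
        proof -
          have "1 / (1 + \<epsilon>) * (1 + \<epsilon>) = 1" using e(1) by simp
          then show ?thesis by (metis of_real_1 of_real_mult)
        qed
        then show ?thesis by (metis complex_cnj_mult complex_cnj_complex_of_real mult.assoc mult_1)
      qed
      ultimately show ?thesis by simp
    qed
    interpret cyclic_conformal d a F \<phi> c \<rho>
      by unfold_locales (use \<open>d \<ge> 2\<close> F bW \<rho> rot cj zero_interior radial_interior in \<open>auto simp: convex_interior convex_num_range\<close>)
    obtain \<Lambda> where \<Lambda>: "shift_bound d a \<Lambda>" "poly_attains d a \<Lambda>" "\<Lambda> < 2"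
      by (rule positive_weight_case)
    show ?thesis by (rule that [OF \<Lambda>(1,2)]) (use \<Lambda>(3) in auto)
  qed
qed

section \<open>Matrices\<close>

lemma vnorm_eq: "vnorm x = L2_set (\<lambda>i. cmod (x $ i)) {..<dim_vec x}"
  by (simp add: vnorm_def L2_set_def)

lemma vnorm_nonneg [simp]: "0 \<le> vnorm x"
  by (simp add: vnorm_eq)

lemma vnorm_smult: "vnorm (k \<cdot>\<^sub>v x) = cmod k * vnorm x"
  by (simp add: vnorm_def norm_mult power_mult_distrib real_sqrt_mult flip: sum_distrib_left)

lemma mult_mat_vec_index:
  "i < dim_row A \<Longrightarrow> dim_vec x = dim_col A \<Longrightarrow> (A *\<^sub>v x) $ i = (\<Sum>j<dim_col A. A $$ (i, j) * x $ j)"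
  by (simp add: scalar_prod_def lessThan_atLeast0)

text \<open>A crude finite bound. It shows that the supremum defining \<open>op_norm\<close> is over
  a bounded set, without which that real number would carry no information; it also covers the zero
  vector.\<close>

lemma vnorm_mult_le:
  assumes "dim_vec x = dim_col A"
  shows "vnorm (A *\<^sub>v x) \<le> (\<Sum>i<dim_row A. L2_set (\<lambda>j. cmod (A $$ (i, j))) {..<dim_col A}) * vnorm x"
proof -
  have "vnorm (A *\<^sub>v x) \<le> (\<Sum>i<dim_row A. \<bar>cmod ((A *\<^sub>v x) $ i)\<bar>)"
    unfolding vnorm_eq dim_mult_mat_vec by (rule L2_set_le_sum_abs)
  also have "\<dots> \<le> (\<Sum>i<dim_row A. L2_set (\<lambda>j. cmod (A $$ (i, j))) {..<dim_col A} * vnorm x)"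
  proof (rule sum_mono)
    fix i assume "i \<in> {..<dim_row A}"
    then have "\<bar>cmod ((A *\<^sub>v x) $ i)\<bar> = cmod (\<Sum>j<dim_col A. A $$ (i, j) * x $ j)"
      using assms by (subst mult_mat_vec_index) auto
    also have "\<dots> \<le> (\<Sum>j<dim_col A. \<bar>cmod (A $$ (i, j))\<bar> * \<bar>cmod (x $ j)\<bar>)"
      by (rule sum_norm_le) (simp add: norm_mult)
    also have "\<dots> \<le> L2_set (\<lambda>j. cmod (A $$ (i, j))) {..<dim_col A} * vnorm x"
      unfolding vnorm_eq assms by (rule L2_set_mult_ineq)
    finally show "\<bar>cmod ((A *\<^sub>v x) $ i)\<bar> \<le> L2_set (\<lambda>j. cmod (A $$ (i, j))) {..<dim_col A} * vnorm x" .
  qed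
  finally show ?thesis by (simp add: sum_distrib_right)
qed

lemma bdd_above_op_norm: "bdd_above ((\<lambda>x. vnorm (A *\<^sub>v x)) ` {x \<in> carrier_vec (dim_col A). vnorm x = 1})"
  unfolding bdd_above_def
proof (intro exI ballI)
  fix y assume "y \<in> (\<lambda>x. vnorm (A *\<^sub>v x)) ` {x \<in> carrier_vec (dim_col A). vnorm x = 1}"
  then obtain x where "y = vnorm (A *\<^sub>v x)" "dim_vec x = dim_col A" "vnorm x = 1" by auto
  then show "y \<le> (\<Sum>i<dim_row A. L2_set (\<lambda>j. cmod (A $$ (i, j))) {..<dim_col A})"
    using vnorm_mult_le [of x A] by simp
qed

lemma op_norm_ge: "x \<in> carrier_vec (dim_col A) \<Longrightarrow> vnorm x = 1 \<Longrightarrow> vnorm (A *\<^sub>v x) \<le> op_norm A"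
  unfolding op_norm_def by (rule cSUP_upper [OF _ bdd_above_op_norm]) simp

lemma vnorm_unit_vec: "i < n \<Longrightarrow> vnorm (unit_vec n i) = 1"
  by (simp add: vnorm_def unit_vec_def if_distrib [of cmod] if_distrib [of "\<lambda>x. x ^ 2"] cong: if_cong)

lemma op_norm_le:
  assumes "dim_col A > 0" "\<And>x. x \<in> carrier_vec (dim_col A) \<Longrightarrow> vnorm x = 1 \<Longrightarrow> vnorm (A *\<^sub>v x) \<le> K"
  shows "op_norm A \<le> K"
  unfolding op_norm_def
proof (rule cSUP_least)
  show "{x \<in> carrier_vec (dim_col A). vnorm x = 1} \<noteq> {}"
    using vnorm_unit_vec [OF assms(1)] unit_vec_carrier by blast
qed (use assms in auto)

lemma vnorm_mult_op_norm_le: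
  assumes x: "x \<in> carrier_vec (dim_col A)" shows "vnorm (A *\<^sub>v x) \<le> op_norm A * vnorm x"
proof (cases "vnorm x = 0")
  case True
  then show ?thesis using vnorm_mult_le [of x A] x by simp
next
  case False
  define k where "k = complex_of_real (1 / vnorm x)"
  have k: "cmod k = 1 / vnorm x" unfolding k_def norm_of_real by simp
  have "vnorm (k \<cdot>\<^sub>v x) = 1" using False by (simp add: vnorm_smult k)
  then have "vnorm (A *\<^sub>v (k \<cdot>\<^sub>v x)) \<le> op_norm A" using x by (intro op_norm_ge) auto
  moreover have "A *\<^sub>v (k \<cdot>\<^sub>v x) = k \<cdot>\<^sub>v (A *\<^sub>v x)"
    using x by (intro mult_mat_vec [of _ "dim_row A" "dim_col A"]) auto
  ultimately have "1 / vnorm x * vnorm (A *\<^sub>v x) \<le> op_norm A" by (simp only: vnorm_smult k)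
  moreover have "vnorm x > 0" using False vnorm_nonneg [of x] by linarith
  ultimately show ?thesis by (simp add: field_simps)
qed

lemma entry_le_op_norm:
  assumes "i < dim_row A" "j < dim_col A" shows "cmod (A $$ (i, j)) \<le> op_norm A"
proof -
  have e: "(A *\<^sub>v unit_vec (dim_col A) j) $ i = A $$ (i, j)"
    using assms by (subst mult_mat_vec_index) (auto simp: unit_vec_def if_distrib cong: if_cong)
  have "cmod ((A *\<^sub>v unit_vec (dim_col A) j) $ i) \<le> vnorm (A *\<^sub>v unit_vec (dim_col A) j)"
    unfolding vnorm_eq using member_le_L2_set [of "{..<dim_row A}" i "\<lambda>i. cmod ((A *\<^sub>v unit_vec (dim_col A) j) $ i)"] assms by simp
  also have "\<dots> \<le> op_norm A" using assms by (intro op_norm_ge vnorm_unit_vec) auto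
  finally show ?thesis unfolding e .
qed

lemma opbound_of_op_norm:
  assumes A: "dim_row A = m" "dim_col A = m" "op_norm A \<le> K"
  shows "opbound m (\<lambda>e c. A $$ (e, c)) K"
  unfolding opbound_def
proof (intro allI)
  fix \<xi> \<eta> :: "nat \<Rightarrow> complex"
  define x where "x = vec m \<eta>"
  have x: "x \<in> carrier_vec (dim_col A)" by (simp add: x_def A)
  have nx: "vnorm x = l2n m \<eta>" unfolding vnorm_eq l2n_def by (intro L2_set_cong) (auto simp: x_def)
  have "(\<Sum>e<m. \<Sum>c<m. A $$ (e, c) * \<eta> c * cnj (\<xi> e)) = (\<Sum>e<m. (A *\<^sub>v x) $ e * cnj (\<xi> e))"
  proof (rule sum.cong [OF refl])
    fix e assume "e \<in> {..<m}"
    then have "(A *\<^sub>v x) $ e = (\<Sum>c<m. A $$ (e, c) * \<eta> c)"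
      using A by (subst mult_mat_vec_index) (auto simp: x_def)
    then show "(\<Sum>c<m. A $$ (e, c) * \<eta> c * cnj (\<xi> e)) = (A *\<^sub>v x) $ e * cnj (\<xi> e)"
      by (simp only: sum_distrib_right)
  qed
  also have "cmod \<dots> \<le> (\<Sum>e<m. \<bar>cmod ((A *\<^sub>v x) $ e)\<bar> * \<bar>cmod (\<xi> e)\<bar>)"
    by (rule sum_norm_le) (simp add: norm_mult)
  also have "\<dots> \<le> vnorm (A *\<^sub>v x) * l2n m \<xi>"
    unfolding vnorm_eq l2n_def using A by (simp only: dim_mult_mat_vec) (rule L2_set_mult_ineq)
  also have "\<dots> \<le> (K * l2n m \<eta>) * l2n m \<xi>"
  proof (rule mult_right_mono)
    have "vnorm (A *\<^sub>v x) \<le> op_norm A * vnorm x" by (rule vnorm_mult_op_norm_le [OF x])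
    also have "\<dots> \<le> K * vnorm x" using A(3) by (rule mult_right_mono) simp
    finally show "vnorm (A *\<^sub>v x) \<le> K * l2n m \<eta>" unfolding nx .
  qed simp
  finally show "cmod (\<Sum>e<m. \<Sum>c<m. A $$ (e, c) * \<eta> c * cnj (\<xi> e)) \<le> K * l2n m \<xi> * l2n m \<eta>"
    by (simp add: ac_simps)
qed

text \<open>\<open>c * d + j\<close> is the index convention of \<open>kronecker\<close>: the block
  comes first, then the position within the block.\<close>

lemma sum_product_index: "(\<Sum>q<m * d. f q) = (\<Sum>c<m. \<Sum>j<d. f (c * d + j))" for f :: "nat \<Rightarrow> 'a::comm_monoid_add"
proof -
  have "(\<Sum>q<m * d. f q) = (\<Sum>c<m. sum f {c * d..<c * d + d})" by (rule sum.nat_group [symmetric])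
  also have "\<dots> = (\<Sum>c<m. \<Sum>j<d. f (c * d + j))"
  proof (rule sum.cong [OF refl])
    fix c show "sum f {c * d..<c * d + d} = (\<Sum>j<d. f (c * d + j))"
      by (rule sum.reindex_bij_witness [of _ "\<lambda>j. c * d + j" "\<lambda>q. q - c * d"]) auto
  qed
  finally show ?thesis .
qed

section \<open>The given matrix and its weights\<close>

locale cyclic_matrix =
  fixes d :: nat and \<alpha> :: "nat \<Rightarrow> complex" and M :: "complex mat"
  assumes d: "d \<ge> 1" and M_def: "M = cyclic_perm_mat d * mat_diag d (\<lambda>i. \<alpha> (i + 1))"
begin

lemma d_pos: "d > 0" using d by simp

text \<open>The diagonal factor stands on the right and scales columns, and the non-zero entry of
  row \<open>i\<close> is in column \<open>(i + 1) mod d\<close>. The second \<open>+ 1\<close>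
  arises because \<alpha> is numbered from 1.\<close>

definition w where "w i = \<alpha> ((i + 1) mod d + 1)"

lemma dim_M [simp]: "dim_row M = d" "dim_col M = d" "M \<in> carrier_mat d d"
  by (auto simp: M_def cyclic_perm_mat_def mat_diag_def)

lemma M_index: assumes "i < d" "j < d" shows "M $$ (i, j) = (if j = (i + 1) mod d then w i else 0)"
proof -
  have "cyclic_perm_mat d \<in> carrier_mat d d" by (simp add: cyclic_perm_mat_def)
  then have "M $$ (i, j) = cyclic_perm_mat d $$ (i, j) * \<alpha> (j + 1)"
    unfolding M_def using assms by (simp add: mat_diag_mult_right)
  moreover have "(i = d - 1 \<and> j = 0 \<or> j = i + 1) \<longleftrightarrow> j = (i + 1) mod d"
    using assms by (cases "i + 1 = d") (auto simp: mod_if)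
  ultimately show ?thesis using assms by (simp add: cyclic_perm_mat_def w_def)
qed

lemma M_power_index:
  assumes "i < d" "j < d" shows "(M ^\<^sub>m n) $$ (i, j) = (if j = (i + n) mod d then cyc_prod d w i n else 0)"
  using assms
proof (induction n arbitrary: j)
  case 0
  then show ?case by auto
next
  case (Suc n)
  have l: "(i + n) mod d < d" using d_pos by simp
  have "(M ^\<^sub>m Suc n) $$ (i, j) = (\<Sum>l<d. (M ^\<^sub>m n) $$ (i, l) * M $$ (l, j))"
    using Suc.prems by (simp add: scalar_prod_def lessThan_atLeast0)
  also have "\<dots> = (\<Sum>l<d. if l = (i + n) mod d then cyc_prod d w i n * M $$ (l, j) else 0)"
    using Suc.IH Suc.prems by (intro sum.cong) auto
  also have "\<dots> = cyc_prod d w i n * M $$ ((i + n) mod d, j)" using l by simp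
  also have "\<dots> = (if j = (i + Suc n) mod d then cyc_prod d w i (Suc n) else 0)"
    using M_index [OF l Suc.prems(2)] by (simp add: cyc_prod_Suc_right mod_Suc_eq)
  finally show ?case .
qed

definition a where "a i = cmod (w i)"
definition ph where "ph i = cis (Arg (w i))"
text \<open>The product of the phases around the cycle is invariant under diagonal unitaries and
  cannot be removed by them. Its \<open>d\<close>-th root \<open>u\<close> is split off as a
  rotation; \<open>g\<close> below absorbs the other phases.\<close>

definition u where "u = cis (Arg (\<Prod>l<d. ph l) / d)"
definition g where "g i = (\<Prod>l<i. ph l) / u ^ i"

lemma norm_u [simp]: "cmod u = 1" by (simp add: u_def)

lemma u_nonzero [simp]: "u \<noteq> 0" by (simp add: u_def)

lemma norm_ph: "cmod (\<Prod>l<n. ph l) = 1"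
  unfolding prod_norm [symmetric] by (rule prod.neutral) (simp add: ph_def)

lemma norm_g: "cmod (g i) = 1"
  unfolding g_def norm_divide norm_ph by (simp add: norm_power)

lemma g_nonzero [simp]: "g i \<noteq> 0" using norm_g [of i] by auto

lemma g_cnj: "1 / g i = cnj (g i)"
  using complex_norm_square [of "g i"] norm_g [of i] by (simp add: field_simps)

lemma w_gauge: assumes i: "i < d" shows "w i = u * of_real (a i) * g ((i + 1) mod d) / g i"
proof -
  have wi: "w i = of_real (a i) * ph i" using rcis_cmod_Arg [of "w i"] by (simp add: rcis_def a_def ph_def)
  have "g d = 1"
  proof -
    have "u ^ d = cis (Arg (\<Prod>l<d. ph l))" unfolding u_def Complex.DeMoivre using d_pos by simp
    also have "\<dots> = (\<Prod>l<d. ph l)"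
      using rcis_cmod_Arg [of "\<Prod>l<d. ph l"] unfolding rcis_def norm_ph by simp
    finally have "(\<Prod>l<d. ph l) = u ^ d" ..
    then show ?thesis by (simp add: g_def)
  qed
  moreover have "g 0 = 1" by (simp add: g_def)
  ultimately have "g ((i + 1) mod d) = g (Suc i)" using i by (cases "Suc i = d") auto
  moreover have "g (Suc i) = g i * ph i / u" by (simp add: g_def)
  ultimately show ?thesis using wi by simp
qed

lemma w_power_gauge: "cyc_prod d w i n = u ^ n * cyc_prod d (\<lambda>i. of_real (a i)) i n * g ((i + n) mod d) / g (i mod d)"
  by (rule cyc_prod_gauge [of d w u _ g, OF d_pos w_gauge]) auto

lemma M_form:
  assumes x: "x \<in> carrier_vec d" shows "(M *\<^sub>v x) \<bullet>c x = u * cform d a (\<lambda>i. g i * x $ i)"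
proof -
  have Mx: "(M *\<^sub>v x) $ i = w i * x $ ((i + 1) mod d)" if i: "i < d" for i
  proof -
    have "(M *\<^sub>v x) $ i = (\<Sum>j<d. M $$ (i, j) * x $ j)"
      using i x by (subst mult_mat_vec_index) auto
    also have "\<dots> = (\<Sum>j<d. if j = (i + 1) mod d then w i * x $ j else 0)"
      by (intro sum.cong refl) (auto simp: M_index [OF i])
    finally show ?thesis using d_pos by simp
  qed
  have "(M *\<^sub>v x) \<bullet>c x = (\<Sum>i<d. (M *\<^sub>v x) $ i * cnj (x $ i))"
    using x by (simp add: scalar_prod_def lessThan_atLeast0)
  also have "\<dots> = (\<Sum>i<d. u * (of_real (a i) * (g ((i + 1) mod d) * x $ ((i + 1) mod d)) * cnj (g i * x $ i)))"
  proof (rule sum.cong [OF refl])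
    fix i assume "i \<in> {..<d}"
    then have i: "i < d" by simp
    have "(M *\<^sub>v x) $ i * cnj (x $ i) = u * of_real (a i) * g ((i + 1) mod d) * (1 / g i) * x $ ((i + 1) mod d) * cnj (x $ i)"
      unfolding Mx [OF i] w_gauge [OF i] by simp
    then show "(M *\<^sub>v x) $ i * cnj (x $ i) = u * (of_real (a i) * (g ((i + 1) mod d) * x $ ((i + 1) mod d)) * cnj (g i * x $ i))"
      unfolding g_cnj by (simp add: ac_simps)
  qed
  finally show ?thesis by (simp add: cform_def csesq_def sum_distrib_left)
qed

lemma numerical_range_eq: "numerical_range M = (\<lambda>z. u * z) ` num_range d a"
proof (intro equalityI subsetI)
  fix z assume "z \<in> numerical_range M"
  then obtain x where x: "z = (M *\<^sub>v x) \<bullet>c x" "x \<in> carrier_vec d" "vnorm x = 1"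
    unfolding numerical_range_def by auto
  have "nsq d (\<lambda>i. g i * x $ i) = 1"
    using x(2,3) norm_g by (simp add: nsq_def vnorm_def norm_mult)
  then show "z \<in> (\<lambda>z. u * z) ` num_range d a"
    unfolding x(1) M_form [OF x(2)] using cform_mem_num_range by blast
next
  fix z assume "z \<in> (\<lambda>z. u * z) ` num_range d a"
  then obtain y where y: "z = u * cform d a y" "nsq d y = 1" by (auto simp: num_range_def)
  define x where "x = vec d (\<lambda>i. y i / g i)"
  have x: "x \<in> carrier_vec d" by (simp add: x_def)
  have "cform d a (\<lambda>i. g i * x $ i) = cform d a y"
    unfolding cform_def csesq_def using d_pos by (intro sum.cong refl) (simp add: x_def)
  then have "z = (M *\<^sub>v x) \<bullet>c x" unfolding M_form [OF x] y(1) by simp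
  moreover have "vnorm x = 1"
    using y(2) norm_g by (simp add: vnorm_def x_def nsq_def norm_divide)
  ultimately show "z \<in> numerical_range M" unfolding numerical_range_def using x by auto
qed

text \<open>The form is tested on \<open>v\<close> and its own image \<open>A v\<close>, which gives
  \<open>\<parallel>A v\<parallel>\<^sup>2 \<le> \<Lambda> * \<parallel>A v\<parallel>\<close>. The
  phases move into the vectors through \<open>g\<close> and into the coefficients through
  \<open>u\<close>, so the hypothesis is used on the rotated range.\<close>

lemma op_norm_mpoly_at_mat_le:
  assumes sb: "shift_bound d a \<Lambda>" and m: "m \<ge> 1" and C: "\<And>j. j \<le> N \<Longrightarrow> C j \<in> carrier_mat m m"
    and H: "\<And>z. z \<in> numerical_range M \<Longrightarrow> op_norm (mpoly_at m N C z) \<le> 1"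
  shows "op_norm (mpoly_at_mat m N C M) \<le> \<Lambda>"
proof (rule op_norm_le)
  define A where "A = mpoly_at_mat m N C M"
  have dA: "dim_row A = m * d" "dim_col A = m * d" by (auto simp: A_def mpoly_at_mat_def mat_sum_def)
  show "dim_col (mpoly_at_mat m N C M) > 0" using dA m d_pos by (simp add: A_def)
  fix v assume "v \<in> carrier_vec (dim_col (mpoly_at_mat m N C M))" and v1: "vnorm v = 1"
  then have v: "dim_vec v = m * d" using dA by (simp add: A_def)
  define y where "y c i = v $ (c * d + i)" for c i
  define z where "z e i = (A *\<^sub>v v) $ (e * d + i)" for e i
  have idx: "e * d + i < m * d" if "e < m" "i < d" for e i
  proof -
    have "e * d + i < (e + 1) * d" using that by simp
    also have "\<dots> \<le> m * d" using that by (intro mult_right_mono) auto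
    finally show ?thesis .
  qed
  have A_index: "A $$ (e * d + i, c * d + j) = (\<Sum>n\<le>N. C n $$ (e, c) * (M ^\<^sub>m n) $$ (i, j))"
    if "e < m" "i < d" "c < m" "j < d" for e i c j
  proof -
    have dC: "dim_row (C n) = m" "dim_col (C n) = m" if "n \<le> N" for n using C [OF that] by auto
    have "kronecker (C n) (M ^\<^sub>m n) $$ (e * d + i, c * d + j) = C n $$ (e, c) * (M ^\<^sub>m n) $$ (i, j)" if "n \<le> N" for n
      unfolding kronecker_def using idx [OF \<open>e < m\<close> \<open>i < d\<close>] idx [OF \<open>c < m\<close> \<open>j < d\<close>] \<open>i < d\<close> \<open>j < d\<close> dC [OF that]
      by (simp add: pow_mat_dim_square [of M d] del: pow_mat.simps)
    then show ?thesis
      unfolding A_def mpoly_at_mat_def mat_sum_def using idx [OF that(1,2)] idx [OF that(3,4)] by simp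
  qed
  have z_eq: "z e i = (\<Sum>c<m. \<Sum>n\<le>N. C n $$ (e, c) * cyc_prod d w i n * y c ((i + n) mod d))" if "e < m" "i < d" for e i
  proof -
    have "z e i = (\<Sum>q<m * d. A $$ (e * d + i, q) * v $ q)"
      unfolding z_def using idx [OF that] v dA by (subst mult_mat_vec_index) auto
    also have "\<dots> = (\<Sum>c<m. \<Sum>j<d. A $$ (e * d + i, c * d + j) * y c j)"
      unfolding sum_product_index y_def ..
    also have "\<dots> = (\<Sum>c<m. \<Sum>j<d. \<Sum>n\<le>N. if j = (i + n) mod d then C n $$ (e, c) * cyc_prod d w i n * y c j else 0)"
      using A_index that M_power_index [OF that(2)]
      by (intro sum.cong refl) (auto simp: sum_distrib_right intro!: sum.cong)
    also have "\<dots> = (\<Sum>c<m. \<Sum>n\<le>N. \<Sum>j<d. if j = (i + n) mod d then C n $$ (e, c) * cyc_prod d w i n * y c j else 0)"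
      by (rule sum.cong [OF refl], rule sum.swap)
    also have "\<dots> = (\<Sum>c<m. \<Sum>n\<le>N. C n $$ (e, c) * cyc_prod d w i n * y c ((i + n) mod d))"
      using d_pos by simp
    finally show ?thesis .
  qed
  define R where "R n e c = C n $$ (e, c)" for n e c
  have ny: "l2nn m d y = 1"
    using v1 v by (simp add: l2nn_def y_def vnorm_def sum_product_index)
  have nz: "l2nn m d z = vnorm (A *\<^sub>v v)"
    unfolding l2nn_def z_def vnorm_def dim_mult_mat_vec dA sum_product_index ..
  have "complex_of_real ((l2nn m d z)\<^sup>2) = (\<Sum>e<m. \<Sum>i<d. z e i * cnj (z e i))"
    by (simp add: l2nn_def sum_nonneg complex_norm_square del: of_real_power)
  also have "\<dots> = (\<Sum>e<m. \<Sum>i<d. \<Sum>c<m. \<Sum>n\<le>N. R n e c * cyc_prod d w i n * y c ((i + n) mod d) * cnj (z e i))"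
    using z_eq by (intro sum.cong refl) (simp add: sum_distrib_right R_def)
  also have "\<dots> = (\<Sum>i<d. \<Sum>e<m. \<Sum>c<m. \<Sum>n\<le>N. R n e c * cyc_prod d w i n * y c ((i + n) mod d) * cnj (z e i))"
    by (rule sum.swap)
  also have "\<dots> = shift_form d m N R w y z"
    unfolding shift_form_def by (rule sum_rotate [symmetric])
  also have "\<dots> = shift_form d m N (\<lambda>n e c. R n e c * u ^ n) (\<lambda>i. of_real (a i)) (\<lambda>c i. g i * y c i) (\<lambda>e i. z e i / cnj (g i))"
    using d_pos w_gauge by (intro shift_form_gauge) auto
  finally have eq: "complex_of_real ((l2nn m d z)\<^sup>2) = \<dots>" .
  have "cmod (shift_form d m N (\<lambda>n e c. R n e c * u ^ n) (\<lambda>i. of_real (a i)) (\<lambda>c i. g i * y c i) (\<lambda>e i. z e i / cnj (g i)))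
     \<le> \<Lambda> * l2nn m d (\<lambda>c i. g i * y c i) * l2nn m d (\<lambda>e i. z e i / cnj (g i))"
  proof (rule sb [unfolded shift_bound_def, rule_format])
    fix x assume "x \<in> num_range d a"
    then have "op_norm (mpoly_at m N C (u * x)) \<le> 1" by (intro H) (simp add: numerical_range_eq)
    then have "opbound m (\<lambda>e c. mpoly_at m N C (u * x) $$ (e, c)) 1"
      by (intro opbound_of_op_norm) (auto simp: mpoly_at_def mat_sum_def)
    moreover have "mpoly_at m N C (u * x) $$ (e, c) = (\<Sum>n\<le>N. R n e c * u ^ n * x ^ n)" if "e < m" "c < m" for e c
    proof -
      have "(k \<cdot>\<^sub>m C n) $$ (e, c) = k * C n $$ (e, c)" if "n \<le> N" for n k
        using C [OF that] \<open>e < m\<close> \<open>c < m\<close> by (subst index_smult_mat(1)) auto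
      then show ?thesis
        unfolding mpoly_at_def mat_sum_def using that by (simp add: R_def power_mult_distrib ac_simps)
    qed
    ultimately show "opbound m (\<lambda>e c. \<Sum>n\<le>N. R n e c * u ^ n * x ^ n) 1"
      unfolding opbound_def by simp
  qed
  also have "l2nn m d (\<lambda>c i. g i * y c i) = l2nn m d y" by (simp add: l2nn_def norm_mult norm_g)
  also have "l2nn m d (\<lambda>e i. z e i / cnj (g i)) = l2nn m d z" by (simp add: l2nn_def norm_divide norm_g)
  finally have "(l2nn m d z)\<^sup>2 \<le> \<Lambda> * l2nn m d z"
    unfolding eq [symmetric] ny norm_of_real by simp
  then have le: "vnorm (A *\<^sub>v v) * vnorm (A *\<^sub>v v) \<le> \<Lambda> * vnorm (A *\<^sub>v v)"
    unfolding nz by (simp add: power2_eq_square)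
  \<comment> \<open>Tested on the constant polynomial 1; this settles vectors with
    \<open>A v = 0\<close>, where no division is possible.\<close>
  have "\<Lambda> \<ge> 0"
  proof (rule ccontr)
    assume "\<not> \<Lambda> \<ge> 0"
    have "opbound 1 (\<lambda>e c. \<Sum>n\<le>(0::nat). 1 * x ^ n) 1" for x :: complex
    proof -
      have "cmod (\<eta> (0::nat) * cnj (\<xi> 0)) \<le> l2n 1 \<xi> * l2n 1 \<eta>" for \<xi> \<eta>
        by (simp add: l2n_def L2_set_def norm_mult)
      then show ?thesis by (simp add: opbound_def)
    qed
    then have "cmod (shift_form d 1 0 (\<lambda>n e c. 1) (\<lambda>i. of_real (a i)) (\<lambda>c i. 1) (\<lambda>c i. 1)) \<le> \<Lambda> * l2nn 1 d (\<lambda>c i. 1) * l2nn 1 d (\<lambda>c i. 1)"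
      by (intro sb [unfolded shift_bound_def, rule_format])
    then have "0 \<le> \<Lambda> * (l2nn 1 d (\<lambda>c i. 1) * l2nn 1 d (\<lambda>c i. 1))"
      by (smt (verit) mult.assoc norm_ge_zero)
    moreover have "l2nn 1 d (\<lambda>c i. 1) * l2nn 1 d (\<lambda>c i. 1) > 0" using d_pos by (simp add: l2nn_def)
    ultimately show False using \<open>\<not> \<Lambda> \<ge> 0\<close> by (simp add: zero_le_mult_iff)
  qed
  show "vnorm (mpoly_at_mat m N C M *\<^sub>v v) \<le> \<Lambda>"
    unfolding A_def [symmetric]
  proof (cases "vnorm (A *\<^sub>v v) = 0")
    case False
    then have "vnorm (A *\<^sub>v v) > 0" using vnorm_nonneg [of "A *\<^sub>v v"] by linarith
    then show "vnorm (A *\<^sub>v v) \<le> \<Lambda>" using le by simp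
  qed (use \<open>\<Lambda> \<ge> 0\<close> in simp)
qed

lemma psi_cb_le: assumes "shift_bound d a \<Lambda>" shows "psi_cb M \<le> ereal \<Lambda>"
  unfolding psi_cb_def
  by (rule SUP_least) (use op_norm_mpoly_at_mat_le [OF assms] in auto)

lemma poly_at_mat_index:
  "i < d \<Longrightarrow> j < d \<Longrightarrow> poly_at_mat p M $$ (i, j) = (\<Sum>n\<le>degree p. coeff p n * (M ^\<^sub>m n) $$ (i, j))"
  unfolding poly_at_mat_def mat_sum_def by (simp add: pow_carrier_mat)

text \<open>An entry is bounded by the operator norm. The diagonal unitaries change it only by the
  unimodular factor \<open>g j / g i\<close>.\<close>

lemma psi_ge: assumes pa: "poly_attains d a \<Lambda>" shows "ereal \<Lambda> \<le> psi M"
proof (rule ccontr)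
  assume "\<not> ereal \<Lambda> \<le> psi M"
  then obtain r where r: "psi M < ereal r" "ereal r < ereal \<Lambda>" using ereal_dense2 by (metis not_le)
  then have "\<Lambda> - r > 0" by simp
  then obtain p i k where p: "i < d" "k < d" "\<And>x. x \<in> num_range d a \<Longrightarrow> cmod (poly p x) \<le> 1"
    "\<Lambda> - (\<Lambda> - r) \<le> cmod (\<Sum>n\<in>{n. n \<le> degree p \<and> n mod d = k}. coeff p n * cyc_prod d (\<lambda>i. of_real (a i)) i n)"
    using pa unfolding poly_attains_def by blast
  \<comment> \<open>Scaling the variable by \<open>1 / u\<close> undoes the rotation between the two
    ranges.\<close>
  define p' where "p' = pcompose p [:0, 1 / u:]"
  have cp': "coeff p' n = (1 / u) ^ n * coeff p n" for n
    unfolding p'_def by (rule coeff_pcompose_linear)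
  have dp': "degree p' = degree p" unfolding p'_def by (simp add: degree_pcompose)
  have p'1: "\<forall>z\<in>numerical_range M. cmod (poly p' z) \<le> 1"
    using p(3) by (auto simp: numerical_range_eq p'_def poly_pcompose)
  define j where "j = (i + k) mod d"
  have j: "j < d" using d_pos by (simp add: j_def)
  have nj: "(i + n) mod d = j \<longleftrightarrow> n mod d = k" for n
  proof
    assume "(i + n) mod d = j"
    then have "(int i + int n) mod int d = (int i + int k) mod int d"
      unfolding j_def by (metis of_nat_add zmod_int)
    then have "int n mod int d = int k mod int d" by (metis add_diff_cancel_left' mod_diff_left_eq)
    then have "n mod d = k mod d" by (simp flip: zmod_int)
    then show "n mod d = k" using p(2) by simp
  next
    assume "n mod d = k"
    then show "(i + n) mod d = j" unfolding j_def by (metis mod_add_right_eq)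
  qed
  have "poly_at_mat p' M $$ (i, j) = (\<Sum>n\<le>degree p. coeff p' n * (if n mod d = k then cyc_prod d w i n else 0))"
    unfolding poly_at_mat_index [OF p(1) j] dp' M_power_index [OF p(1) j] nj [symmetric] eq_commute [of j] ..
  also have "\<dots> = (\<Sum>n\<in>{n. n \<le> degree p \<and> n mod d = k}. coeff p' n * cyc_prod d w i n)"
    by (rule sum.mono_neutral_cong_right) auto
  also have "\<dots> = (\<Sum>n\<in>{n. n \<le> degree p \<and> n mod d = k}. coeff p n * cyc_prod d (\<lambda>i. of_real (a i)) i n * (g j / g i))"
  proof (rule sum.cong [OF refl])
    fix n assume "n \<in> {n. n \<le> degree p \<and> n mod d = k}"
    then have "(i + n) mod d = j" using nj by simp
    then show "coeff p' n * cyc_prod d w i n = coeff p n * cyc_prod d (\<lambda>i. of_real (a i)) i n * (g j / g i)"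
      unfolding w_power_gauge cp' using p(1) by (simp add: power_divide)
  qed
  also have "\<dots> = (\<Sum>n\<in>{n. n \<le> degree p \<and> n mod d = k}. coeff p n * cyc_prod d (\<lambda>i. of_real (a i)) i n) * (g j / g i)"
    by (simp only: sum_distrib_right)
  finally have "cmod (poly_at_mat p' M $$ (i, j)) = cmod (\<Sum>n\<in>{n. n \<le> degree p \<and> n mod d = k}. coeff p n * cyc_prod d (\<lambda>i. of_real (a i)) i n)"
    by (simp add: norm_mult norm_divide norm_g)
  then have "r \<le> cmod (poly_at_mat p' M $$ (i, j))" using p(4) by simp
  also have "\<dots> \<le> op_norm (poly_at_mat p' M)"
    using p(1) j by (intro entry_le_op_norm) (auto simp: poly_at_mat_def mat_sum_def)
  finally have "ereal r \<le> ereal (op_norm (poly_at_mat p' M))" by simp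
  also have "\<dots> \<le> psi M" unfolding psi_def using p'1 by (intro SUP_upper) simp
  finally show False using r(1) by simp
qed

text \<open>Scalar polynomials are those with coefficients of size 1, where the Kronecker product
  reduces to a scalar multiple.\<close>

lemma psi_le_psi_cb: "psi M \<le> psi_cb M"
  unfolding psi_def
proof (rule SUP_least)
  fix p assume "p \<in> {p. \<forall>z\<in>numerical_range M. cmod (poly p z) \<le> 1}"
  then have p: "\<And>z. z \<in> numerical_range M \<Longrightarrow> cmod (poly p z) \<le> 1" by simp
  define N where "N = degree p"
  define C where "C n = mat 1 1 (\<lambda>_. coeff p n)" for n
  have "op_norm (mpoly_at 1 N C z) \<le> 1" if z: "z \<in> numerical_range M" for z
  proof (rule op_norm_le)
    define A where "A = mpoly_at 1 N C z"
    have dA: "dim_row A = 1" "dim_col A = 1" by (auto simp: A_def mpoly_at_def mat_sum_def)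
    show "0 < dim_col (mpoly_at 1 N C z)" using dA by (simp add: A_def)
    fix x assume "x \<in> carrier_vec (dim_col (mpoly_at 1 N C z))" and x1: "vnorm x = 1"
    then have x: "dim_vec x = 1" using dA by (simp add: A_def)
    have "A $$ (0, 0) = poly p z"
      by (simp add: A_def mpoly_at_def mat_sum_def C_def N_def poly_altdef mult.commute)
    then have "(A *\<^sub>v x) $ 0 = poly p z * x $ 0" using dA x by (subst mult_mat_vec_index) auto
    moreover have "vnorm (A *\<^sub>v x) = cmod ((A *\<^sub>v x) $ 0)" using dA by (simp add: vnorm_def)
    moreover have "cmod (x $ 0) = 1" using x1 x by (simp add: vnorm_def)
    ultimately show "vnorm (mpoly_at 1 N C z *\<^sub>v x) \<le> 1" using p [OF z] by (simp add: A_def norm_mult)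
  qed
  then have "(1, N, C) \<in> {(m, N, C). m \<ge> 1 \<and> (\<forall>j\<le>N. C j \<in> carrier_mat m m) \<and>
                        (\<forall>z\<in>numerical_range M. op_norm (mpoly_at m N C z) \<le> 1)}"
    by (simp add: C_def)
  then have "(case (1, N, C) of (m, N, C) \<Rightarrow> ereal (op_norm (mpoly_at_mat m N C M))) \<le> psi_cb M"
    unfolding psi_cb_def by (rule SUP_upper)
  moreover have "mpoly_at_mat 1 N C M = poly_at_mat p M"
  proof (rule eq_matI)
    fix i j assume "i < dim_row (poly_at_mat p M)" "j < dim_col (poly_at_mat p M)"
    then have ij: "i < d" "j < d" by (auto simp: poly_at_mat_def mat_sum_def)
    show "mpoly_at_mat 1 N C M $$ (i, j) = poly_at_mat p M $$ (i, j)"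
      unfolding poly_at_mat_index [OF ij] mpoly_at_mat_def mat_sum_def using ij
      by (simp add: kronecker_def C_def N_def)
  qed (auto simp: mpoly_at_mat_def poly_at_mat_def mat_sum_def)
  ultimately show "ereal (op_norm (poly_at_mat p M)) \<le> psi_cb M" by simp
qed

end

theorem theorem2:
  fixes d :: nat and \<alpha> :: "nat \<Rightarrow> complex" and M :: "complex mat"
  assumes "d \<ge> 1"
    and "M = cyclic_perm_mat d * mat_diag d (\<lambda>i. \<alpha> (i + 1))"
  shows "psi M = psi_cb M \<and> psi_cb M \<le> 2 \<and>
    ((\<Prod>i=1..d. \<alpha> i) \<noteq> 0 \<longrightarrow> psi M = psi_cb M \<and> psi_cb M < 2)"
proof -
  interpret cyclic_matrix d \<alpha> M using assms by unfold_locales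
  have "0 \<le> a i" for i by (simp add: a_def)
  then obtain \<Lambda> where \<Lambda>: "shift_bound d a \<Lambda>" "poly_attains d a \<Lambda>" "\<Lambda> \<le> 2" "(\<Prod>i<d. a i) \<noteq> 0 \<Longrightarrow> \<Lambda> < 2"
    using cyclic_weights_main [OF d, of a] by blast
  have cb: "psi_cb M = ereal \<Lambda>" "psi M = ereal \<Lambda>"
    using psi_cb_le [OF \<Lambda>(1)] psi_ge [OF \<Lambda>(2)] psi_le_psi_cb by (auto intro: antisym order_trans)
  have "(\<Prod>i<d. a i) \<noteq> 0" if "(\<Prod>i=1..d. \<alpha> i) \<noteq> 0"
  proof -
    \<comment> \<open>The weights are a cyclic relabelling of the \<alpha>, with the same
      product.\<close>
    have "(\<Prod>i<d. w i) = (\<Prod>i<d. \<alpha> (i + 1))"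
      unfolding w_def using prod.reindex_bij_betw [OF bij_betw_add_mod, of "\<lambda>i. \<alpha> (i + 1)" 1 d] by simp
    also have "\<dots> = (\<Prod>i=1..d. \<alpha> i)"
      by (rule prod.reindex_bij_witness [of _ "\<lambda>i. i - 1" "\<lambda>i. i + 1"]) auto
    finally have "(\<Prod>i<d. w i) = (\<Prod>i=1..d. \<alpha> i)" .
    moreover have "(\<Prod>i<d. a i) = cmod (\<Prod>i<d. w i)" unfolding a_def by (rule prod_norm)
    ultimately show ?thesis using that by (metis norm_eq_zero)
  qed
  moreover have "psi_cb M \<le> 2" unfolding cb using \<Lambda>(3) by simp
  moreover have "psi_cb M < 2" if "\<Lambda> < 2" unfolding cb using that by simp
  ultimately show ?thesis using \<Lambda>(4) cb by auto
qed

end
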